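(* Let $(\mathscr E,t)=\{t_k\}_{k\in\mathbb Z}$ be an $\mathcal A$-Hilbert complex. (i) The complex $(\mathscr E,t)$ has strong Hodge decomposition if and only if, for every $k$, the differential map $t_k$ has closed range. (ii) If $(\mathscr E,t)$ has finite length, then $(\mathscr E,t)$ has strong Hodge decomposition if and only if the even Dirac operator $\mathcal D^+_t$ has closed range.
   Context: $\mathcal A$ is a fixed complex C*-algebra. Hilbert $\mathcal A$-modules are right Hilbert C*-modules over $\mathcal A$; $\oplus$ is the orthogonal direct sum. A densely defined $\mathcal A$-linear operator $t\colon \mathrm{dom}(t)\subset \mathscr E\to\mathscr F$ is semi-regular if its adjoint $t^*$ is densely defined; a semi-regular $t$ is regular if it is closed and $1+t^*t$ has dense range. $\mathcal R_{\mathcal A}(\mathscr E,\mathscr F)$ denotes the set of regular operators. An $\mathcal A$-Hilbert complex $(\mathscr E,t)$ is a sequence of regular operators $t_k\in\mathcal R_{\mathcal A}(\mathscr E_k,\mathscr E_{k+1})$, $k\in\mathbb Z$ (its differential maps), between Hilbert $\mathcal A$-modules, with $\mathrm{ran}(t_k)\subset\ker(t_{k+1})$ for all $k$. It has finite length if $\mathscr E_k=0$ for $|k|$ large; it is then indexed so that $\mathscr E_k=0$ unless $0\le k\le N+1$, written $\{t_k\}_{k=0}^N$, and $t_k=0$ (everywhere defined) for $k<0$ or $k>N$. The complex has strong Hodge decomposition if for all $k\in\mathbb Z$, $\mathscr E_k=(\ker t_k\cap\ker t_{k-1}^* )\oplus\mathrm{ran}(t_k^* )\oplus\mathrm{ran}(t_{k-1})$.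 For a finite-length complex put $\mathscr E_{\mathrm{ev}}=\bigoplus_k\mathscr E_{2k}$, $\mathscr E_{\mathrm{odd}}=\bigoplus_k\mathscr E_{2k+1}$. The even Dirac operator $\mathcal D^+_t\colon\mathrm{dom}(\mathcal D^+_t)\subset\mathscr E_{\mathrm{ev}}\to\mathscr E_{\mathrm{odd}}$ has domain $\bigoplus_k \mathrm{dom}(t_{2k})\cap\mathrm{dom}(t_{2k-1}^* )$ and is given by $\mathcal D^+_t(x_{2k})_k=(t_{2k}x_{2k}+t_{2k+1}^*x_{2k+2})_k$. *)

theory Defs
  imports "HOL-Analysis.Analysis" "HOL-Algebra.AbelCoset"
begin

section \<open>C*-algebras\<close>

text \<open>Complex C*-algebras, not necessarily unital. The real structure of the library class is
  required to be the restriction of the complex one.\<close>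

class cstar_algebra = real_normed_algebra + banach +
  fixes scaleC :: "complex \<Rightarrow> 'a \<Rightarrow> 'a" (infixr \<open>*\<^sub>C\<close> 75)
    and cstar :: "'a \<Rightarrow> 'a"
  assumes scaleC_add_right: "c *\<^sub>C (x + y) = c *\<^sub>C x + c *\<^sub>C y"
    and scaleC_add_left: "(c + d) *\<^sub>C x = c *\<^sub>C x + d *\<^sub>C x"
    and scaleC_scaleC: "c *\<^sub>C d *\<^sub>C x = (c * d) *\<^sub>C x"
    and scaleC_of_real: "complex_of_real r *\<^sub>C x = r *\<^sub>R x"
    and mult_scaleC_left: "(c *\<^sub>C x) * y = c *\<^sub>C (x * y)"
    and mult_scaleC_right: "x * (c *\<^sub>C y) = c *\<^sub>C (x * y)"
    and norm_scaleC: "norm (c *\<^sub>C x) = cmod c * norm x"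
    and cstar_cstar: "cstar (cstar x) = x"
    and cstar_add: "cstar (x + y) = cstar x + cstar y"
    and cstar_scaleC: "cstar (c *\<^sub>C x) = cnj c *\<^sub>C cstar x"
    and cstar_mult: "cstar (x * y) = cstar y * cstar x"
    and norm_cstar_mult_self: "norm (cstar x * x) = (norm x)\<^sup>2"

definition cpositive :: "'a::cstar_algebra \<Rightarrow> bool" where
  "cpositive a \<longleftrightarrow> (\<exists>b. a = cstar b * b)"


section \<open>Hilbert modules\<close>

text \<open>Modules are carrier-based, so that a sequence of different modules can be formed over one
  element type. The fields \<open>mult\<close> and \<open>one\<close> inherited from the ring record are unused.\<close>

record ('a, 'e) hilbert_mod = "'e ring" +
  ract :: "'e \<Rightarrow> 'a \<Rightarrow> 'e"
  csmult :: "complex \<Rightarrow> 'e \<Rightarrow> 'e"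
  ip :: "'e \<Rightarrow> 'e \<Rightarrow> 'a"

definition hnorm :: "('a::cstar_algebra, 'e) hilbert_mod \<Rightarrow> 'e \<Rightarrow> real" where
  "hnorm E x = sqrt (norm (ip E x x))"

text \<open>The value \<open>0\<close> outside the carrier makes \<open>hdist\<close> symmetric everywhere, as the locale
  \<open>Metric_space\<close> demands.\<close>

definition hdist :: "('a::cstar_algebra, 'e) hilbert_mod \<Rightarrow> 'e \<Rightarrow> 'e \<Rightarrow> real" where
  "hdist E x y = (if x \<in> carrier E \<and> y \<in> carrier E then hnorm E (x \<ominus>\<^bsub>E\<^esub> y) else 0)"

definition htopology :: "('a::cstar_algebra, 'e) hilbert_mod \<Rightarrow> 'e topology" where
  "htopology E = Metric_space.mtopology (carrier E) (hdist E)"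

locale pre_hilbert_module = abelian_group E
  for E :: "('a::cstar_algebra, 'e) hilbert_mod" (structure) +
  assumes ract_closed: "x \<in> carrier E \<Longrightarrow> ract E x a \<in> carrier E"
    and ract_add_left: "\<lbrakk>x \<in> carrier E; y \<in> carrier E\<rbrakk> \<Longrightarrow> ract E (x \<oplus> y) a = ract E x a \<oplus> ract E y a"
    and ract_add_right: "x \<in> carrier E \<Longrightarrow> ract E x (a + b) = ract E x a \<oplus> ract E x b"
    and ract_mult: "x \<in> carrier E \<Longrightarrow> ract E x (a * b) = ract E (ract E x a) b"
    and csmult_closed: "x \<in> carrier E \<Longrightarrow> csmult E c x \<in> carrier E"
    and csmult_add_right: "\<lbrakk>x \<in> carrier E; y \<in> carrier E\<rbrakk> \<Longrightarrow> csmult E c (x \<oplus> y) = csmult E c x \<oplus> csmult E c y"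
    and csmult_add_left: "x \<in> carrier E \<Longrightarrow> csmult E (c + d) x = csmult E c x \<oplus> csmult E d x"
    and csmult_mult: "x \<in> carrier E \<Longrightarrow> csmult E (c * d) x = csmult E c (csmult E d x)"
    and csmult_one: "x \<in> carrier E \<Longrightarrow> csmult E 1 x = x"
    and csmult_ract: "x \<in> carrier E \<Longrightarrow> csmult E c (ract E x a) = ract E (csmult E c x) a"
    and ract_scaleC: "x \<in> carrier E \<Longrightarrow> ract E x (c *\<^sub>C a) = csmult E c (ract E x a)"
    and ip_add_right: "\<lbrakk>x \<in> carrier E; y \<in> carrier E; z \<in> carrier E\<rbrakk> \<Longrightarrow> ip E x (y \<oplus> z) = ip E x y + ip E x z"
    and ip_ract_right: "\<lbrakk>x \<in> carrier E; y \<in> carrier E\<rbrakk> \<Longrightarrow> ip E x (ract E y a) = ip E x y * a"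
    and ip_csmult_right: "\<lbrakk>x \<in> carrier E; y \<in> carrier E\<rbrakk> \<Longrightarrow> ip E x (csmult E c y) = c *\<^sub>C ip E x y"
    and ip_cstar: "\<lbrakk>x \<in> carrier E; y \<in> carrier E\<rbrakk> \<Longrightarrow> ip E y x = cstar (ip E x y)"
    and ip_positive: "x \<in> carrier E \<Longrightarrow> cpositive (ip E x x)"
    and ip_definite: "\<lbrakk>x \<in> carrier E; ip E x x = 0\<rbrakk> \<Longrightarrow> x = \<zero>"

locale hilbert_module = pre_hilbert_module +
  assumes complete: "Metric_space.mcomplete (carrier E) (hdist E)"

definition orthogonal_sets :: "('a::cstar_algebra, 'e) hilbert_mod \<Rightarrow> 'e set \<Rightarrow> 'e set \<Rightarrow> bool" where
  "orthogonal_sets E X Y \<longleftrightarrow> (\<forall>x\<in>X. \<forall>y\<in>Y. ip E x y = 0)"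

text \<open>\<open>E\<close> is the internal orthogonal direct sum of \<open>X\<close>, \<open>Y\<close> and \<open>Z\<close>; that the summands of a vector
  are unique follows from orthogonality.\<close>

definition orthogonal_sum3 ::
    "('a::cstar_algebra, 'e) hilbert_mod \<Rightarrow> 'e set \<Rightarrow> 'e set \<Rightarrow> 'e set \<Rightarrow> bool" where
  "orthogonal_sum3 E X Y Z \<longleftrightarrow>
     carrier E = X <+>\<^bsub>E\<^esub> Y <+>\<^bsub>E\<^esub> Z \<and>
     orthogonal_sets E X Y \<and> orthogonal_sets E X Z \<and> orthogonal_sets E Y Z"

text \<open>External orthogonal direct sum. It is only used for families with finitely many nonzero
  members; for these every family of vectors has finite support and the sum is complete.\<close>

definition hilbert_sum ::
    "('i \<Rightarrow> ('a::cstar_algebra, 'e) hilbert_mod) \<Rightarrow> ('a, 'i \<Rightarrow> 'e) hilbert_mod" where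
  "hilbert_sum M =
    \<lparr>carrier = {x. (\<forall>i. x i \<in> carrier (M i)) \<and> finite {i. x i \<noteq> \<zero>\<^bsub>M i\<^esub>}},
     mult = undefined, one = undefined,
     zero = (\<lambda>i. \<zero>\<^bsub>M i\<^esub>),
     add = (\<lambda>x y i. x i \<oplus>\<^bsub>M i\<^esub> y i),
     ract = (\<lambda>x a i. ract (M i) (x i) a),
     csmult = (\<lambda>c x i. csmult (M i) c (x i)),
     ip = (\<lambda>x y. \<Sum>i | x i \<noteq> \<zero>\<^bsub>M i\<^esub>. ip (M i) (x i) (y i))\<rparr>"


section \<open>Unbounded operators\<close>

text \<open>The values of \<open>app_of t\<close> outside \<open>dom_of t\<close> are irrelevant.\<close>

record ('e, 'f) unbounded_op =
  dom_of :: "'e set"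
  app_of :: "'e \<Rightarrow> 'f"

definition ran_of :: "('e, 'f) unbounded_op \<Rightarrow> 'f set" where
  "ran_of t = app_of t ` dom_of t"

definition ker_of :: "('a::cstar_algebra, 'f) hilbert_mod \<Rightarrow> ('e, 'f) unbounded_op \<Rightarrow> 'e set" where
  "ker_of F t = {x \<in> dom_of t. app_of t x = \<zero>\<^bsub>F\<^esub>}"

definition graph_of :: "('e, 'f) unbounded_op \<Rightarrow> ('e \<times> 'f) set" where
  "graph_of t = (\<lambda>x. (x, app_of t x)) ` dom_of t"

definition dense_in :: "('a::cstar_algebra, 'e) hilbert_mod \<Rightarrow> 'e set \<Rightarrow> bool" where
  "dense_in E X \<longleftrightarrow> htopology E closure_of X = carrier E"

definition linear_op ::
    "('a::cstar_algebra, 'e) hilbert_mod \<Rightarrow> ('a, 'f) hilbert_mod \<Rightarrow> ('e, 'f) unbounded_op \<Rightarrow> bool" where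
  "linear_op E F t \<longleftrightarrow>
     dom_of t \<subseteq> carrier E \<and> app_of t ` dom_of t \<subseteq> carrier F \<and> \<zero>\<^bsub>E\<^esub> \<in> dom_of t \<and>
     (\<forall>x\<in>dom_of t. \<forall>y\<in>dom_of t. x \<oplus>\<^bsub>E\<^esub> y \<in> dom_of t \<and>
        app_of t (x \<oplus>\<^bsub>E\<^esub> y) = app_of t x \<oplus>\<^bsub>F\<^esub> app_of t y) \<and>
     (\<forall>x\<in>dom_of t. \<forall>c. csmult E c x \<in> dom_of t \<and>
        app_of t (csmult E c x) = csmult F c (app_of t x)) \<and>
     (\<forall>x\<in>dom_of t. \<forall>a. ract E x a \<in> dom_of t \<and>
        app_of t (ract E x a) = ract F (app_of t x) a)"

definition densely_defined_op ::
    "('a::cstar_algebra, 'e) hilbert_mod \<Rightarrow> ('a, 'f) hilbert_mod \<Rightarrow> ('e, 'f) unbounded_op \<Rightarrow> bool" where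
  "densely_defined_op E F t \<longleftrightarrow> linear_op E F t \<and> dense_in E (dom_of t)"

text \<open>The vector described by \<open>THE\<close> is unique as soon as \<open>t\<close> is densely defined.\<close>

definition adjoint_op ::
    "('a::cstar_algebra, 'e) hilbert_mod \<Rightarrow> ('a, 'f) hilbert_mod \<Rightarrow> ('e, 'f) unbounded_op \<Rightarrow>
     ('f, 'e) unbounded_op" where
  "adjoint_op E F t =
    \<lparr>dom_of = {y \<in> carrier F. \<exists>z\<in>carrier E. \<forall>x\<in>dom_of t. ip F (app_of t x) y = ip E x z},
     app_of = (\<lambda>y. THE z. z \<in> carrier E \<and> (\<forall>x\<in>dom_of t. ip F (app_of t x) y = ip E x z))\<rparr>"

definition comp_op ::
    "('f, 'g) unbounded_op \<Rightarrow> ('e, 'f) unbounded_op \<Rightarrow> ('e, 'g) unbounded_op" where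
  "comp_op s t =
    \<lparr>dom_of = {x \<in> dom_of t. app_of t x \<in> dom_of s}, app_of = (\<lambda>x. app_of s (app_of t x))\<rparr>"

definition one_plus_op ::
    "('a::cstar_algebra, 'e) hilbert_mod \<Rightarrow> ('e, 'e) unbounded_op \<Rightarrow> ('e, 'e) unbounded_op" where
  "one_plus_op E s = \<lparr>dom_of = dom_of s, app_of = (\<lambda>x. x \<oplus>\<^bsub>E\<^esub> app_of s x)\<rparr>"

definition semiregular_op ::
    "('a::cstar_algebra, 'e) hilbert_mod \<Rightarrow> ('a, 'f) hilbert_mod \<Rightarrow> ('e, 'f) unbounded_op \<Rightarrow> bool" where
  "semiregular_op E F t \<longleftrightarrow>
     densely_defined_op E F t \<and> dense_in F (dom_of (adjoint_op E F t))"

definition closed_op ::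
    "('a::cstar_algebra, 'e) hilbert_mod \<Rightarrow> ('a, 'f) hilbert_mod \<Rightarrow> ('e, 'f) unbounded_op \<Rightarrow> bool" where
  "closed_op E F t \<longleftrightarrow> closedin (prod_topology (htopology E) (htopology F)) (graph_of t)"

definition regular_op ::
    "('a::cstar_algebra, 'e) hilbert_mod \<Rightarrow> ('a, 'f) hilbert_mod \<Rightarrow> ('e, 'f) unbounded_op \<Rightarrow> bool" where
  "regular_op E F t \<longleftrightarrow>
     semiregular_op E F t \<and> closed_op E F t \<and>
     dense_in E (ran_of (one_plus_op E (comp_op (adjoint_op E F t) t)))"

definition closed_range :: "('a::cstar_algebra, 'f) hilbert_mod \<Rightarrow> ('e, 'f) unbounded_op \<Rightarrow> bool" where
  "closed_range F t \<longleftrightarrow> closedin (htopology F) (ran_of t)"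


section \<open>Hilbert complexes\<close>

text \<open>A single element type \<open>'e\<close> for all the modules is no restriction: an arbitrary sequence of
  modules can be realised on the disjoint union of the underlying sets.\<close>

definition hilbert_complex ::
    "(int \<Rightarrow> ('a::cstar_algebra, 'e) hilbert_mod) \<Rightarrow> (int \<Rightarrow> ('e, 'e) unbounded_op) \<Rightarrow> bool" where
  "hilbert_complex E t \<longleftrightarrow>
     (\<forall>k. hilbert_module (E k)) \<and>
     (\<forall>k. regular_op (E k) (E (k + 1)) (t k)) \<and>
     (\<forall>k. ran_of (t k) \<subseteq> ker_of (E (k + 2)) (t (k + 1)))"

definition complex_adj ::
    "(int \<Rightarrow> ('a::cstar_algebra, 'e) hilbert_mod) \<Rightarrow> (int \<Rightarrow> ('e, 'e) unbounded_op) \<Rightarrow>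
     int \<Rightarrow> ('e, 'e) unbounded_op" where
  "complex_adj E t k = adjoint_op (E k) (E (k + 1)) (t k)"

definition strong_hodge_decomposition ::
    "(int \<Rightarrow> ('a::cstar_algebra, 'e) hilbert_mod) \<Rightarrow> (int \<Rightarrow> ('e, 'e) unbounded_op) \<Rightarrow> bool" where
  "strong_hodge_decomposition E t \<longleftrightarrow>
     (\<forall>k. orthogonal_sum3 (E k)
        (ker_of (E (k + 1)) (t k) \<inter> ker_of (E (k - 1)) (complex_adj E t (k - 1)))
        (ran_of (complex_adj E t k))
        (ran_of (t (k - 1))))"

text \<open>No normalisation of the indices is imposed: a complex supported in \<open>{0..N + 1}\<close> is a special
  case. Differentials into or out of a zero module are automatically zero and everywhere defined,
  being densely defined and closed.\<close>

definition finite_length :: "(int \<Rightarrow> ('a::cstar_algebra, 'e) hilbert_mod) \<Rightarrow> bool" where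
  "finite_length E \<longleftrightarrow> (\<exists>K. \<forall>k. \<bar>k\<bar> > K \<longrightarrow> carrier (E k) = {\<zero>\<^bsub>E k\<^esub>})"

definition even_part ::
    "(int \<Rightarrow> ('a::cstar_algebra, 'e) hilbert_mod) \<Rightarrow> ('a, int \<Rightarrow> 'e) hilbert_mod" where
  "even_part E = hilbert_sum (\<lambda>k. E (2 * k))"

definition odd_part ::
    "(int \<Rightarrow> ('a::cstar_algebra, 'e) hilbert_mod) \<Rightarrow> ('a, int \<Rightarrow> 'e) hilbert_mod" where
  "odd_part E = hilbert_sum (\<lambda>k. E (2 * k + 1))"

text \<open>Component \<open>k\<close> of an element of \<open>even_part E\<close> is its entry in \<open>E (2 * k)\<close>.\<close>

definition even_dirac ::
    "(int \<Rightarrow> ('a::cstar_algebra, 'e) hilbert_mod) \<Rightarrow> (int \<Rightarrow> ('e, 'e) unbounded_op) \<Rightarrow>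
     (int \<Rightarrow> 'e, int \<Rightarrow> 'e) unbounded_op" where
  "even_dirac E t =
    \<lparr>dom_of = {x \<in> carrier (even_part E).
        \<forall>k. x k \<in> dom_of (t (2 * k)) \<inter> dom_of (complex_adj E t (2 * k - 1))},
     app_of = (\<lambda>x k. app_of (t (2 * k)) (x k) \<oplus>\<^bsub>E (2 * k + 1)\<^esub>
        app_of (complex_adj E t (2 * k + 1)) (x (k + 1)))\<rparr>"

end

theory Submission
  imports Defs "HOL-Real_Asymp.Real_Asymp"
begin

text \<open>The theorem rests on one fact about a single operator: if \<open>t\<close> is regular with adjoint \<open>t\<^sup>*\<close> and \<open>ran t\<close>
  is closed, then \<open>E = ker t \<oplus> ran t\<^sup>*\<close> and \<open>F = ker t\<^sup>* \<oplus> ran t\<close> (\<open>domain_decomposition\<close>,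
  \<open>codomain_decomposition\<close>). Closed submodules of Hilbert modules need not be complemented, so
  regularity has to enter; it does so through the surjectivity of \<open>1 + t\<^sup>* t\<close> and \<open>1 + t t\<^sup>*\<close>. Every
  vector is \<open>u + t\<^sup>* t u\<close>, so it suffices to split \<open>u \<in> dom t\<close>, that is, to solve \<open>t t\<^sup>* v = t u\<close>. On the
  Hilbert module \<open>ran t\<close> the uniform boundedness principle bounds \<open>t\<^sup>*\<close> from below; this bounds
  \<open>\<mu> + t t\<^sup>*\<close> from below uniformly in \<open>\<mu> \<ge> 0\<close>. Since \<open>1 + t t\<^sup>*\<close> maps onto \<open>ran t\<close>, the method of continuity
  reaches \<open>\<mu> = 0\<close> by finitely many contraction arguments (\<open>ran_surj\<close>).

  For part (i), closed ranges of \<open>t\<^sub>k\<close> and \<open>t\<^sub>k\<^sub>-\<^sub>1\<close> give two decompositions of \<open>E\<^sub>k\<close> that combine to the Hodge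
  decomposition. Conversely, a summand of an orthogonal decomposition is an orthogonal complement
  and hence closed.

  For part (ii), let \<open>D\<close> be the even Dirac operator and \<open>D'\<close> its formal adjoint, the odd one. Applying
  the above fact to \<open>D\<close> only takes the surjectivity of \<open>1 + D' D\<close> and \<open>1 + D D'\<close>, and this holds in every
  degree: since \<open>t\<^sub>k t\<^sub>k\<^sub>-\<^sub>1 = 0\<close>, the operator \<open>1 + t\<^sub>k\<^sup>* t\<^sub>k + t\<^sub>k\<^sub>-\<^sub>1 t\<^sub>k\<^sub>-\<^sub>1\<^sup>*\<close> is inverted by inverting
  \<open>1 + t\<^sub>k\<^sub>-\<^sub>1 t\<^sub>k\<^sub>-\<^sub>1\<^sup>*\<close> and then \<open>1 + t\<^sub>k\<^sup>* t\<^sub>k\<close>. The resulting decompositions of the even and the odd part are,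
  component by component, the Hodge decompositions. Conversely, the Hodge decompositions in all
  degrees identify \<open>ran D\<close> as the orthogonal complement of the harmonic vectors of odd degree.

  All of this uses that the norm of a Hilbert module is a norm for which the inner product is
  continuous, and that \<open>\<parallel>\<langle>x, x\<rangle>\<parallel> \<le> \<parallel>\<langle>x, x\<rangle> + \<langle>y, y\<rangle>\<parallel>\<close>. Behind it is the theorem that the elements \<open>b\<^sup>* b\<close> of a
  C*-algebra form a cone on which the norm is monotone. It is proved here without spectral theory,
  from square roots obtained by iteration and from the C*-identity; algebras without unit are
  embedded in their multiplier algebras for this purpose.\<close>

section \<open>Identities in C*-algebras\<close>

text \<open>The class admits \<open>1 = 0\<close>, because the multiplier algebra of the zero algebra is again zero.\<close>

class unital_cstar_algebra = cstar_algebra + monoid_mult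

lemma scaleC_zero_right [simp]: "c *\<^sub>C 0 = 0"
  using scaleC_add_right[of c 0 0] by simp

lemma scaleC_zero_left [simp]: "0 *\<^sub>C x = 0"
  using scaleC_add_left[of 0 0 x] by simp

lemma scaleC_one [simp]: "1 *\<^sub>C x = x"
  using scaleC_of_real[of 1 x] by simp

lemma scaleC_minus1 [simp]: "(-1) *\<^sub>C x = - x"
  using scaleC_of_real[of "-1" x] by simp

lemma scaleC_minus_right: "c *\<^sub>C (- x) = - (c *\<^sub>C x)"
  using scaleC_add_right[of c x "-x"] by (simp add: eq_neg_iff_add_eq_0 add.commute)

lemma scaleC_minus_left: "(- c) *\<^sub>C x = - (c *\<^sub>C x)"
  using scaleC_add_left[of c "-c" x] by (simp add: eq_neg_iff_add_eq_0 add.commute)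

lemma scaleC_diff_right: "c *\<^sub>C (x - y) = c *\<^sub>C x - c *\<^sub>C y"
  using scaleC_add_right[of c x "-y"] by (simp add: scaleC_minus_right)

lemma cstar_zero [simp]: "cstar 0 = 0"
  using cstar_add[of 0 0] by simp

lemma cstar_minus: "cstar (- x) = - cstar x"
  using cstar_add[of x "-x"] by (simp add: eq_neg_iff_add_eq_0 add.commute)

lemma cstar_diff: "cstar (x - y) = cstar x - cstar y"
  using cstar_add[of x "-y"] by (simp add: cstar_minus)

lemma cstar_scaleR: "cstar (r *\<^sub>R x) = r *\<^sub>R cstar x"
  using cstar_scaleC[of "complex_of_real r" x] by (simp add: scaleC_of_real)

lemma norm_cstar [simp]: "norm (cstar x) = norm x"
proof -
  have le: "norm y \<le> norm (cstar y)" for y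
  proof (cases "norm y = 0")
    case False
    have "norm y * norm y \<le> norm (cstar y) * norm y"
      using norm_mult_ineq[of "cstar y" y] norm_cstar_mult_self[of y] by (simp add: power2_eq_square)
    then show ?thesis using False by simp
  qed simp
  show ?thesis using le[of x] le[of "cstar x"] by (simp add: cstar_cstar)
qed

lemma norm_mult_cstar_self: "norm (x * cstar x) = (norm x)\<^sup>2"
  using norm_cstar_mult_self[of "cstar x"] by (simp add: cstar_cstar)

lemma norm_self_adjoint_square: "cstar a = a \<Longrightarrow> norm (a * a) = (norm a)\<^sup>2"
  using norm_cstar_mult_self[of a] by simp

lemma eq_zero_if_cstar_mult_zero: "cstar x * x = 0 \<Longrightarrow> x = 0"
  using norm_cstar_mult_self[of x] by simp

lemma tendsto_cstar:
  assumes "(f \<longlongrightarrow> a) F"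
  shows "((\<lambda>n. cstar (f n)) \<longlongrightarrow> cstar a) F"
proof (rule LIM_zero_cancel, rule tendsto_norm_zero_cancel)
  have "((\<lambda>n. norm (f n - a)) \<longlongrightarrow> 0) F"
    by (rule tendsto_norm_zero[OF LIM_zero[OF assms]])
  then show "((\<lambda>n. norm (cstar (f n) - cstar a)) \<longlongrightarrow> 0) F"
    by (simp flip: cstar_diff)
qed

text \<open>\<open>2 Re a = a + a\<^sup>*\<close> and \<open>2 Im a = - \<i> (a - a\<^sup>*)\<close> turn \<open>a\<^sup>* a + a a\<^sup>*\<close> into squares of
  self-adjoint elements.\<close>

lemma cartesian_decomposition:
  obtains x y where "cstar x = x" "cstar y = y"
    "cstar a * a + a * cstar a = 2 *\<^sub>R (x * x) + 2 *\<^sub>R (y * y)"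
proof
  define x where "x = (1/2) *\<^sub>R (a + cstar a)"
  define y where "y = (- \<i> / 2) *\<^sub>C (a - cstar a)"
  show "cstar x = x" by (simp add: x_def cstar_scaleR cstar_add cstar_cstar add.commute)
  show "cstar y = y"
    by (simp add: y_def cstar_scaleC cstar_diff cstar_cstar)
       (metis minus_diff_eq scaleC_minus_left scaleC_minus_right)
  have "y * y = complex_of_real (- 1/4) *\<^sub>C ((a - cstar a) * (a - cstar a))"
    by (simp add: y_def mult_scaleC_left mult_scaleC_right scaleC_scaleC)
  then have yy: "y * y = (1/4) *\<^sub>R - ((a - cstar a) * (a - cstar a))"
    unfolding scaleC_of_real by simp
  have "2 *\<^sub>R (x * x) + 2 *\<^sub>R (y * y) =
      (1/2) *\<^sub>R ((a + cstar a) * (a + cstar a) - (a - cstar a) * (a - cstar a))"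
    by (simp add: yy x_def scaleR_diff_right)
  also have "(a + cstar a) * (a + cstar a) - (a - cstar a) * (a - cstar a) =
      2 *\<^sub>R (cstar a * a + a * cstar a)"
    by (simp add: algebra_simps scaleR_2)
  finally show "cstar a * a + a * cstar a = 2 *\<^sub>R (x * x) + 2 *\<^sub>R (y * y)" by simp
qed

lemma cstar_one [simp]: "cstar (1::'a::unital_cstar_algebra) = 1"
  by (metis cstar_cstar cstar_mult mult_1_left mult_1_right)

lemma norm_one_le: "norm (1::'a::unital_cstar_algebra) \<le> 1"
proof -
  have "(norm (1::'a))\<^sup>2 = norm (1::'a)" using norm_cstar_mult_self[of "1::'a"] by simp
  then show ?thesis by (auto simp: power2_eq_square)
qed

lemma norm_scaleR_one_le: "r \<ge> 0 \<Longrightarrow> norm (r *\<^sub>R 1 :: 'a::unital_cstar_algebra) \<le> r"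
  using norm_one_le mult_left_mono[of "norm (1::'a)" 1 r] by simp

lemma norm_power_le: "norm (x ^ n :: 'a::unital_cstar_algebra) \<le> norm x ^ n"
proof (induction n)
  case 0 show ?case using norm_one_le by simp
next
  case (Suc n)
  have "norm (x * x ^ n) \<le> norm x * norm (x ^ n)" by (rule norm_mult_ineq)
  also have "\<dots> \<le> norm x * norm x ^ n" using Suc by (simp add: mult_left_mono)
  finally show ?case by simp
qed

lemma cstar_power: "cstar (x ^ n :: 'a::unital_cstar_algebra) = cstar x ^ n"
  by (induction n) (simp_all add: cstar_mult power_commutes)

text \<open>The C*-identity makes the norm of a self-adjoint element equal to its spectral radius; the
  powers \<open>2 ^ n\<close> suffice to exploit this.\<close>

lemma norm_self_adjoint_power:
  fixes a :: "'a::unital_cstar_algebra"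
  assumes "cstar a = a"
  shows "norm (a ^ (2 ^ n)) = norm a ^ (2 ^ n)"
proof (induction n)
  case 0 show ?case by simp
next
  case (Suc n)
  have "a ^ (2 ^ Suc n) = a ^ (2 ^ n) * a ^ (2 ^ n)" by (simp add: power_add[symmetric] mult_2)
  moreover have "norm (a ^ (2 ^ n) * a ^ (2 ^ n)) = (norm (a ^ (2 ^ n)))\<^sup>2"
    using assms by (intro norm_self_adjoint_square) (simp add: cstar_power)
  ultimately show ?case using Suc by (simp add: power_mult[symmetric] mult.commute[of 2])
qed

section \<open>Positivity in unital C*-algebras\<close>

text \<open>A limit \<open>y\<close> of this iteration solves \<open>y = (z + y\<^sup>2) / 2\<close>, that is, \<open>(1 - y)\<^sup>2 = 1 - z\<close>. The real
  sequence for \<open>z = 1\<close> serves as a majorant.\<close>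

fun sqrt_iter :: "'a::{real_algebra} \<Rightarrow> nat \<Rightarrow> 'a" where
  "sqrt_iter z 0 = 0"
| "sqrt_iter z (Suc n) = (1/2) *\<^sub>R (z + sqrt_iter z n * sqrt_iter z n)"

lemma sqrt_iter_commute: "w * z = z * w \<Longrightarrow> w * sqrt_iter z n = sqrt_iter z n * w"
  by (induction n) (simp_all add: algebra_simps, metis mult.assoc)

lemma sqrt_iter_real:
  shows "0 \<le> sqrt_iter (1::real) n" "sqrt_iter (1::real) n \<le> sqrt_iter 1 (Suc n)"
    "sqrt_iter (1::real) n \<le> 1"
proof -
  show pos: "0 \<le> sqrt_iter (1::real) n" for n by (induction n) auto
  show le: "sqrt_iter (1::real) n \<le> 1" for n
  proof (induction n)
    case (Suc n)
    have "sqrt_iter (1::real) n * sqrt_iter 1 n \<le> 1 * 1"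
      using Suc pos by (intro mult_mono) auto
    then show ?case by simp
  qed simp
  show "sqrt_iter (1::real) n \<le> sqrt_iter 1 (Suc n)"
    using sum_squares_ge_zero[of "sqrt_iter (1::real) n - 1" 0] by (simp add: algebra_simps)
qed

text \<open>Successive increments satisfy
  \<open>y\<^sub>n\<^sub>+\<^sub>2 - y\<^sub>n\<^sub>+\<^sub>1 = (y\<^sub>n\<^sub>+\<^sub>1 - y\<^sub>n) (y\<^sub>n\<^sub>+\<^sub>1 + y\<^sub>n) / 2\<close>, for \<open>z\<close> as well as for the majorant.\<close>

lemma sqrt_iter_norm:
  fixes z :: "'a::unital_cstar_algebra"
  assumes "norm z \<le> 1"
  shows "norm (sqrt_iter z n) \<le> sqrt_iter 1 n"
    "norm (sqrt_iter z (Suc n) - sqrt_iter z n) \<le> sqrt_iter 1 (Suc n) - sqrt_iter 1 n"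
proof -
  show le: "norm (sqrt_iter z n) \<le> sqrt_iter 1 n" for n
  proof (induction n)
    case (Suc n)
    have "norm (z + sqrt_iter z n * sqrt_iter z n) \<le> norm z + norm (sqrt_iter z n) * norm (sqrt_iter z n)"
      by (rule order_trans[OF norm_triangle_ineq]) (simp add: norm_mult_ineq)
    also have "\<dots> \<le> 1 + sqrt_iter 1 n * sqrt_iter 1 n"
      using assms Suc by (intro add_mono mult_mono) (auto simp: sqrt_iter_real)
    finally show ?case by simp
  qed simp
  show "norm (sqrt_iter z (Suc n) - sqrt_iter z n) \<le> sqrt_iter 1 (Suc n) - sqrt_iter 1 n"
  proof (induction n)
    case 0 show ?case using assms by simp
  next
    case (Suc n)
    let ?y = "sqrt_iter z" and ?e = "sqrt_iter (1::real)"
    have comm: "?y n * ?y m = ?y m * ?y n" for n m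
      by (intro sqrt_iter_commute sqrt_iter_commute[symmetric]) simp
    have "?y (Suc (Suc n)) - ?y (Suc n) = (1/2) *\<^sub>R (?y (Suc n) * ?y (Suc n) - ?y n * ?y n)"
      unfolding sqrt_iter.simps(2)[of z "Suc n"] sqrt_iter.simps(2)[of z n, THEN arg_cong[where f="\<lambda>u. _ - u"]]
      by (simp only: scaleR_diff_right[symmetric]) simp
    also have "\<dots> = (1/2) *\<^sub>R ((?y (Suc n) - ?y n) * (?y (Suc n) + ?y n))"
      using comm[of n "Suc n"] by (simp only: algebra_simps)
    finally have "norm (?y (Suc (Suc n)) - ?y (Suc n)) \<le> (1/2) * (norm (?y (Suc n) - ?y n) * norm (?y (Suc n) + ?y n))"
      using norm_mult_ineq[of "?y (Suc n) - ?y n" "?y (Suc n) + ?y n"] by (simp only: norm_scaleR)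
    also have "\<dots> \<le> (1/2) * ((?e (Suc n) - ?e n) * (?e (Suc n) + ?e n))"
    proof -
      have "norm (?y (Suc n) + ?y n) \<le> ?e (Suc n) + ?e n"
        using norm_triangle_ineq[of "?y (Suc n)" "?y n"] le[of "Suc n"] le[of n] by linarith
      then show ?thesis
        using Suc sqrt_iter_real(2)[of n] by (intro mult_left_mono mult_mono) auto
    qed
    also have "\<dots> = ?e (Suc (Suc n)) - ?e (Suc n)"
      unfolding sqrt_iter.simps(2)[of 1 "Suc n"] sqrt_iter.simps(2)[of 1 n, THEN arg_cong[where f="\<lambda>u. _ - u"]]
      by (simp only: real_scaleR_def) (simp only: algebra_simps)
    finally show ?case .
  qed
qed

lemma sqrt_iter_real_tendsto: "sqrt_iter (1::real) \<longlonglongrightarrow> 1"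
proof -
  have "incseq (sqrt_iter (1::real))" using sqrt_iter_real(2) by (intro incseq_SucI)
  then obtain L where L: "sqrt_iter (1::real) \<longlonglongrightarrow> L"
    using incseq_convergent[of "sqrt_iter 1" 1] sqrt_iter_real(3) by blast
  have "(\<lambda>n. sqrt_iter (1::real) (Suc n)) \<longlonglongrightarrow> (1/2) * (1 + L * L)"
    unfolding sqrt_iter.simps real_scaleR_def by (intro tendsto_intros L)
  then have "L = (1/2) * (1 + L * L)"
    using LIMSEQ_Suc[OF L] LIMSEQ_unique by blast
  then have "(L - 1) * (L - 1) = 0" by (simp add: algebra_simps)
  then show ?thesis using L by simp
qed

text \<open>The last two clauses record what the limit inherits from the iterates: it commutes with all
  elements that commute with \<open>z\<close>, and \<open>s\<close> lies in every closed right ideal that contains \<open>1 - z\<close>.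
  The latter brings square roots back from the multiplier algebra into the algebra itself.\<close>

lemma sqrt_one_minus_exists:
  fixes z :: "'a::unital_cstar_algebra"
  assumes sa: "cstar z = z" and z: "norm z \<le> 1"
  obtains s where "cstar s = s" "s * s = 1 - z" "norm (1 - s) \<le> 1"
    "\<And>w. w * z = z * w \<Longrightarrow> w * s = s * w"
    "\<And>I. \<lbrakk>closed I; subspace I; \<And>x y. x \<in> I \<Longrightarrow> x * y \<in> I; z - 1 \<in> I\<rbrakk> \<Longrightarrow> s \<in> I"
proof -
  let ?y = "sqrt_iter z" and ?e = "sqrt_iter (1::real)"
  have "summable (\<lambda>n. ?e (Suc n) - ?e n)"
    by (rule telescope_summable[OF sqrt_iter_real_tendsto])
  then have "summable (\<lambda>n. ?y (Suc n) - ?y n)"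
    by (rule summable_comparison_test[rotated]) (use sqrt_iter_norm(2)[OF z] in blast)
  from summable_LIMSEQ[OF this] obtain y where y: "?y \<longlonglongrightarrow> y"
    by (auto simp: sum_lessThan_telescope simp del: sqrt_iter.simps(2))
  have "(\<lambda>n. ?y (Suc n)) \<longlonglongrightarrow> (1/2) *\<^sub>R (z + y * y)"
    unfolding sqrt_iter.simps by (intro tendsto_intros y)
  then have fixpt: "y = (1/2) *\<^sub>R (z + y * y)"
    using LIMSEQ_Suc[OF y] LIMSEQ_unique by blast
  show thesis
  proof
    have "cstar (?y n) = ?y n" for n
      by (induction n) (simp_all add: cstar_scaleR cstar_add cstar_mult sa)
    moreover have "(\<lambda>n. cstar (?y n)) \<longlonglongrightarrow> cstar y"
      by (rule tendsto_cstar[OF y])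
    ultimately have "cstar y = y" using y LIMSEQ_unique by auto
    then show "cstar (1 - y) = 1 - y" by (simp add: cstar_diff)
    have "y + y = z + y * y"
      using arg_cong[OF fixpt, of "\<lambda>u. 2 *\<^sub>R u"] unfolding scaleR_scaleR by (simp add: scaleR_2)
    then have "z = y + y - y * y" by (metis add_diff_cancel_right')
    then show "(1 - y) * (1 - y) = 1 - z" by (simp add: algebra_simps)
    have "norm (?y n) \<le> 1" for n
      using sqrt_iter_norm(1)[OF z, of n] sqrt_iter_real(3)[of n] by linarith
    then have "norm y \<le> 1" using LIMSEQ_le_const2[OF tendsto_norm[OF y]] by blast
    then show "norm (1 - (1 - y)) \<le> 1" by simp
    fix w assume "w * z = z * w"
    then have comm: "w * ?y n = ?y n * w" for n by (rule sqrt_iter_commute)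
    have "(\<lambda>n. w * ?y n) \<longlonglongrightarrow> w * y" by (intro tendsto_intros y)
    moreover have "(\<lambda>n. w * ?y n) \<longlonglongrightarrow> y * w"
      unfolding comm by (intro tendsto_intros y)
    ultimately have "w * y = y * w" by (rule LIMSEQ_unique)
    then show "w * (1 - y) = (1 - y) * w" by (simp add: algebra_simps)
  next
    fix I assume cl: "closed I" and sub: "subspace I" and id: "\<And>x y. x \<in> I \<Longrightarrow> x * y \<in> I"
      and zI: "z - 1 \<in> I"
    \<comment> \<open>The iterates for \<open>z\<close> and for \<open>1\<close> agree modulo \<open>I\<close>, and the latter tend to \<open>1\<close>.\<close>
    have "?y n - ?e n *\<^sub>R 1 \<in> I" for n
    proof (induction n)
      case 0 show ?case using subspace_0[OF sub] by simp
    next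
      case (Suc n)
      have eq: "?y (Suc n) - ?e (Suc n) *\<^sub>R 1 =
          (1/2) *\<^sub>R ((z - 1) + (?y n - ?e n *\<^sub>R 1) * (?y n + ?e n *\<^sub>R 1))"
      proof -
        have "(?y n - ?e n *\<^sub>R 1) * (?y n + ?e n *\<^sub>R 1) = ?y n * ?y n - (?e n * ?e n) *\<^sub>R 1"
          by (simp add: algebra_simps)
        then show ?thesis
          by (simp add: scaleR_diff_right scaleR_add_right scaleR_add_left add_divide_distrib)
      qed
      show ?case unfolding eq
        by (rule subspace_scale[OF sub], rule subspace_add[OF sub zI], rule id, rule Suc)
    qed
    moreover have "(\<lambda>n. ?y n - ?e n *\<^sub>R 1) \<longlonglongrightarrow> y - 1 *\<^sub>R 1"
      by (intro tendsto_intros y sqrt_iter_real_tendsto)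
    ultimately have "y - 1 *\<^sub>R 1 \<in> I" by (rule closed_sequentially[OF cl])
    then show "1 - y \<in> I" using subspace_neg[OF sub, of "y - 1"] by simp
  qed
qed

text \<open>Here positivity is the existence of a self-adjoint square root, which is what the norm estimates
  below produce. That every \<open>b\<^sup>* b\<close> is of this form is the hard fact
  \<open>positive_cstar_mult_self\<close>.\<close>

definition positive :: "'a::cstar_algebra \<Rightarrow> bool" where
  "positive a \<longleftrightarrow> (\<exists>s. cstar s = s \<and> a = s * s)"

lemma positive_self_adjoint: "positive a \<Longrightarrow> cstar a = a"
  by (auto simp: positive_def cstar_mult)

lemma positive_scaleR: "positive a \<Longrightarrow> r \<ge> 0 \<Longrightarrow> positive (r *\<^sub>R a)"
  unfolding positive_def
proof (elim exE conjE)
  fix s assume "r \<ge> 0" "cstar s = s" "a = s * s"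
  then show "\<exists>s. cstar s = s \<and> r *\<^sub>R a = s * s"
    by (intro exI[of _ "sqrt r *\<^sub>R s"]) (simp add: cstar_scaleR)
qed

text \<open>For \<open>k = \<surd>(1 - h\<^sup>2)\<close> the element \<open>u = h + \<i> k\<close> is unitary, and \<open>1 - h\<^sup>2 = (2 - u\<^sup>2 - (u\<^sup>*)\<^sup>2) / 4\<close>.\<close>

lemma norm_one_minus_square_le:
  fixes h :: "'a::unital_cstar_algebra"
  assumes h: "cstar h = h" "norm h \<le> 1"
  shows "norm (1 - h * h) \<le> 1"
proof -
  have "norm (h * h) \<le> 1"
    using h norm_self_adjoint_square[of h] by (simp add: power_le_one)
  then obtain k where k: "cstar k = k" "k * k = 1 - h * h" "h * k = k * h"
    using sqrt_one_minus_exists[of "h * h"] h(1)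
    by (metis (no_types, lifting) cstar_mult mult.assoc)
  define u where "u = h + \<i> *\<^sub>C k"
  define v where "v = h - \<i> *\<^sub>C k"
  have uv: "cstar u = v" by (simp add: u_def v_def cstar_add cstar_scaleC h k scaleC_minus_left)
  have "v * u = h * h + k * k"
    using k(3) by (simp add: u_def v_def algebra_simps mult_scaleC_left mult_scaleC_right scaleC_scaleC
      scaleC_diff_right scaleC_add_right)
  then have "v * u = 1" using k by simp
  then have "(norm u)\<^sup>2 \<le> 1"
    using norm_cstar_mult_self[of u] uv norm_one_le by (metis)
  then have nu: "norm u \<le> 1" by (simp add: abs_le_square_iff[of "norm u" 1, simplified])
  then have nv: "norm v \<le> 1" using uv norm_cstar[of u] by simp
  have "u * u + v * v = 2 *\<^sub>R (h * h - k * k)"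
    by (simp add: u_def v_def algebra_simps mult_scaleC_left mult_scaleC_right scaleC_scaleC
      scaleC_diff_right scaleC_add_right scaleR_2)
  also have "h * h - k * k = 2 *\<^sub>R (h * h) - 1" using k(2) by (simp add: scaleR_2)
  finally have "2 *\<^sub>R 1 - u * u - v * v = 2 *\<^sub>R 1 - (4 *\<^sub>R (h * h) - 2 *\<^sub>R 1)"
    by (simp add: scaleR_diff_right diff_diff_add)
  also have "\<dots> = 4 *\<^sub>R (1 - h * h)"
    by (simp add: scaleR_diff_right flip: scaleR_add_left)
  finally have "2 *\<^sub>R 1 - u * u - v * v = 4 *\<^sub>R (1 - h * h)" .
  then have "1 - h * h = (1/4) *\<^sub>R (2 *\<^sub>R 1 - u * u - v * v)" by simp
  moreover have "norm (2 *\<^sub>R 1 - u * u - v * v) \<le> 2 + 1 + 1"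
  proof -
    have "norm (u * u) \<le> 1" "norm (v * v) \<le> 1"
      using norm_mult_ineq[of u u] norm_mult_ineq[of v v] nu nv
        mult_le_one[of "norm u" "norm u"] mult_le_one[of "norm v" "norm v"] by auto
    then show ?thesis
      using norm_triangle_ineq4[of "2 *\<^sub>R 1 - u * u" "v * v"]
        norm_triangle_ineq4[of "2 *\<^sub>R 1" "u * u"] norm_scaleR_one_le[of 2, where 'a='a] by linarith
  qed
  ultimately show ?thesis by simp
qed

lemma positive_sqrt:
  fixes a :: "'a::unital_cstar_algebra"
  assumes sa: "cstar a = a" and r: "r > 0" and a: "norm (r *\<^sub>R 1 - a) \<le> r"
  obtains s where "cstar s = s" "a = s * s" "norm (sqrt r *\<^sub>R 1 - s) \<le> sqrt r"
    "\<And>w. w * a = a * w \<Longrightarrow> w * s = s * w"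
    "\<And>I. \<lbrakk>closed I; subspace I; \<And>x y. x \<in> I \<Longrightarrow> x * y \<in> I; a \<in> I\<rbrakk> \<Longrightarrow> s \<in> I"
proof -
  define z where "z = 1 - (1/r) *\<^sub>R a"
  have "norm z = (1/r) * norm (r *\<^sub>R 1 - a)"
  proof -
    have "z = (1/r) *\<^sub>R (r *\<^sub>R 1 - a)" using r by (simp add: z_def algebra_simps)
    then show ?thesis using r by simp
  qed
  then have "norm z \<le> 1" using a r by (simp add: divide_le_eq)
  moreover have "cstar z = z" by (simp add: z_def cstar_diff cstar_scaleR sa)
  ultimately obtain s where s: "cstar s = s" "s * s = 1 - z" "norm (1 - s) \<le> 1"
    "\<And>w. w * z = z * w \<Longrightarrow> w * s = s * w"
    "\<And>I. \<lbrakk>closed I; subspace I; \<And>x y. x \<in> I \<Longrightarrow> x * y \<in> I; z - 1 \<in> I\<rbrakk> \<Longrightarrow> s \<in> I"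
    using sqrt_one_minus_exists by metis
  show thesis
  proof
    show "cstar (sqrt r *\<^sub>R s) = sqrt r *\<^sub>R s" by (simp add: cstar_scaleR s)
    show "a = (sqrt r *\<^sub>R s) * (sqrt r *\<^sub>R s)" using r by (simp add: s z_def)
    have "sqrt r *\<^sub>R 1 - sqrt r *\<^sub>R s = sqrt r *\<^sub>R (1 - s)" by (simp add: algebra_simps)
    then show "norm (sqrt r *\<^sub>R 1 - sqrt r *\<^sub>R s) \<le> sqrt r" using s(3) r
      by (simp add: mult_left_le)
    show "w * sqrt r *\<^sub>R s = sqrt r *\<^sub>R s * w" if "w * a = a * w" for w
      using s(4)[of w] that by (simp add: z_def algebra_simps)
    show "sqrt r *\<^sub>R s \<in> I" if "closed I" "subspace I" "\<And>x y. x \<in> I \<Longrightarrow> x * y \<in> I" "a \<in> I" for I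
    proof -
      have "z - 1 \<in> I" using subspace_scale[OF that(2,4), of "- (1/r)"] by (simp add: z_def)
      then show ?thesis using s(5) that by (simp add: subspace_scale)
    qed
  qed
qed

text \<open>This description by the norm makes it evident that sums of positive elements are positive.\<close>

lemma positive_iff_norm:
  fixes a :: "'a::unital_cstar_algebra"
  shows "positive a \<longleftrightarrow> cstar a = a \<and> (\<exists>r>0. norm (r *\<^sub>R 1 - a) \<le> r)"
proof
  assume "cstar a = a \<and> (\<exists>r>0. norm (r *\<^sub>R 1 - a) \<le> r)"
  then show "positive a" unfolding positive_def using positive_sqrt by metis
next
  assume pa: "positive a"
  then obtain s where s: "cstar s = s" "a = s * s" unfolding positive_def by auto
  define c where "c = norm s + 1"
  have c: "c > 0" "norm s \<le> c" by (auto simp: c_def add_nonneg_pos)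
  have "norm (1 - ((1/c) *\<^sub>R s) * ((1/c) *\<^sub>R s)) \<le> 1"
    using c s by (intro norm_one_minus_square_le) (auto simp: cstar_scaleR divide_simps)
  moreover have "(c * c) *\<^sub>R 1 - a = (c * c) *\<^sub>R (1 - ((1/c) *\<^sub>R s) * ((1/c) *\<^sub>R s))"
    using c by (simp add: s algebra_simps)
  ultimately have "norm ((c * c) *\<^sub>R 1 - a) \<le> c * c" by (simp add: mult_left_le)
  then show "cstar a = a \<and> (\<exists>r>0. norm (r *\<^sub>R 1 - a) \<le> r)"
    using pa c by (auto simp: positive_self_adjoint intro!: exI[of _ "c * c"])
qed

lemma positive_add:
  fixes a b :: "'a::unital_cstar_algebra"
  assumes "positive a" "positive b"
  shows "positive (a + b)"
proof -
  obtain r q where r: "r > 0" "norm (r *\<^sub>R 1 - a) \<le> r" and q: "q > 0" "norm (q *\<^sub>R 1 - b) \<le> q"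
    using assms by (auto simp: positive_iff_norm)
  have "(r + q) *\<^sub>R 1 - (a + b) = (r *\<^sub>R 1 - a) + (q *\<^sub>R 1 - b)" by (simp add: algebra_simps)
  then have "norm ((r + q) *\<^sub>R 1 - (a + b)) \<le> r + q"
    using r q by (metis add_mono norm_triangle_le)
  then show ?thesis using assms r q
    by (auto simp: positive_iff_norm cstar_add intro!: exI[of _ "r + q"])
qed

lemma positive_upper_bound:
  fixes a :: "'a::unital_cstar_algebra"
  assumes "positive a" "norm a \<le> r" "r > 0"
  shows "positive (r *\<^sub>R 1 - a)"
  unfolding positive_iff_norm using assms positive_self_adjoint[OF assms(1)]
  by (auto simp: cstar_diff cstar_scaleR intro!: exI[of _ r])

text \<open>Let \<open>a = s\<^sup>2\<close> and \<open>r - a = k\<^sup>2\<close> with commuting self-adjoint \<open>s\<close>, \<open>k\<close>. Then \<open>u = s + \<i> k\<close> satisfies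
  \<open>u\<^sup>* u = r\<close>, and \<open>s\<close> is the real part of \<open>u\<close>.\<close>

lemma norm_le_if_positive_diff:
  fixes a :: "'a::unital_cstar_algebra"
  assumes a: "positive a" and ra: "positive (r *\<^sub>R 1 - a)" and r: "r \<ge> 0"
  shows "norm a \<le> r"
proof -
  obtain s where s: "cstar s = s" "a = s * s" using a unfolding positive_def by auto
  obtain k where k: "cstar k = k" "r *\<^sub>R 1 - a = k * k"
      "\<And>w. w * (r *\<^sub>R 1 - a) = (r *\<^sub>R 1 - a) * w \<Longrightarrow> w * k = k * w"
    using ra positive_sqrt unfolding positive_iff_norm by metis
  have sk: "s * k = k * s" by (rule k(3)) (simp add: s algebra_simps)
  define u where "u = s + \<i> *\<^sub>C k"
  have cu: "cstar u = s - \<i> *\<^sub>C k" by (simp add: u_def cstar_add cstar_scaleC s k scaleC_minus_left)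
  have "cstar u * u = s * s + k * k"
    unfolding cu using sk
    by (simp add: u_def algebra_simps mult_scaleC_left mult_scaleC_right scaleC_scaleC
      scaleC_diff_right scaleC_add_right)
  then have "cstar u * u = r *\<^sub>R 1" using s k(2) by (metis add_diff_cancel_left' diff_add_cancel add.commute)
  then have "(norm u)\<^sup>2 \<le> r"
    using norm_cstar_mult_self[of u] norm_scaleR_one_le[OF r, where 'a='a] by metis
  moreover have "s = (1/2) *\<^sub>R (u + cstar u)" unfolding cu by (simp add: u_def flip: scaleR_2)
  then have "norm s \<le> norm u"
    using norm_triangle_ineq[of u "cstar u"] by simp
  ultimately have "(norm s)\<^sup>2 \<le> r" by (meson power_mono norm_ge_zero order_trans)
  then show ?thesis using norm_self_adjoint_square[OF s(1)] s(2) by simp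
qed

lemma positive_norm_mono:
  fixes a b :: "'a::unital_cstar_algebra"
  assumes "positive a" "positive b"
  shows "norm a \<le> norm (a + b)"
proof (rule field_le_epsilon)
  fix e :: real assume e: "e > 0"
  let ?r = "norm (a + b) + e"
  have r: "?r > 0" using e by (simp add: add_nonneg_pos)
  have "positive (?r *\<^sub>R 1 - (a + b) + b)"
    using assms e r by (intro positive_add positive_upper_bound) auto
  then have "positive (?r *\<^sub>R 1 - a)" by (simp add: algebra_simps)
  then show "norm a \<le> ?r" using assms r by (intro norm_le_if_positive_diff) auto
qed

text \<open>From \<open>w\<^sup>n\<^sup>+\<^sup>1 = r w\<^sup>n - w\<^sup>n v\<close> the norm of \<open>w\<^sup>n\<close> exceeds \<open>r\<^sup>n\<close> by a factor that is at most linear in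
  \<open>n\<close>, and such a factor disappears when roots are taken. This replaces the comparison of the
  spectra of \<open>c\<^sup>* c\<close> and \<open>c c\<^sup>*\<close>.\<close>

lemma norm_le_if_powers_linear:
  fixes v w :: "'a::unital_cstar_algebra"
  assumes sa: "cstar w = w" and w: "w = r *\<^sub>R 1 - v" and r: "r > 0"
    and K: "\<And>j. norm (w ^ j * v) \<le> r ^ j * K"
  shows "norm w \<le> r"
proof (rule ccontr)
  assume "\<not> norm w \<le> r"
  define d where "d = norm w / r - 1"
  have d: "d > 0" "norm w = r * (1 + d)"
    using \<open>\<not> norm w \<le> r\<close> r by (simp_all add: d_def field_simps)
  have "K \<ge> 0" using K[of 0] norm_ge_zero[of "w ^ 0 * v"] by (simp del: norm_ge_zero)
  have bd: "norm (w ^ n) \<le> r ^ n * (1 + n * (K / r))" for n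
  proof (induction n)
    case 0 show ?case using norm_one_le by simp
  next
    case (Suc n)
    have "w ^ Suc n = w ^ n * (r *\<^sub>R 1 - v)" by (simp add: w power_commutes)
    also have "\<dots> = r *\<^sub>R w ^ n - w ^ n * v" by (simp add: algebra_simps)
    finally have "norm (w ^ Suc n) \<le> r * norm (w ^ n) + norm (w ^ n * v)"
      using norm_triangle_ineq4[of "r *\<^sub>R w ^ n" "w ^ n * v"] r by simp
    also have "\<dots> \<le> r * (r ^ n * (1 + n * (K / r))) + r ^ n * K"
      using Suc K[of n] r by (intro add_mono mult_left_mono) auto
    also have "\<dots> = r ^ Suc n * (1 + Suc n * (K / r))" using r by (simp add: field_simps)
    finally show ?case .
  qed
  have "(1 + d) ^ (2 ^ n) \<le> 1 + 2 ^ n * (K / r)" for n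
  proof -
    have "(r * (1 + d)) ^ (2 ^ n) \<le> r ^ (2 ^ n) * (1 + 2 ^ n * (K / r))"
      using bd[of "2 ^ n"] norm_self_adjoint_power[OF sa, of n] d by simp
    then show ?thesis using r by (simp add: power_mult_distrib)
  qed
  moreover have "eventually (\<lambda>n::nat. (1 + d) ^ (2 ^ n) > 1 + 2 ^ n * (K / r)) sequentially"
    using d by real_asymp
  ultimately have "eventually (\<lambda>n::nat. False) sequentially"
    by (auto elim!: eventually_mono simp: not_less[symmetric])
  then show False by simp
qed

text \<open>\<open>(r - c\<^sup>* c)\<^sup>j c\<^sup>* c = c\<^sup>* (r - c c\<^sup>*)\<^sup>j c\<close>, so the powers of \<open>r - c\<^sup>* c\<close> are controlled by those of
  \<open>r - c c\<^sup>*\<close>.\<close>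

lemma positive_swap:
  fixes c :: "'a::unital_cstar_algebra"
  assumes "positive (c * cstar c)"
  shows "positive (cstar c * c)"
proof -
  obtain r where r: "r > 0" "norm (r *\<^sub>R 1 - c * cstar c) \<le> r"
    using assms by (auto simp: positive_iff_norm)
  let ?w = "r *\<^sub>R 1 - cstar c * c" and ?w' = "r *\<^sub>R 1 - c * cstar c"
  have eq: "?w ^ j * (cstar c * c) = cstar c * (?w' ^ j * c)" for j
  proof (induction j)
    case (Suc j)
    have "?w ^ Suc j * (cstar c * c) = ?w * (cstar c * (?w' ^ j * c))"
      using Suc by (simp add: mult.assoc)
    also have "\<dots> = cstar c * (?w' * (?w' ^ j * c))" by (simp add: algebra_simps)
    finally show ?case by (simp add: mult.assoc)
  qed (simp add: mult.assoc)
  have "norm (?w ^ j * (cstar c * c)) \<le> r ^ j * (norm c)\<^sup>2" for j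
  proof -
    have "norm (cstar c * (?w' ^ j * c)) \<le> norm (cstar c) * (norm (?w' ^ j) * norm c)"
      by (meson norm_mult_ineq mult_left_mono norm_ge_zero order_trans)
    also have "\<dots> \<le> norm c * (r ^ j * norm c)"
      using r norm_power_le[of ?w' j] power_mono[OF r(2), of j]
      by (intro mult_mono) (auto intro: order_trans)
    finally show ?thesis by (simp add: eq power2_eq_square mult_ac)
  qed
  then have "norm ?w \<le> r"
    by (rule norm_le_if_powers_linear[OF _ refl r(1), rotated])
      (simp add: cstar_diff cstar_scaleR cstar_mult cstar_cstar)
  then show ?thesis using r(1) unfolding positive_iff_norm
    by (intro conjI exI[of _ r]) (simp_all add: cstar_mult cstar_cstar)
qed

text \<open>Since \<open>p q = 0\<close>, \<open>(r - q)\<^sup>j q = (r - (p + q))\<^sup>j q\<close>.\<close>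

lemma positive_orthogonal_summand:
  fixes p q :: "'a::unital_cstar_algebra"
  assumes sa: "cstar q = q" and pq: "p * q = 0" and pos: "positive (p + q)"
  shows "positive q"
proof -
  obtain r where r: "r > 0" "norm (r *\<^sub>R 1 - (p + q)) \<le> r"
    using pos by (auto simp: positive_iff_norm)
  let ?w = "r *\<^sub>R 1 - q" and ?w' = "r *\<^sub>R 1 - (p + q)"
  have comm: "?w ^ j * q = q * ?w ^ j" for j
    by (rule power_commuting_commutes) (simp add: algebra_simps)
  have eq: "?w ^ j * q = ?w' ^ j * q" for j
  proof (induction j)
    case (Suc j)
    have "?w' ^ Suc j * q = ?w' * (?w' ^ j * q)" by (simp add: mult.assoc)
    also have "\<dots> = ?w' * (q * ?w ^ j)" using Suc comm by simp
    also have "\<dots> = (r *\<^sub>R q - (p * q + q * q)) * ?w ^ j" by (simp add: algebra_simps)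
    also have "\<dots> = ?w * (q * ?w ^ j)" using pq by (simp add: algebra_simps)
    also have "\<dots> = ?w ^ Suc j * q" using comm by (simp add: mult.assoc)
    finally show ?case by simp
  qed simp
  have "norm (?w ^ j * q) \<le> r ^ j * norm q" for j
  proof -
    have "norm (?w' ^ j * q) \<le> norm (?w' ^ j) * norm q" by (rule norm_mult_ineq)
    also have "\<dots> \<le> r ^ j * norm q"
      using r norm_power_le[of ?w' j] power_mono[OF r(2), of j]
      by (intro mult_right_mono) (auto intro: order_trans)
    finally show ?thesis by (simp add: eq)
  qed
  then have "norm ?w \<le> r"
    by (rule norm_le_if_powers_linear[OF _ refl r(1), rotated])
      (simp add: cstar_diff cstar_scaleR sa)
  then show ?thesis using r(1) sa unfolding positive_iff_norm by (intro conjI exI[of _ r])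
qed

lemma positive_antisym:
  fixes a :: "'a::unital_cstar_algebra"
  assumes "positive a" "positive (- a)"
  shows "a = 0"
  using positive_norm_mono[OF assms] by simp

text \<open>Kaplansky's argument. Let \<open>h = b\<^sup>* b\<close>, \<open>m = \<surd>(h\<^sup>2)\<close>, and let \<open>q = (m - h) / 2\<close> be the negative part of \<open>h\<close>.
  For \<open>c = b q\<close> one has \<open>c\<^sup>* c = - q\<^sup>3\<close>, while \<open>c\<^sup>* c + c c\<^sup>*\<close> is a sum of squares; so \<open>c c\<^sup>*\<close> is
  positive, hence so is \<open>c\<^sup>* c = - q\<^sup>3\<close>, and \<open>q\<close> vanishes.\<close>

theorem positive_cstar_mult_self:
  fixes b :: "'a::unital_cstar_algebra"
  shows "positive (cstar b * b)"
proof -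
  define h where "h = cstar b * b"
  have h: "cstar h = h" by (simp add: h_def cstar_mult cstar_cstar)
  then have "positive (h * h)" by (auto simp: positive_def)
  then obtain r where r: "r > 0" "norm (r *\<^sub>R 1 - h * h) \<le> r"
    by (auto simp: positive_iff_norm)
  obtain m where m: "cstar m = m" "h * h = m * m" "norm (sqrt r *\<^sub>R 1 - m) \<le> sqrt r"
      "\<And>w. w * (h * h) = (h * h) * w \<Longrightarrow> w * m = m * w"
    using positive_sqrt[OF _ r] by (metis cstar_mult h)
  have hm: "h * m = m * h" using m(4)[of h] by (simp add: mult.assoc)
  have pm: "positive m"
    unfolding positive_iff_norm using m(1,3) r(1) by (intro conjI exI[of _ "sqrt r"]) simp_all
  define p where "p = (1/2) *\<^sub>R (m + h)"
  define q where "q = (1/2) *\<^sub>R (m - h)"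
  have q: "cstar q = q" by (simp add: q_def cstar_scaleR cstar_diff m h)
  have p: "cstar p = p" by (simp add: p_def cstar_scaleR cstar_add m h)
  have pq: "p * q = 0" using hm m(2) by (simp add: p_def q_def algebra_simps)
  have sum: "p + q = m" by (simp add: p_def q_def flip: scaleR_add_right scaleR_2)
  have diff: "h = p - q" by (simp add: p_def q_def flip: scaleR_diff_right scaleR_2)
  have pos_q: "positive q" by (rule positive_orthogonal_summand[OF q pq]) (simp add: sum pm)
  then obtain s where s: "cstar s = s" "q = s * s" by (auto simp: positive_def)
  have q3: "positive (q * q * q)"
    unfolding positive_def using s by (intro exI[of _ "s * s * s"]) (simp add: cstar_mult mult.assoc)
  define c where "c = b * q"
  have "cstar c * c = q * h * q" by (simp add: c_def h_def cstar_mult q mult.assoc)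
  also have "\<dots> = - (q * q * q)" using pq by (simp add: diff algebra_simps)
  finally have cc: "cstar c * c = - (q * q * q)" .
  obtain x y where xy: "cstar x = x" "cstar y = y"
      "cstar c * c + c * cstar c = 2 *\<^sub>R (x * x) + 2 *\<^sub>R (y * y)"
    by (rule cartesian_decomposition)
  have "c * cstar c = (2 *\<^sub>R (x * x) + 2 *\<^sub>R (y * y)) + q * q * q"
    using xy(3) cc by (simp add: algebra_simps)
  moreover have "positive (x * x)" "positive (y * y)" using xy by (auto simp: positive_def)
  ultimately have "positive (c * cstar c)"
    using q3 by (simp add: positive_add positive_scaleR)
  then have "positive (- (q * q * q))" using positive_swap cc by metis
  with q3 have "q * q * q = 0" by (rule positive_antisym)
  then have "(q * q) * (q * q) = 0" by (metis mult.assoc mult_zero_left)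
  then have "q = 0"
    using eq_zero_if_cstar_mult_zero[of q] eq_zero_if_cstar_mult_zero[of "q * q"] q
    by (simp add: cstar_mult)
  then show ?thesis using pm sum diff by (simp add: h_def)
qed

section \<open>The multiplier algebra\<close>

text \<open>A multiplier is an operator \<open>T\<close> on the algebra together with an adjoint \<open>S\<close> for the inner product
  \<open>\<langle>a, b\<rangle> = a\<^sup>* b\<close>. Multipliers form a unital C*-algebra that contains the given algebra as a closed
  ideal, and arguments that need a unit are carried out there.\<close>

typedef (overloaded) 'a multiplier =
  "{(T :: 'a::cstar_algebra \<Rightarrow>\<^sub>L 'a, S :: 'a \<Rightarrow>\<^sub>L 'a).
    \<forall>a b. cstar (blinfun_apply T a) * b = cstar a * blinfun_apply S b}"
  by (intro exI[of _ "(0, 0)"]) auto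

setup_lifting type_definition_multiplier

lemma multiplier_swap:
  assumes "\<And>a b. cstar (blinfun_apply T a) * b = cstar a * blinfun_apply S b"
  shows "cstar (S a) * b = cstar a * T b"
  using arg_cong[OF assms[of b a], of cstar] by (simp add: cstar_mult cstar_cstar)

text \<open>\<open>\<parallel>T b\<parallel>\<^sup>2 = \<parallel>b\<^sup>* S T b\<parallel>\<close>.\<close>

lemma norm_multiplier_pair:
  assumes "\<And>a b. cstar (blinfun_apply T a) * b = cstar a * blinfun_apply S b"
  shows "(norm T)\<^sup>2 \<le> norm (S o\<^sub>L T)" "norm T = norm S"
proof -
  have 1: "(norm T)\<^sup>2 \<le> norm (S o\<^sub>L T)"
    if TS: "\<And>a b. cstar (blinfun_apply T a) * b = cstar a * blinfun_apply S b" for T S :: "'a \<Rightarrow>\<^sub>L 'a"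
  proof -
    have "norm T \<le> sqrt (norm (S o\<^sub>L T))"
    proof (rule norm_blinfun_bound)
      fix b
      have "(norm (T b))\<^sup>2 = norm (cstar b * (S o\<^sub>L T) b)"
        using TS[of b "T b"] norm_cstar_mult_self[of "T b"] by simp
      also have "\<dots> \<le> norm b * (norm (S o\<^sub>L T) * norm b)"
        by (rule order_trans[OF norm_mult_ineq]) (simp add: mult_left_mono norm_blinfun del: blinfun_apply_blinfun_compose)
      finally have "norm (T b) \<le> sqrt (norm (S o\<^sub>L T) * (norm b)\<^sup>2)"
        by (intro real_le_rsqrt) (simp add: power2_eq_square mult_ac)
      then show "norm (T b) \<le> sqrt (norm (S o\<^sub>L T)) * norm b" by (simp add: real_sqrt_mult)
    qed simp
    then have "(norm T)\<^sup>2 \<le> (sqrt (norm (S o\<^sub>L T)))\<^sup>2" by (rule power_mono) simp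
    then show ?thesis by simp
  qed
  have 2: "norm T \<le> norm S"
    if TS: "\<And>a b. cstar (blinfun_apply T a) * b = cstar a * blinfun_apply S b" for T S :: "'a \<Rightarrow>\<^sub>L 'a"
  proof (cases "norm T = 0")
    case False
    have "norm T * norm T \<le> norm S * norm T"
      using 1[OF TS] norm_blinfun_compose[of S T] by (simp add: power2_eq_square)
    then show ?thesis using False by simp
  qed simp
  show "(norm T)\<^sup>2 \<le> norm (S o\<^sub>L T)" using 1 assms by blast
  show "norm T = norm S"
    using 2[OF assms] 2[OF multiplier_swap[OF assms]] by simp
qed

lift_definition blinfun_scaleC :: "complex \<Rightarrow> ('a::cstar_algebra \<Rightarrow>\<^sub>L 'a) \<Rightarrow> ('a \<Rightarrow>\<^sub>L 'a)"
  is "\<lambda>c T a. c *\<^sub>C T a"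
proof -
  fix c and T :: "'a \<Rightarrow> 'a" assume "bounded_linear T"
  then interpret T: bounded_linear T .
  show "bounded_linear (\<lambda>a. c *\<^sub>C T a)"
  proof (rule bounded_linear_intro[where K = "cmod c * onorm T"])
    fix x y r
    show "c *\<^sub>C T (x + y) = c *\<^sub>C T x + c *\<^sub>C T y" by (simp add: T.add scaleC_add_right)
    show "c *\<^sub>C T (r *\<^sub>R x) = r *\<^sub>R c *\<^sub>C T x"
      by (simp only: T.scaleR) (simp only: scaleC_of_real[symmetric] scaleC_scaleC mult.commute)
    show "norm (c *\<^sub>C T x) \<le> norm x * (cmod c * onorm T)"
      using onorm[OF T.bounded_linear_axioms, of x] mult_left_mono[of "norm (T x)" "onorm T * norm x" "cmod c"]
      by (simp add: norm_scaleC mult_ac)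
  qed
qed

lemma norm_blinfun_scaleC: "norm (blinfun_scaleC c T) = cmod c * norm T"
proof -
  have le: "norm (blinfun_scaleC c T) \<le> cmod c * norm T" for c and T :: "'a \<Rightarrow>\<^sub>L 'a"
    by (rule norm_blinfun_bound)
      (auto simp: blinfun_scaleC.rep_eq norm_scaleC mult.assoc intro!: mult_left_mono norm_blinfun)
  show ?thesis
  proof (cases "c = 0")
    case True
    then show ?thesis using le[of c T] by simp
  next
    case False
    have "T = blinfun_scaleC (1/c) (blinfun_scaleC c T)"
      using False by (intro blinfun_eqI) (simp add: blinfun_scaleC.rep_eq scaleC_scaleC)
    then have "norm T \<le> cmod (1/c) * norm (blinfun_scaleC c T)" using le by metis
    then show ?thesis using le[of c T] False by (simp add: norm_divide field_simps)
  qed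
qed

text \<open>Only real linearity is built into the type of \<open>T\<close>; complex linearity follows from the existence
  of an adjoint.\<close>

lemma multiplier_scaleC:
  assumes "\<And>a b. cstar (blinfun_apply T a) * b = cstar a * blinfun_apply S b"
  shows "T (c *\<^sub>C a) = c *\<^sub>C T a"
proof -
  let ?d = "T (c *\<^sub>C a) - c *\<^sub>C T a"
  have "cstar ?d * ?d = 0"
    by (simp only: cstar_diff left_diff_distrib assms cstar_scaleC mult_scaleC_left) simp
  then show ?thesis using eq_zero_if_cstar_mult_zero[of ?d] by simp
qed

instantiation multiplier :: (cstar_algebra) real_vector
begin

lift_definition zero_multiplier :: "'a multiplier" is "(0, 0)" by auto
lift_definition plus_multiplier :: "'a multiplier \<Rightarrow> 'a multiplier \<Rightarrow> 'a multiplier"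
  is "\<lambda>(T, S) (T', S'). (T + T', S + S')"
  by (auto simp: blinfun.add_left cstar_add algebra_simps)
lift_definition minus_multiplier :: "'a multiplier \<Rightarrow> 'a multiplier \<Rightarrow> 'a multiplier"
  is "\<lambda>(T, S) (T', S'). (T - T', S - S')"
  by (auto simp: blinfun.diff_left cstar_diff algebra_simps)
lift_definition uminus_multiplier :: "'a multiplier \<Rightarrow> 'a multiplier" is "\<lambda>(T, S). (- T, - S)"
  by (auto simp: blinfun.minus_left cstar_minus)
lift_definition scaleR_multiplier :: "real \<Rightarrow> 'a multiplier \<Rightarrow> 'a multiplier"
  is "\<lambda>r (T, S). (r *\<^sub>R T, r *\<^sub>R S)"
  by (auto simp: blinfun.scaleR_left cstar_scaleR)

instance
proof
  fix x y z :: "'a multiplier" and r q :: real and c d :: complex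
  show "x + y + z = x + (y + z)" by transfer auto
  show "x + y = y + x" by transfer auto
  show "0 + x = x" by transfer auto
  show "- x + x = 0" by transfer auto
  show "x - y = x + - y" by transfer auto
  show "r *\<^sub>R (x + y) = r *\<^sub>R x + r *\<^sub>R y" by transfer (auto simp: algebra_simps)
  show "(r + q) *\<^sub>R x = r *\<^sub>R x + q *\<^sub>R x" by transfer (auto simp: algebra_simps)
  show "r *\<^sub>R q *\<^sub>R x = (r * q) *\<^sub>R x" by transfer auto
  show "1 *\<^sub>R x = x" by transfer auto
qed

end

instantiation multiplier :: (cstar_algebra) real_normed_vector
begin

lift_definition norm_multiplier :: "'a multiplier \<Rightarrow> real" is "\<lambda>(T, S). norm T" .
definition dist_multiplier :: "'a multiplier \<Rightarrow> 'a multiplier \<Rightarrow> real" where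
  "dist_multiplier x y = norm (x - y)"
definition sgn_multiplier :: "'a multiplier \<Rightarrow> 'a multiplier" where
  "sgn_multiplier x = x /\<^sub>R norm x"
definition uniformity_multiplier :: "('a multiplier \<times> 'a multiplier) filter" where
  "uniformity_multiplier = (INF e\<in>{0<..}. principal {(x, y). dist x y < e})"
definition open_multiplier :: "'a multiplier set \<Rightarrow> bool" where
  "open_multiplier U = (\<forall>x\<in>U. eventually (\<lambda>(x', y). x' = x \<longrightarrow> y \<in> U) uniformity)"

instance
proof
  fix x y z :: "'a multiplier" and r q :: real and c d :: complex
  show "dist x y = norm (x - y)" by (rule dist_multiplier_def)
  show "sgn x = x /\<^sub>R norm x" by (rule sgn_multiplier_def)
  show "uniformity = (INF e\<in>{0<..}. principal {(x, y). dist x (y :: 'a multiplier) < e})"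
    by (rule uniformity_multiplier_def)
  show "open U = (\<forall>x\<in>U. eventually (\<lambda>(x', y). x' = x \<longrightarrow> y \<in> U) uniformity)" for U :: "'a multiplier set"
    by (rule open_multiplier_def)
  show "(norm x = 0) = (x = 0)"
  proof transfer
    fix x :: "('a \<Rightarrow>\<^sub>L 'a) \<times> ('a \<Rightarrow>\<^sub>L 'a)"
    assume x: "x \<in> {(T, S). \<forall>a b. cstar (blinfun_apply T a) * b = cstar a * blinfun_apply S b}"
    obtain T S where "x = (T, S)" by (cases x)
    then show "((case x of (T, S) \<Rightarrow> norm T) = 0) = (x = (0, 0))"
      using norm_multiplier_pair(2)[of T S] x by auto
  qed
  show "norm (x + y) \<le> norm x + norm y" by transfer (auto simp: norm_triangle_ineq)
  show "norm (r *\<^sub>R x) = \<bar>r\<bar> * norm x" by transfer auto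
qed

end

instance multiplier :: (cstar_algebra) banach
proof
  fix X :: "nat \<Rightarrow> 'a multiplier" assume X: "Cauchy X"
  show "convergent X"
  proof -
    define T where "T n = fst (Rep_multiplier (X n))" for n
    define S where "S n = snd (Rep_multiplier (X n))" for n
    have TS: "cstar (T n a) * b = cstar a * S n b" for n a b
      using Rep_multiplier[of "X n"] by (auto simp: T_def S_def split: prod.splits)
    have nT: "norm (X n - X m) = norm (T n - T m)" for n m
      by (simp add: T_def norm_multiplier.rep_eq minus_multiplier.rep_eq split: prod.splits)
    have nS: "norm (X n - X m) = norm (S n - S m)" for n m
    proof -
      have "norm (T n - T m) = norm (S n - S m)"
        by (rule norm_multiplier_pair(2))
          (simp add: blinfun.diff_left cstar_diff left_diff_distrib right_diff_distrib TS)
      then show ?thesis by (simp add: nT)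
    qed
    have "Cauchy T" "Cauchy S"
      using X nT nS by (simp_all add: Cauchy_def dist_norm)
    then obtain T0 S0 where lim: "T \<longlonglongrightarrow> T0" "S \<longlonglongrightarrow> S0"
      by (auto simp: Cauchy_convergent_iff convergent_def)
    have TS0: "cstar (T0 a) * b = cstar a * S0 b" for a b
    proof -
      have "(\<lambda>n. cstar (T n a)) \<longlonglongrightarrow> cstar (T0 a)"
        by (intro tendsto_cstar tendsto_intros lim)
      then have "(\<lambda>n. cstar (T n a) * b) \<longlonglongrightarrow> cstar (T0 a) * b" by (intro tendsto_intros)
      moreover have "(\<lambda>n. cstar a * S n b) \<longlonglongrightarrow> cstar a * S0 b"
        by (intro tendsto_intros lim)
      ultimately show ?thesis using LIMSEQ_unique by (simp add: TS)
    qed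
    define X0 where "X0 = Abs_multiplier (T0, S0)"
    have X0: "Rep_multiplier X0 = (T0, S0)"
      unfolding X0_def by (rule Abs_multiplier_inverse) (simp add: TS0)
    have "norm (X n - X0) = norm (T n - T0)" for n
      by (simp add: T_def X0 norm_multiplier.rep_eq minus_multiplier.rep_eq split: prod.splits)
    moreover have "(\<lambda>n. norm (T n - T0)) \<longlonglongrightarrow> 0"
      by (intro tendsto_norm_zero LIM_zero lim)
    ultimately have "(\<lambda>n. norm (X n - X0)) \<longlonglongrightarrow> 0" by simp
    then have "(\<lambda>n. X n - X0) \<longlonglongrightarrow> 0" by (rule tendsto_norm_zero_cancel)
    then have "X \<longlonglongrightarrow> X0" by (rule LIM_zero_cancel)
    then show ?thesis by (auto simp: convergent_def)
  qed
qed

instantiation multiplier :: (cstar_algebra) unital_cstar_algebra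
begin

lift_definition one_multiplier :: "'a multiplier" is "(id_blinfun, id_blinfun)" by auto
lift_definition times_multiplier :: "'a multiplier \<Rightarrow> 'a multiplier \<Rightarrow> 'a multiplier"
  is "\<lambda>(T, S) (T', S'). (T o\<^sub>L T', S' o\<^sub>L S)"
  by auto
lift_definition scaleC_multiplier :: "complex \<Rightarrow> 'a multiplier \<Rightarrow> 'a multiplier"
  is "\<lambda>c (T, S). (blinfun_scaleC c T, blinfun_scaleC (cnj c) S)"
  by (auto simp: blinfun_scaleC.rep_eq cstar_scaleC mult_scaleC_left mult_scaleC_right)
lift_definition cstar_multiplier :: "'a multiplier \<Rightarrow> 'a multiplier" is "\<lambda>(T, S). (S, T)"
  subgoal for p by (cases p) (use multiplier_swap[of "fst p" "snd p"] in auto)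
  done

instance
proof
  fix x y z :: "'a multiplier" and r q :: real and c d :: complex
  show "x * y * z = x * (y * z)" by transfer (auto simp: blinfun_eqI)
  show "(x + y) * z = x * z + y * z"
    by transfer (auto intro!: blinfun_eqI simp: blinfun.add_left blinfun.add_right)
  show "x * (y + z) = x * y + x * z"
    by transfer (auto intro!: blinfun_eqI simp: blinfun.add_left blinfun.add_right)
  show "r *\<^sub>R x * y = r *\<^sub>R (x * y)"
    by transfer (auto intro!: blinfun_eqI simp: blinfun.scaleR_left blinfun.scaleR_right)
  show "x * r *\<^sub>R y = r *\<^sub>R (x * y)"
    by transfer (auto intro!: blinfun_eqI simp: blinfun.scaleR_left blinfun.scaleR_right)
  show "1 * x = x" by transfer (auto intro!: blinfun_eqI)
  show "x * 1 = x" by transfer (auto intro!: blinfun_eqI)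
  show "norm (x * y) \<le> norm x * norm y" by transfer (auto simp: norm_blinfun_compose)
  show "c *\<^sub>C (x + y) = c *\<^sub>C x + c *\<^sub>C y"
    by transfer (auto intro!: blinfun_eqI simp: blinfun.add_left blinfun_scaleC.rep_eq scaleC_add_right)
  show "(c + d) *\<^sub>C x = c *\<^sub>C x + d *\<^sub>C x"
    by transfer (auto intro!: blinfun_eqI simp: blinfun.add_left blinfun_scaleC.rep_eq scaleC_add_left)
  show "c *\<^sub>C d *\<^sub>C x = (c * d) *\<^sub>C x"
    by transfer (auto intro!: blinfun_eqI simp: blinfun_scaleC.rep_eq scaleC_scaleC)
  show "complex_of_real r *\<^sub>C x = r *\<^sub>R x"
    by transfer (auto intro!: blinfun_eqI simp: blinfun.scaleR_left blinfun_scaleC.rep_eq scaleC_of_real)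
  obtain T S where x: "Rep_multiplier x = (T, S)" "\<And>a b. cstar (T a) * b = cstar a * S b"
    using Rep_multiplier[of x] by auto
  obtain T' S' where y: "Rep_multiplier y = (T', S')" "\<And>a b. cstar (T' a) * b = cstar a * S' b"
    using Rep_multiplier[of y] by auto
  show "c *\<^sub>C x * y = c *\<^sub>C (x * y)"
    unfolding Rep_multiplier_inject[symmetric] times_multiplier.rep_eq scaleC_multiplier.rep_eq x y
    using multiplier_scaleC[OF multiplier_swap[OF y(2)]]
    by (auto intro!: blinfun_eqI simp: blinfun_scaleC.rep_eq)
  show "x * c *\<^sub>C y = c *\<^sub>C (x * y)"
    unfolding Rep_multiplier_inject[symmetric] times_multiplier.rep_eq scaleC_multiplier.rep_eq x y
    using multiplier_scaleC[OF x(2)]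
    by (auto intro!: blinfun_eqI simp: blinfun_scaleC.rep_eq)
  show "norm (c *\<^sub>C x) = cmod c * norm x" by transfer (auto simp: norm_blinfun_scaleC)
  show "cstar (cstar x) = x" by transfer auto
  show "cstar (x + y) = cstar x + cstar y" by transfer auto
  show "cstar (c *\<^sub>C x) = cnj c *\<^sub>C cstar x" by transfer auto
  show "cstar (x * y) = cstar y * cstar x" by transfer auto
  have "norm (cstar x * x) = norm (S o\<^sub>L T)"
    by (simp add: norm_multiplier.rep_eq times_multiplier.rep_eq cstar_multiplier.rep_eq x)
  also have "\<dots> = (norm T)\<^sup>2"
    using norm_multiplier_pair[OF x(2)] norm_blinfun_compose[of S T]
    by (simp add: power2_eq_square)
  finally show "norm (cstar x * x) = (norm x)\<^sup>2"
    by (simp add: norm_multiplier.rep_eq x)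
qed

end

text \<open>Left multiplication embeds a C*-algebra isometrically as an ideal of its multiplier algebra.\<close>

lift_definition left_mult :: "'a::cstar_algebra \<Rightarrow> 'a multiplier"
  is "\<lambda>a. (blinfun_mult_right a, blinfun_mult_right (cstar a))"
  by (simp add: cstar_mult mult.assoc)

lemma norm_left_mult [simp]: "norm (left_mult a) = norm a"
proof (transfer, simp, rule antisym)
  fix a :: 'a
  show "norm (blinfun_mult_right a) \<le> norm a"
    by (rule norm_blinfun_bound) (auto simp: norm_mult_ineq)
  show "norm a \<le> norm (blinfun_mult_right a)"
  proof (cases "norm a = 0")
    case False
    have "norm a * norm a \<le> norm (blinfun_mult_right a) * norm a"
      using norm_blinfun[of "blinfun_mult_right a" "cstar a"] norm_mult_cstar_self[of a]
      by (simp add: power2_eq_square)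
    then show ?thesis using False by simp
  qed simp
qed

lemma left_mult_add: "left_mult (a + b) = left_mult a + left_mult b"
  by transfer (auto intro!: blinfun_eqI simp: blinfun.add_left cstar_add algebra_simps)

lemma left_mult_scaleR: "left_mult (r *\<^sub>R a) = r *\<^sub>R left_mult a"
  by transfer (auto intro!: blinfun_eqI simp: blinfun.scaleR_left cstar_scaleR)

lemma left_mult_mult: "left_mult (a * b) = left_mult a * left_mult b"
  by transfer (auto intro!: blinfun_eqI simp: cstar_mult mult.assoc)

lemma left_mult_cstar: "left_mult (cstar a) = cstar (left_mult a)"
  by transfer (simp add: cstar_cstar)

lemma linear_left_mult: "linear left_mult"
  by (rule linearI) (simp_all add: left_mult_add left_mult_scaleR)

lemma left_mult_diff: "left_mult (a - b) = left_mult a - left_mult b"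
  by (rule linear_diff[OF linear_left_mult])

lemma left_mult_inject [simp]: "left_mult a = left_mult b \<longleftrightarrow> a = b"
  by (metis eq_iff_diff_eq_0 left_mult_diff norm_eq_zero norm_left_mult)

text \<open>An adjointable operator commutes with right multiplications: \<open>T (a b) = T(a) b\<close>.\<close>

lemma multiplier_times_left_mult:
  "m * left_mult a = left_mult (blinfun_apply (fst (Rep_multiplier m)) a)"
proof -
  obtain T S where m: "Rep_multiplier m = (T, S)" "\<And>a b. cstar (T a) * b = cstar a * S b"
    using Rep_multiplier[of m] by auto
  have "T (a * b) = T a * b" for b
  proof -
    let ?d = "T (a * b) - T a * b"
    have "cstar ?d * ?d = 0"
      by (simp only: cstar_diff cstar_mult left_diff_distrib m mult.assoc) simp
    then show ?thesis using eq_zero_if_cstar_mult_zero[of ?d] by simp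
  qed
  then show ?thesis
    unfolding Rep_multiplier_inject[symmetric] times_multiplier.rep_eq left_mult.rep_eq m
    by (auto intro!: blinfun_eqI simp: m(2)[symmetric] multiplier_swap[OF m(2)] cstar_cstar)
qed

lemma left_mult_times_multiplier: "\<exists>b. left_mult a * m = left_mult b"
proof -
  have "cstar (left_mult a * m) = left_mult (blinfun_apply (fst (Rep_multiplier (cstar m))) (cstar a))"
    by (simp add: cstar_mult multiplier_times_left_mult flip: left_mult_cstar)
  then have "left_mult a * m = cstar (left_mult (blinfun_apply (fst (Rep_multiplier (cstar m))) (cstar a)))"
    by (metis cstar_cstar)
  then show ?thesis by (metis left_mult_cstar)
qed

lemma closed_range_left_mult: "closed (range left_mult)"
  unfolding closed_sequential_limits
proof (intro allI impI, elim conjE)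
  fix x l assume x: "\<forall>n. x n \<in> range left_mult" and l: "x \<longlonglongrightarrow> l"
  then have "\<forall>n. \<exists>a. x n = left_mult a" by auto
  then obtain a where a: "\<And>n. x n = left_mult (a n)" by metis
  have "Cauchy x" using l by (rule LIMSEQ_imp_Cauchy)
  then have "Cauchy a" by (simp add: Cauchy_def dist_norm a flip: left_mult_diff)
  then obtain b where b: "a \<longlonglongrightarrow> b" by (auto simp: Cauchy_convergent_iff convergent_def)
  have "(\<lambda>n. norm (left_mult (a n) - left_mult b)) \<longlonglongrightarrow> 0"
    using tendsto_norm_zero[OF LIM_zero[OF b]] by (simp flip: left_mult_diff)
  then have "(\<lambda>n. x n - left_mult b) \<longlonglongrightarrow> 0"
    unfolding a by (rule tendsto_norm_zero_cancel)
  then have "x \<longlonglongrightarrow> left_mult b" by (rule LIM_zero_cancel)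
  with l have "l = left_mult b" by (rule LIMSEQ_unique)
  then show "l \<in> range left_mult" by simp
qed

section \<open>Positivity in C*-algebras\<close>

text \<open>The square root of \<open>left_mult a\<close> lies in the range of \<open>left_mult\<close>, a closed ideal.\<close>

lemma cpositive_iff_positive_left_mult: "cpositive a \<longleftrightarrow> positive (left_mult a)"
proof
  assume "cpositive a"
  then show "positive (left_mult a)"
    using positive_cstar_mult_self by (auto simp: cpositive_def left_mult_mult left_mult_cstar)
next
  assume pos: "positive (left_mult a)"
  then obtain r where r: "r > 0" "norm (r *\<^sub>R 1 - left_mult a) \<le> r"
    by (auto simp: positive_iff_norm)
  obtain s where s: "cstar s = s" "left_mult a = s * s"
      "\<And>I. \<lbrakk>closed I; subspace I; \<And>x y. x \<in> I \<Longrightarrow> x * y \<in> I; left_mult a \<in> I\<rbrakk> \<Longrightarrow> s \<in> I"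
    using positive_sqrt[OF positive_self_adjoint[OF pos] r] by metis
  have "subspace (range (left_mult :: 'a \<Rightarrow> _))"
    using linear_subspace_image[OF linear_left_mult subspace_UNIV] .
  then have "s \<in> range left_mult"
    by (intro s(3) closed_range_left_mult) (auto simp: image_iff left_mult_times_multiplier)
  then obtain b where "s = left_mult b" by auto
  then have "left_mult a = left_mult (cstar b * b)"
    using s(1,2) by (simp add: left_mult_mult left_mult_cstar)
  then show "cpositive a" unfolding cpositive_def by (simp only: left_mult_inject) blast
qed

lemma cpositive_cstar_mult_self: "cpositive (cstar b * b)"
  by (auto simp: cpositive_def)

lemma cpositive_zero: "cpositive 0"
  using cpositive_cstar_mult_self[of 0] by simp

lemma cpositive_add: "cpositive a \<Longrightarrow> cpositive b \<Longrightarrow> cpositive (a + b)"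
  by (simp add: cpositive_iff_positive_left_mult left_mult_add positive_add)

lemma cpositive_sum: "(\<And>i. i \<in> I \<Longrightarrow> cpositive (f i)) \<Longrightarrow> cpositive (sum f I)"
  by (induction I rule: infinite_finite_induct) (auto simp: cpositive_zero cpositive_add)

lemma cpositive_norm_mono: "cpositive a \<Longrightarrow> cpositive b \<Longrightarrow> norm a \<le> norm (a + b)"
  using positive_norm_mono[of "left_mult a" "left_mult b"]
  by (simp add: cpositive_iff_positive_left_mult flip: left_mult_add)

text \<open>In the multiplier algebra \<open>r - g = k\<^sup>2\<close> with \<open>k\<close> self-adjoint, so \<open>a\<^sup>* (r - g) a = (k a)\<^sup>* (k a)\<close>.\<close>

lemma cpositive_conjugate_bound:
  assumes "cpositive g" "norm g \<le> r" "r > 0"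
  shows "cpositive (r *\<^sub>R (cstar a * a) - cstar a * g * a)"
proof -
  have "positive (r *\<^sub>R 1 - left_mult g)"
    using assms by (intro positive_upper_bound) (auto simp: cpositive_iff_positive_left_mult)
  then obtain k where k: "cstar k = k" "r *\<^sub>R 1 - left_mult g = k * k"
    by (auto simp: positive_def)
  have "cstar (k * left_mult a) * (k * left_mult a) = cstar (left_mult a) * (k * k) * left_mult a"
    by (simp add: cstar_mult k mult.assoc)
  also have "\<dots> = left_mult (r *\<^sub>R (cstar a * a) - cstar a * g * a)"
    by (simp add: k(2)[symmetric] left_mult_diff left_mult_scaleR left_mult_mult left_mult_cstar algebra_simps)
  finally have "positive (left_mult (r *\<^sub>R (cstar a * a) - cstar a * g * a))"
    using positive_cstar_mult_self by metis
  then show ?thesis by (simp add: cpositive_iff_positive_left_mult)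
qed

section \<open>Hilbert modules as metric spaces\<close>

lemma tendsto_zero_mono:
  fixes f g :: "nat \<Rightarrow> real"
  assumes "g \<longlonglongrightarrow> 0" "\<And>n. 0 \<le> f n" "\<And>n. f n \<le> g n"
  shows "f \<longlonglongrightarrow> 0"
  using assms by (intro tendsto_sandwich[of "\<lambda>_. 0" f sequentially g 0]) auto

context pre_hilbert_module
begin

lemma csmult_zero_left: "x \<in> carrier E \<Longrightarrow> csmult E 0 x = \<zero>"
  using csmult_add_left[of x 0 0] by (simp add: csmult_closed)

lemma csmult_minus1: "x \<in> carrier E \<Longrightarrow> csmult E (-1) x = \<ominus> x"
  using csmult_add_left[of x "-1" 1]
  by (intro minus_equality[symmetric]) (simp_all add: csmult_zero_left csmult_one csmult_closed)

lemma ip_zero_right [simp]: "x \<in> carrier E \<Longrightarrow> ip E x \<zero> = 0"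
  using ip_add_right[of x \<zero> \<zero>] by simp

lemma ip_minus_right: "\<lbrakk>x \<in> carrier E; y \<in> carrier E\<rbrakk> \<Longrightarrow> ip E x (\<ominus> y) = - ip E x y"
  using ip_csmult_right[of x y "-1"] by (simp add: csmult_minus1)

lemma ip_diff_right:
  "\<lbrakk>x \<in> carrier E; y \<in> carrier E; z \<in> carrier E\<rbrakk> \<Longrightarrow> ip E x (y \<ominus> z) = ip E x y - ip E x z"
  by (simp add: a_minus_def ip_add_right ip_minus_right)

lemma ip_add_left:
  "\<lbrakk>x \<in> carrier E; y \<in> carrier E; z \<in> carrier E\<rbrakk> \<Longrightarrow> ip E (y \<oplus> z) x = ip E y x + ip E z x"
  using ip_cstar[of x "y \<oplus> z"] ip_cstar[of x y] ip_cstar[of x z]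
  by (simp add: ip_add_right cstar_add)

lemma ip_zero_left [simp]: "x \<in> carrier E \<Longrightarrow> ip E \<zero> x = 0"
  using ip_cstar[of x \<zero>] by simp

lemma ip_minus_left: "\<lbrakk>x \<in> carrier E; y \<in> carrier E\<rbrakk> \<Longrightarrow> ip E (\<ominus> y) x = - ip E y x"
  using ip_cstar[of x "\<ominus> y"] ip_cstar[of x y] by (simp add: ip_minus_right cstar_minus)

lemma ip_diff_left:
  "\<lbrakk>x \<in> carrier E; y \<in> carrier E; z \<in> carrier E\<rbrakk> \<Longrightarrow> ip E (y \<ominus> z) x = ip E y x - ip E z x"
  by (simp add: a_minus_def ip_add_left ip_minus_left)

lemma ip_ract_left:
  "\<lbrakk>x \<in> carrier E; y \<in> carrier E\<rbrakk> \<Longrightarrow> ip E (ract E y a) x = cstar a * ip E y x"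
  using ip_cstar[of x "ract E y a"] ip_cstar[of x y] by (simp add: ract_closed ip_ract_right cstar_mult)

lemma ip_csmult_left:
  "\<lbrakk>x \<in> carrier E; y \<in> carrier E\<rbrakk> \<Longrightarrow> ip E (csmult E c y) x = cnj c *\<^sub>C ip E y x"
  using ip_cstar[of x "csmult E c y"] ip_cstar[of x y]
  by (simp add: csmult_closed ip_csmult_right cstar_scaleC)

lemmas ip_simps = ip_add_right ip_diff_right ip_minus_right ip_add_left ip_diff_left ip_minus_left
  ip_csmult_left ip_csmult_right ract_closed csmult_closed

lemma minus_eq_zero_iff: "\<lbrakk>x \<in> carrier E; y \<in> carrier E\<rbrakk> \<Longrightarrow> x \<ominus> y = \<zero> \<longleftrightarrow> x = y"
  using minus_equality[of x "\<ominus> y"] by (auto simp: a_minus_def r_neg)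

text \<open>This rule reduces linear identities between vectors to identities in the algebra, where the
  simplifier decides them.\<close>

lemma ip_eqI:
  assumes "x \<in> carrier E" "y \<in> carrier E" "\<And>z. z \<in> carrier E \<Longrightarrow> ip E z x = ip E z y"
  shows "x = y"
proof -
  have "ip E (x \<ominus> y) (x \<ominus> y) = 0" using assms by (subst ip_diff_right) auto
  then have "x \<ominus> y = \<zero>" using assms by (intro ip_definite) auto
  then show ?thesis using assms by (simp add: minus_eq_zero_iff)
qed

lemma hnorm_nonneg [simp]: "hnorm E x \<ge> 0"
  by (simp add: hnorm_def)

lemma hnorm_power2: "(hnorm E x)\<^sup>2 = norm (ip E x x)"
  by (simp add: hnorm_def)

lemma hnorm_eq_zero: "x \<in> carrier E \<Longrightarrow> hnorm E x = 0 \<longleftrightarrow> x = \<zero>"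
  using ip_definite[of x] by (auto simp: hnorm_def)

text \<open>For \<open>r \<ge> \<parallel>\<langle>x, x\<rangle>\<parallel>\<close> and \<open>r a = \<langle>x, y\<rangle>\<close>, expanding \<open>\<langle>x a - y, x a - y\<rangle> \<ge> 0\<close> yields
  \<open>r a\<^sup>* a \<le> \<langle>y, y\<rangle>\<close>.\<close>

theorem cauchy_schwarz:
  assumes x: "x \<in> carrier E" and y: "y \<in> carrier E"
  shows "norm (ip E x y) \<le> hnorm E x * hnorm E y"
proof -
  let ?N = "norm (ip E x y)" and ?X = "norm (ip E x x)" and ?Y = "norm (ip E y y)"
  have le: "?N\<^sup>2 \<le> r * ?Y" if r: "r > 0" "?X \<le> r" for r
  proof -
    define a where "a = (1/r) *\<^sub>R ip E x y"
    have xy: "ip E x y = r *\<^sub>R a" using r by (simp add: a_def)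
    have yx: "ip E y x = r *\<^sub>R cstar a" using ip_cstar[OF x y] xy by (simp add: cstar_scaleR)
    define u where "u = ract E x a \<ominus> y"
    have u: "u \<in> carrier E" by (simp add: u_def x y ract_closed)
    have "ip E u u = cstar a * ip E x x * a - r *\<^sub>R (cstar a * a) - r *\<^sub>R (cstar a * a) + ip E y y"
      unfolding u_def using x y
      by (simp add: ip_simps ip_ract_left ip_ract_right xy yx left_diff_distrib mult.assoc)
    then have "r *\<^sub>R (cstar a * a) + (ip E u u + (r *\<^sub>R (cstar a * a) - cstar a * ip E x x * a)) = ip E y y"
      by simp
    moreover have "cpositive (ip E u u + (r *\<^sub>R (cstar a * a) - cstar a * ip E x x * a))"
      using u r x by (intro cpositive_add ip_positive cpositive_conjugate_bound)
    moreover have "cpositive (r *\<^sub>R (cstar a * a))"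
    proof -
      have "r *\<^sub>R (cstar a * a) = cstar (sqrt r *\<^sub>R a) * (sqrt r *\<^sub>R a)"
        using r by (simp add: cstar_scaleR)
      then show ?thesis unfolding cpositive_def by blast
    qed
    ultimately have "norm (r *\<^sub>R (cstar a * a)) \<le> ?Y"
      using cpositive_norm_mono by metis
    then have "r * (norm a)\<^sup>2 \<le> ?Y" using r by (simp add: norm_cstar_mult_self)
    then have "r * (r * (norm a)\<^sup>2) \<le> r * ?Y" using r by (simp add: mult_left_mono)
    then show ?thesis using r by (simp add: xy power2_eq_square mult_ac)
  qed
  have "?N\<^sup>2 \<le> ?X * ?Y"
  proof (rule field_le_epsilon)
    fix e :: real assume e: "e > 0"
    have Y: "?Y + 1 > 0" by (simp add: add_nonneg_pos)
    have "?N\<^sup>2 \<le> (?X + e / (?Y + 1)) * ?Y"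
      using e Y by (intro le) (auto intro!: add_nonneg_pos divide_pos_pos)
    also have "\<dots> = ?X * ?Y + e * (?Y / (?Y + 1))" by (simp add: algebra_simps)
    also have "e * (?Y / (?Y + 1)) \<le> e" using e Y by (intro mult_left_le) auto
    finally show "?N\<^sup>2 \<le> ?X * ?Y + e" by simp
  qed
  then have "?N\<^sup>2 \<le> (hnorm E x * hnorm E y)\<^sup>2" by (simp add: power_mult_distrib hnorm_power2)
  then show ?thesis by (rule power2_le_imp_le) simp
qed

lemma hnorm_triangle:
  assumes x: "x \<in> carrier E" and y: "y \<in> carrier E"
  shows "hnorm E (x \<oplus> y) \<le> hnorm E x + hnorm E y"
proof (rule power2_le_imp_le)
  have "ip E (x \<oplus> y) (x \<oplus> y) = (ip E x x + ip E x y) + (ip E y x + ip E y y)"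
    using x y by (simp add: ip_simps)
  then have "(hnorm E (x \<oplus> y))\<^sup>2 \<le> (norm (ip E x x) + norm (ip E x y)) + (norm (ip E y x) + norm (ip E y y))"
    unfolding hnorm_power2 by (metis add_mono norm_triangle_ineq norm_triangle_le)
  also have "\<dots> \<le> ((hnorm E x)\<^sup>2 + hnorm E x * hnorm E y) + (hnorm E y * hnorm E x + (hnorm E y)\<^sup>2)"
    using x y by (intro add_mono cauchy_schwarz) (simp_all add: hnorm_power2)
  finally show "(hnorm E (x \<oplus> y))\<^sup>2 \<le> (hnorm E x + hnorm E y)\<^sup>2"
    by (simp add: power2_eq_square algebra_simps)
qed simp

lemma hnorm_csmult: "x \<in> carrier E \<Longrightarrow> hnorm E (csmult E c x) = cmod c * hnorm E x"
  by (simp add: hnorm_def ip_simps scaleC_scaleC norm_scaleC norm_mult real_sqrt_mult)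

lemma hnorm_minus: "x \<in> carrier E \<Longrightarrow> hnorm E (\<ominus> x) = hnorm E x"
  by (simp add: hnorm_def ip_simps)

lemma hnorm_minus_commute:
  assumes "x \<in> carrier E" "y \<in> carrier E"
  shows "hnorm E (x \<ominus> y) = hnorm E (y \<ominus> x)"
proof -
  have "x \<ominus> y = \<ominus> (y \<ominus> x)" using assms by (intro ip_eqI) (simp_all add: ip_simps)
  then show ?thesis using assms by (simp add: hnorm_minus)
qed

lemma hnorm_diff_triangle:
  assumes "x \<in> carrier E" "y \<in> carrier E" "z \<in> carrier E"
  shows "hnorm E (x \<ominus> z) \<le> hnorm E (x \<ominus> y) + hnorm E (y \<ominus> z)"
proof -
  have "x \<ominus> z = (x \<ominus> y) \<oplus> (y \<ominus> z)" using assms by (intro ip_eqI) (simp_all add: ip_simps)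
  then show ?thesis using assms by (simp add: hnorm_triangle)
qed

sublocale metric: Metric_space "carrier E" "hdist E"
proof
  show "0 \<le> hdist E x y" for x y by (simp add: hdist_def)
  show "hdist E x y = hdist E y x" for x y by (simp add: hdist_def hnorm_minus_commute)
  show "hdist E x y = 0 \<longleftrightarrow> x = y" if "x \<in> carrier E" "y \<in> carrier E" for x y
    using that by (simp add: hdist_def hnorm_eq_zero minus_eq_zero_iff)
  show "hdist E x z \<le> hdist E x y + hdist E y z"
    if "x \<in> carrier E" "y \<in> carrier E" "z \<in> carrier E" for x y z
    using that by (simp add: hdist_def hnorm_diff_triangle)
qed

lemma topspace_htopology [simp]: "topspace (htopology E) = carrier E"
  by (simp add: htopology_def)

end

definition hlim :: "('a::cstar_algebra, 'e) hilbert_mod \<Rightarrow> (nat \<Rightarrow> 'e) \<Rightarrow> 'e \<Rightarrow> bool" where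
  "hlim E \<sigma> l \<longleftrightarrow> range \<sigma> \<subseteq> carrier E \<and> l \<in> carrier E \<and> (\<lambda>n. hnorm E (\<sigma> n \<ominus>\<^bsub>E\<^esub> l)) \<longlonglongrightarrow> 0"

context pre_hilbert_module
begin

lemma hlim_iff_limitin:
  assumes "range \<sigma> \<subseteq> carrier E"
  shows "hlim E \<sigma> l \<longleftrightarrow> limitin (htopology E) \<sigma> l sequentially"
proof -
  have "hdist E (\<sigma> n) l = hnorm E (\<sigma> n \<ominus> l)" if "l \<in> carrier E" for n
    using assms that by (auto simp: hdist_def)
  then show ?thesis
    using assms unfolding hlim_def htopology_def metric.limitin_metric_dist_null
    by (auto simp: eventually_sequentially range_subsetD)
qed

lemma closedin_htopology_iff:
  "closedin (htopology E) S \<longleftrightarrow>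
    S \<subseteq> carrier E \<and> (\<forall>\<sigma> l. range \<sigma> \<subseteq> S \<longrightarrow> hlim E \<sigma> l \<longrightarrow> l \<in> S)"
proof (cases "S \<subseteq> carrier E")
  case True
  then have "limitin metric.mtopology \<sigma> l sequentially \<longleftrightarrow> hlim E \<sigma> l" if "range \<sigma> \<subseteq> S" for \<sigma> l
    using hlim_iff_limitin[of \<sigma> l] that by (auto simp: htopology_def)
  then show ?thesis
    unfolding htopology_def metric.metric_closedin_iff_sequentially_closed by blast
qed (use closedin_subset[of "htopology E" S] in auto)

lemma dense_in_approx:
  assumes d: "dense_in E X" and X: "X \<subseteq> carrier E" and x: "x \<in> carrier E"
  obtains \<sigma> where "range \<sigma> \<subseteq> X" "hlim E \<sigma> x"
proof -
  have "x \<in> metric.mtopology closure_of X" using d x by (simp add: dense_in_def htopology_def)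
  then have "\<forall>r>0. \<exists>y\<in>X. hdist E x y < r" by (auto simp: metric.metric_closure_of)
  then have "\<forall>n. \<exists>y\<in>X. hdist E x y < inverse (real (Suc n))" by simp
  then obtain \<sigma> where \<sigma>: "\<And>n. \<sigma> n \<in> X" "\<And>n. hdist E x (\<sigma> n) < inverse (real (Suc n))" by metis
  have "hnorm E (\<sigma> n \<ominus> x) \<le> inverse (real (Suc n))" for n
    using \<sigma>[of n] X x hnorm_minus_commute[of x "\<sigma> n"] by (auto simp: hdist_def)
  then have "(\<lambda>n. hnorm E (\<sigma> n \<ominus> x)) \<longlonglongrightarrow> 0"
    by (intro tendsto_zero_mono[OF LIMSEQ_inverse_real_of_nat]) auto
  then show thesis using \<sigma>(1) X x by (intro that[of \<sigma>]) (auto simp: hlim_def)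
qed

lemma hlim_add:
  assumes "hlim E \<sigma> l" "hlim E \<tau> m"
  shows "hlim E (\<lambda>n. \<sigma> n \<oplus> \<tau> n) (l \<oplus> m)"
proof -
  have c: "\<sigma> n \<in> carrier E" "\<tau> n \<in> carrier E" "l \<in> carrier E" "m \<in> carrier E" for n
    using assms by (auto simp: hlim_def)
  have eq: "(\<sigma> n \<oplus> \<tau> n) \<ominus> (l \<oplus> m) = (\<sigma> n \<ominus> l) \<oplus> (\<tau> n \<ominus> m)" for n
    using c by (intro ip_eqI) (simp_all add: ip_simps)
  have lim: "(\<lambda>n. hnorm E (\<sigma> n \<ominus> l) + hnorm E (\<tau> n \<ominus> m)) \<longlonglongrightarrow> 0"
    using assms by (intro tendsto_add_zero) (simp_all add: hlim_def)
  have "(\<lambda>n. hnorm E ((\<sigma> n \<oplus> \<tau> n) \<ominus> (l \<oplus> m))) \<longlonglongrightarrow> 0"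
    by (rule tendsto_zero_mono[OF lim]) (simp_all add: eq hnorm_triangle c)
  then show ?thesis using c by (auto simp: hlim_def)
qed

lemma hlim_diff:
  assumes "hlim E \<sigma> l" "hlim E \<tau> m"
  shows "hlim E (\<lambda>n. \<sigma> n \<ominus> \<tau> n) (l \<ominus> m)"
proof -
  have c: "\<tau> n \<in> carrier E" "m \<in> carrier E" for n using assms by (auto simp: hlim_def)
  have "\<ominus> \<tau> n \<ominus> \<ominus> m = \<ominus> (\<tau> n \<ominus> m)" for n
    using c by (intro ip_eqI) (simp_all add: ip_simps)
  then have "hlim E (\<lambda>n. \<ominus> \<tau> n) (\<ominus> m)"
    using assms(2) c by (auto simp: hlim_def hnorm_minus)
  then show ?thesis unfolding a_minus_def by (rule hlim_add[OF assms(1)])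
qed

lemma tendsto_ip_right:
  assumes "hlim E \<sigma> l" and y: "y \<in> carrier E"
  shows "(\<lambda>n. ip E y (\<sigma> n)) \<longlonglongrightarrow> ip E y l"
proof (rule LIM_zero_cancel, rule tendsto_norm_zero_cancel)
  have c: "\<sigma> n \<in> carrier E" "l \<in> carrier E" for n using assms by (auto simp: hlim_def)
  have "norm (ip E y (\<sigma> n) - ip E y l) \<le> hnorm E y * hnorm E (\<sigma> n \<ominus> l)" for n
    using cauchy_schwarz[of y "\<sigma> n \<ominus> l"] c y by (simp add: ip_simps)
  moreover have lim: "(\<lambda>n. hnorm E y * hnorm E (\<sigma> n \<ominus> l)) \<longlonglongrightarrow> 0"
    using assms(1) by (intro tendsto_mult_right_zero) (simp add: hlim_def)
  ultimately show "(\<lambda>n. norm (ip E y (\<sigma> n) - ip E y l)) \<longlonglongrightarrow> 0"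
    by (intro tendsto_zero_mono[OF lim]) simp_all
qed

lemma tendsto_ip_left:
  assumes l: "hlim E \<sigma> l" and y: "y \<in> carrier E"
  shows "(\<lambda>n. ip E (\<sigma> n) y) \<longlonglongrightarrow> ip E l y"
proof -
  have "ip E (\<sigma> n) y = cstar (ip E y (\<sigma> n))" "ip E l y = cstar (ip E y l)" for n
    using l y by (auto simp: hlim_def intro!: ip_cstar)
  then show ?thesis using tendsto_cstar[OF tendsto_ip_right[OF l y]] by simp
qed

lemma closedin_orthogonal_complement:
  assumes "H \<subseteq> carrier E"
  shows "closedin (htopology E) {y \<in> carrier E. \<forall>h\<in>H. ip E h y = 0}"
  unfolding closedin_htopology_iff
proof (intro conjI allI impI)
  fix \<sigma> l assume r: "range \<sigma> \<subseteq> {y \<in> carrier E. \<forall>h\<in>H. ip E h y = 0}" and l: "hlim E \<sigma> l"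
  have "ip E h l = 0" if "h \<in> H" for h
  proof -
    have "(\<lambda>n. ip E h (\<sigma> n)) \<longlonglongrightarrow> ip E h l" using that assms by (intro tendsto_ip_right l) auto
    moreover have "ip E h (\<sigma> n) = 0" for n using r that by auto
    ultimately show ?thesis by (simp add: LIMSEQ_const_iff)
  qed
  then show "l \<in> {y \<in> carrier E. \<forall>h\<in>H. ip E h y = 0}" using l by (auto simp: hlim_def)
qed auto

text \<open>The inner product is continuous, so vectors may be compared on a dense set.\<close>

lemma ip_eqI_dense:
  assumes d: "dense_in E X" "X \<subseteq> carrier E" and xy: "x \<in> carrier E" "y \<in> carrier E"
    and eq: "\<And>z. z \<in> X \<Longrightarrow> ip E z x = ip E z y"
  shows "x = y"
proof (rule ip_eqI[OF xy])
  fix z assume "z \<in> carrier E"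
  then obtain \<sigma> where \<sigma>: "range \<sigma> \<subseteq> X" "hlim E \<sigma> z" using dense_in_approx[OF d] by blast
  have "(\<lambda>n. ip E (\<sigma> n) x) \<longlonglongrightarrow> ip E z x" by (rule tendsto_ip_left[OF \<sigma>(2) xy(1)])
  moreover have "ip E (\<sigma> n) x = ip E (\<sigma> n) y" for n using \<sigma>(1) eq by auto
  ultimately have "(\<lambda>n. ip E (\<sigma> n) y) \<longlonglongrightarrow> ip E z x" by simp
  then show "ip E z x = ip E z y"
    using tendsto_ip_left[OF \<sigma>(2) xy(2)] by (rule LIMSEQ_unique)
qed

end

definition hCauchy :: "('a::cstar_algebra, 'e) hilbert_mod \<Rightarrow> (nat \<Rightarrow> 'e) \<Rightarrow> bool" where
  "hCauchy E \<sigma> \<longleftrightarrow> range \<sigma> \<subseteq> carrier E \<and>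
    (\<forall>e>0. \<exists>N. \<forall>m\<ge>N. \<forall>n\<ge>N. hnorm E (\<sigma> m \<ominus>\<^bsub>E\<^esub> \<sigma> n) < e)"

context pre_hilbert_module
begin

lemma hCauchy_iff_MCauchy: "hCauchy E \<sigma> \<longleftrightarrow> metric.MCauchy \<sigma>"
proof (cases "range \<sigma> \<subseteq> carrier E")
  case True
  then have "hdist E (\<sigma> m) (\<sigma> n) = hnorm E (\<sigma> m \<ominus> \<sigma> n)" for m n by (auto simp: hdist_def)
  then show ?thesis using True unfolding hCauchy_def metric.MCauchy_def by simp
qed (simp add: hCauchy_def metric.MCauchy_def)

lemma hlim_imp_hCauchy: "hlim E \<sigma> l \<Longrightarrow> hCauchy E \<sigma>"
  using hlim_iff_limitin[of \<sigma> l] metric.convergent_imp_MCauchy[of \<sigma> l]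
  by (simp add: hCauchy_iff_MCauchy hlim_def htopology_def)

lemma mcomplete_iff: "metric.mcomplete \<longleftrightarrow> (\<forall>\<sigma>. hCauchy E \<sigma> \<longrightarrow> (\<exists>l. hlim E \<sigma> l))"
proof -
  have "limitin metric.mtopology \<sigma> l sequentially \<longleftrightarrow> hlim E \<sigma> l" if "hCauchy E \<sigma>" for \<sigma> l
    using hlim_iff_limitin[of \<sigma> l] that by (simp add: htopology_def hCauchy_def)
  then show ?thesis
    unfolding metric.mcomplete_def hCauchy_iff_MCauchy[symmetric] by blast
qed

end

lemma (in hilbert_module) hCauchy_converges: "hCauchy E \<sigma> \<Longrightarrow> \<exists>l. hlim E \<sigma> l"
  using complete mcomplete_iff by blast

lemma hCauchy_mono:
  assumes "hCauchy F \<tau>" "range \<sigma> \<subseteq> carrier E"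
    "\<And>m n. hnorm E (\<sigma> m \<ominus>\<^bsub>E\<^esub> \<sigma> n) \<le> hnorm F (\<tau> m \<ominus>\<^bsub>F\<^esub> \<tau> n)"
  shows "hCauchy E \<sigma>"
  using assms unfolding hCauchy_def by (meson le_less_trans)

section \<open>Operators with closed range\<close>

locale linear_operator = E: pre_hilbert_module E + F: pre_hilbert_module F
  for E :: "('a::cstar_algebra, 'e) hilbert_mod" and F :: "('a, 'f) hilbert_mod"
    and t :: "('e, 'f) unbounded_op" +
  assumes linear: "linear_op E F t"
begin

lemma dom_closed: "x \<in> dom_of t \<Longrightarrow> x \<in> carrier E"
  and app_closed: "x \<in> dom_of t \<Longrightarrow> app_of t x \<in> carrier F"
  and zero_dom: "\<zero>\<^bsub>E\<^esub> \<in> dom_of t"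
  and add_dom: "x \<in> dom_of t \<Longrightarrow> y \<in> dom_of t \<Longrightarrow> x \<oplus>\<^bsub>E\<^esub> y \<in> dom_of t"
  and app_add: "x \<in> dom_of t \<Longrightarrow> y \<in> dom_of t \<Longrightarrow> app_of t (x \<oplus>\<^bsub>E\<^esub> y) = app_of t x \<oplus>\<^bsub>F\<^esub> app_of t y"
  and csmult_dom: "x \<in> dom_of t \<Longrightarrow> csmult E c x \<in> dom_of t"
  and app_csmult: "x \<in> dom_of t \<Longrightarrow> app_of t (csmult E c x) = csmult F c (app_of t x)"
  and ract_dom: "x \<in> dom_of t \<Longrightarrow> ract E x a \<in> dom_of t"
  and app_ract: "x \<in> dom_of t \<Longrightarrow> app_of t (ract E x a) = ract F (app_of t x) a"
  using linear by (auto simp: linear_op_def)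

lemma app_zero: "app_of t \<zero>\<^bsub>E\<^esub> = \<zero>\<^bsub>F\<^esub>"
  using app_csmult[OF zero_dom, of 0] zero_dom
  by (simp add: E.csmult_zero_left F.csmult_zero_left app_closed)

lemma minus_dom: "x \<in> dom_of t \<Longrightarrow> \<ominus>\<^bsub>E\<^esub> x \<in> dom_of t"
  using csmult_dom[of x "-1"] by (simp add: E.csmult_minus1 dom_closed)

lemma app_minus: "x \<in> dom_of t \<Longrightarrow> app_of t (\<ominus>\<^bsub>E\<^esub> x) = \<ominus>\<^bsub>F\<^esub> app_of t x"
  using app_csmult[of x "-1"] by (simp add: E.csmult_minus1 F.csmult_minus1 dom_closed app_closed)

lemma diff_dom: "x \<in> dom_of t \<Longrightarrow> y \<in> dom_of t \<Longrightarrow> x \<ominus>\<^bsub>E\<^esub> y \<in> dom_of t"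
  by (simp add: a_minus_def add_dom minus_dom)

lemma app_diff:
  "x \<in> dom_of t \<Longrightarrow> y \<in> dom_of t \<Longrightarrow> app_of t (x \<ominus>\<^bsub>E\<^esub> y) = app_of t x \<ominus>\<^bsub>F\<^esub> app_of t y"
  by (simp add: a_minus_def app_add app_minus minus_dom)

lemma ker_closed: "x \<in> ker_of F t \<Longrightarrow> x \<in> carrier E"
  by (auto simp: ker_of_def dom_closed)

lemma ran_closed: "y \<in> ran_of t \<Longrightarrow> y \<in> carrier F"
  by (auto simp: ran_of_def app_closed)

lemma ran_add: "y \<in> ran_of t \<Longrightarrow> z \<in> ran_of t \<Longrightarrow> y \<oplus>\<^bsub>F\<^esub> z \<in> ran_of t"
  by (auto simp: ran_of_def app_add[symmetric] add_dom)

lemma ran_csmult: "y \<in> ran_of t \<Longrightarrow> csmult F c y \<in> ran_of t"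
  by (auto simp: ran_of_def app_csmult[symmetric] csmult_dom)

lemma ran_diff: "y \<in> ran_of t \<Longrightarrow> z \<in> ran_of t \<Longrightarrow> y \<ominus>\<^bsub>F\<^esub> z \<in> ran_of t"
  by (auto simp: ran_of_def app_diff[symmetric] diff_dom)

lemma ran_zero: "\<zero>\<^bsub>F\<^esub> \<in> ran_of t"
  using zero_dom by (auto simp: ran_of_def app_zero[symmetric])

end

locale adjoint_pair = T: linear_operator E F t + S: linear_operator F E s
  for E :: "('a::cstar_algebra, 'e) hilbert_mod" and F :: "('a, 'f) hilbert_mod"
    and t :: "('e, 'f) unbounded_op" and s :: "('f, 'e) unbounded_op" +
  assumes adj: "x \<in> dom_of t \<Longrightarrow> y \<in> dom_of s \<Longrightarrow> ip F (app_of t x) y = ip E x (app_of s y)"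
begin

lemma adj': "x \<in> dom_of t \<Longrightarrow> y \<in> dom_of s \<Longrightarrow> ip F y (app_of t x) = ip E (app_of s y) x"
  using adj[of x y] T.F.ip_cstar[of "app_of t x" y] T.E.ip_cstar[of x "app_of s y"]
  by (simp add: T.app_closed S.app_closed T.dom_closed S.dom_closed)

lemma swap: "adjoint_pair F E s t"
  by unfold_locales (simp add: adj')

text \<open>\<open>\<langle>s b, a\<rangle> = \<langle>b, t a\<rangle>\<close> makes kernel and range orthogonal.\<close>

lemma ker_orthogonal_ran: "a \<in> ker_of F t \<Longrightarrow> x \<in> ran_of s \<Longrightarrow> ip E a x = 0"
  unfolding ker_of_def ran_of_def by (auto simp: adj[symmetric] S.dom_closed)

lemma ran_in_kernel_zero:
  assumes "y \<in> dom_of s" "app_of s y \<in> dom_of t" "app_of t (app_of s y) = \<zero>\<^bsub>F\<^esub>"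
  shows "app_of s y = \<zero>\<^bsub>E\<^esub>"
  using ker_orthogonal_ran[of "app_of s y" "app_of s y"] assms
  by (intro T.E.ip_definite) (auto simp: ker_of_def ran_of_def S.app_closed)

end

text \<open>A regular operator and its adjoint form such a pair, and this is all that the decomposition
  theorems use of them. A Dirac operator and its formal adjoint can be shown to form such a pair without
  determining the domain of the true adjoint.\<close>

locale regular_pair = adjoint_pair +
  assumes surj: "x \<in> carrier E \<Longrightarrow>
      \<exists>u\<in>dom_of t. app_of t u \<in> dom_of s \<and> u \<oplus>\<^bsub>E\<^esub> app_of s (app_of t u) = x"
    and surj': "y \<in> carrier F \<Longrightarrow>
      \<exists>v\<in>dom_of s. app_of s v \<in> dom_of t \<and> v \<oplus>\<^bsub>F\<^esub> app_of t (app_of s v) = y"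

lemma (in regular_pair) swap_regular_pair: "regular_pair F E s t"
proof -
  interpret swapped: adjoint_pair F E s t by (rule swap)
  show ?thesis by unfold_locales (rule surj', assumption, rule surj, assumption)
qed

locale closed_range_pair = regular_pair + H: hilbert_module F +
  assumes closed: "closed_range F t"
begin

sublocale R: Submetric "carrier F" "hdist F" "ran_of t"
  by unfold_locales (auto simp: T.ran_closed)

lemma ran_mcomplete: "R.sub.mcomplete"
  using closed R.closedin_eq_mcomplete[OF H.complete]
  by (simp add: closed_range_def htopology_def)

text \<open>The functionals \<open>\<langle>v, \<cdot>\<rangle>\<close> with \<open>v \<in> ran t\<close>, \<open>\<parallel>s v\<parallel> \<le> 1\<close> are pointwise bounded on \<open>ran t\<close>, because
  \<open>\<langle>v, t x\<rangle> = \<langle>s v, x\<rangle>\<close>; the uniform boundedness principle bounds their norms \<open>\<parallel>v\<parallel>\<close>.\<close>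

lemma adjoint_bounded_on_unit:
  obtains B where "B \<ge> 0"
    "\<And>v. \<lbrakk>v \<in> ran_of t; v \<in> dom_of s; hnorm E (app_of s v) \<le> 1\<rbrakk> \<Longrightarrow> hnorm F v \<le> B"
proof -
  define V where "V = {v \<in> ran_of t \<inter> dom_of s. hnorm E (app_of s v) \<le> 1}"
  have V: "v \<in> carrier F" if "v \<in> V" for v using that by (auto simp: V_def T.ran_closed)
  define K where "K n = {y \<in> ran_of t. \<forall>v\<in>V. norm (ip F v y) \<le> real n}" for n
  have "closedin R.sub.mtopology (K n)" for n
  proof -
    have "closedin (htopology F) {y \<in> carrier F. \<forall>v\<in>V. norm (ip F v y) \<le> real n}"
      unfolding T.F.closedin_htopology_iff
    proof (intro conjI allI impI)
      fix \<sigma> l assume r: "range \<sigma> \<subseteq> {y \<in> carrier F. \<forall>v\<in>V. norm (ip F v y) \<le> real n}"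
        and l: "hlim F \<sigma> l"
      have "norm (ip F v l) \<le> real n" if v: "v \<in> V" for v
      proof -
        have lim: "(\<lambda>m. norm (ip F v (\<sigma> m))) \<longlonglongrightarrow> norm (ip F v l)"
          by (rule tendsto_norm[OF T.F.tendsto_ip_right[OF l V[OF v]]])
        have "norm (ip F v (\<sigma> m)) \<le> real n" for m using r v by auto
        then show ?thesis by (intro LIMSEQ_le_const2[OF lim]) blast
      qed
      then show "l \<in> {y \<in> carrier F. \<forall>v\<in>V. norm (ip F v y) \<le> real n}"
        using l by (auto simp: hlim_def)
    qed auto
    moreover have "K n = {y \<in> carrier F. \<forall>v\<in>V. norm (ip F v y) \<le> real n} \<inter> ran_of t"
      by (auto simp: K_def T.ran_closed)
    ultimately show ?thesis
      unfolding R.mtopology_submetric closedin_subtopology htopology_def by blast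
  qed
  moreover have "\<Union>(range K) = ran_of t"
  proof -
    have "y \<in> \<Union>(range K)" if y: "y \<in> ran_of t" for y
    proof -
      obtain x where x: "x \<in> dom_of t" "y = app_of t x" using y by (auto simp: ran_of_def)
      obtain n where n: "hnorm E x \<le> real n" using real_arch_simple by blast
      have "norm (ip F v y) \<le> real n" if "v \<in> V" for v
      proof -
        have v: "v \<in> dom_of s" "hnorm E (app_of s v) \<le> 1" using that by (auto simp: V_def)
        have "norm (ip F v y) \<le> hnorm E (app_of s v) * hnorm E x"
          using x v by (simp add: adj' T.E.cauchy_schwarz S.app_closed T.dom_closed)
        also have "\<dots> \<le> 1 * hnorm E x" using v by (intro mult_right_mono) auto
        finally show ?thesis using n by simp
      qed
      then show ?thesis using y by (auto simp: K_def)
    qed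
    then show ?thesis by (auto simp: K_def)
  qed
  moreover have "R.sub.mtopology interior_of (ran_of t) \<noteq> {}"
    using T.ran_zero interior_of_topspace[of R.sub.mtopology] by auto
  ultimately obtain n where "R.sub.mtopology interior_of (K n) \<noteq> {}"
    using R.sub.metric_Baire_category_alt[OF ran_mcomplete, of "range K"] by auto
  then obtain y0 where "y0 \<in> R.sub.mtopology interior_of (K n)" by blast
  then obtain r where r: "r > 0" "R.sub.mball y0 r \<subseteq> K n" and y0: "y0 \<in> ran_of t"
    by (auto simp: R.sub.metric_interior_of)
  show thesis
  proof (rule that[of "4 * real n / r"])
    show "0 \<le> 4 * real n / r" using r by simp
    fix v assume "v \<in> ran_of t" "v \<in> dom_of s" "hnorm E (app_of s v) \<le> 1"
    then have v: "v \<in> V" "v \<in> ran_of t" "v \<in> carrier F" by (auto simp: V_def T.ran_closed)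
    have y0c: "y0 \<in> carrier F" using y0 by (rule T.ran_closed)
    show "hnorm F v \<le> 4 * real n / r"
    proof (cases "hnorm F v = 0")
      case False
      then have pos: "hnorm F v > 0" using T.F.hnorm_nonneg[of v] by linarith
      \<comment> \<open>With this \<open>c\<close> the point \<open>y\<^sub>0 + c v\<close> has distance \<open>r/2\<close> from \<open>y\<^sub>0\<close>.\<close>
      define c where "c = r / (2 * hnorm F v)"
      have c: "c > 0" using r pos by (simp add: c_def)
      define y where "y = y0 \<oplus>\<^bsub>F\<^esub> csmult F (complex_of_real c) v"
      have yR: "y \<in> ran_of t" using y0 v by (simp add: y_def T.ran_add T.ran_csmult)
      have "y0 \<ominus>\<^bsub>F\<^esub> y = \<ominus>\<^bsub>F\<^esub> csmult F (complex_of_real c) v"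
        using v y0c by (intro T.F.ip_eqI) (simp_all add: y_def T.F.ip_simps)
      then have "hnorm F (y0 \<ominus>\<^bsub>F\<^esub> y) = c * hnorm F v"
        using v c by (simp add: T.F.hnorm_minus T.F.hnorm_csmult T.F.csmult_closed)
      then have "hdist F y0 y = r / 2"
        using yR y0c pos by (simp add: hdist_def T.ran_closed c_def)
      then have "y \<in> K n" "y0 \<in> K n" using r y0 yR by auto
      then have "norm (ip F v y) \<le> real n" "norm (ip F v y0) \<le> real n" using v by (auto simp: K_def)
      moreover have "ip F v y = ip F v y0 + c *\<^sub>R ip F v v"
        using v y0c by (simp add: y_def T.F.ip_simps scaleC_of_real)
      ultimately have "norm (c *\<^sub>R ip F v v) \<le> 2 * real n"
        using norm_triangle_ineq4[of "ip F v y" "ip F v y0"] by simp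
      then have "c * (hnorm F v)\<^sup>2 \<le> 2 * real n" using c by (simp add: T.F.hnorm_power2)
      then have "r * hnorm F v \<le> 4 * real n" using pos by (simp add: c_def power2_eq_square field_simps)
      then show ?thesis using r by (simp add: field_simps)
    qed (use r in simp)
  qed
qed

lemma adjoint_bounded_below:
  obtains C where "C > 0"
    "\<And>v. \<lbrakk>v \<in> ran_of t; v \<in> dom_of s\<rbrakk> \<Longrightarrow> hnorm F v \<le> C * hnorm E (app_of s v)"
proof -
  obtain B where B: "B \<ge> 0"
    "\<And>v. \<lbrakk>v \<in> ran_of t; v \<in> dom_of s; hnorm E (app_of s v) \<le> 1\<rbrakk> \<Longrightarrow> hnorm F v \<le> B"
    by (rule adjoint_bounded_on_unit) blast
  show thesis
  proof (rule that[of "B + 1"])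
    show "B + 1 > 0" using B by simp
    fix v assume v: "v \<in> ran_of t" "v \<in> dom_of s"
    show "hnorm F v \<le> (B + 1) * hnorm E (app_of s v)"
    proof (rule field_le_epsilon)
      fix e :: real assume e: "e > 0"
      define q where "q = hnorm E (app_of s v) + e / (B + 1)"
      have "e / (B + 1) > 0" using e B by simp
      then have q: "q > 0" "hnorm E (app_of s v) \<le> q"
        using T.E.hnorm_nonneg[of "app_of s v"] unfolding q_def by linarith+
      let ?w = "csmult F (complex_of_real (1/q)) v"
      have "hnorm E (app_of s ?w) \<le> 1"
        using q v by (simp add: S.app_csmult T.E.hnorm_csmult S.app_closed norm_divide)
      then have "hnorm F ?w \<le> B" using v by (intro B) (auto simp: T.ran_csmult S.csmult_dom)
      then have "hnorm F v \<le> B * q"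
        using q v by (simp add: T.F.hnorm_csmult T.ran_closed norm_divide field_simps)
      also have "\<dots> \<le> (B + 1) * q" using q by (intro mult_right_mono) auto
      also have "\<dots> = (B + 1) * hnorm E (app_of s v) + e" using B by (simp add: q_def field_simps)
      finally show "hnorm F v \<le> (B + 1) * hnorm E (app_of s v) + e" .
    qed
  qed
qed

text \<open>Solutions are sought inside \<open>ran t\<close>, where \<open>s\<close> is bounded below.\<close>

definition solvable :: "real \<Rightarrow> bool" where
  "solvable \<mu> \<longleftrightarrow> (\<forall>y\<in>ran_of t. \<exists>v\<in>ran_of t. v \<in> dom_of s \<and> app_of s v \<in> dom_of t \<and>
     csmult F (complex_of_real \<mu>) v \<oplus>\<^bsub>F\<^esub> app_of t (app_of s v) = y)"

text \<open>If \<open>y = t x\<close> and \<open>u + s t u = x\<close>, then \<open>v = t u\<close> solves \<open>v + t s v = y\<close>.\<close>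

lemma solvable_one: "solvable 1"
  unfolding solvable_def
proof
  fix y assume "y \<in> ran_of t"
  then obtain x where x: "x \<in> dom_of t" "y = app_of t x" by (auto simp: ran_of_def)
  obtain u where u: "u \<in> dom_of t" "app_of t u \<in> dom_of s" "u \<oplus>\<^bsub>E\<^esub> app_of s (app_of t u) = x"
    using surj[of x] T.dom_closed x by blast
  have stu: "app_of s (app_of t u) = x \<ominus>\<^bsub>E\<^esub> u"
    using u x T.dom_closed S.app_closed by (intro T.E.ip_eqI) (auto simp: T.E.ip_simps simp flip: u(3))
  then have "app_of s (app_of t u) \<in> dom_of t" using u x by (simp add: T.diff_dom)
  moreover have "csmult F (complex_of_real 1) (app_of t u) \<oplus>\<^bsub>F\<^esub> app_of t (app_of s (app_of t u)) = y"
    unfolding stu x(2) using u x T.app_closed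
    by (intro T.F.ip_eqI) (auto simp: T.app_diff T.F.csmult_one T.F.ip_simps)
  ultimately show "\<exists>v\<in>ran_of t. v \<in> dom_of s \<and> app_of s v \<in> dom_of t \<and>
      csmult F (complex_of_real 1) v \<oplus>\<^bsub>F\<^esub> app_of t (app_of s v) = y"
    using u by (auto simp: ran_of_def)
qed

text \<open>\<open>\<langle>v, \<mu> v + t s v\<rangle> = \<mu> \<langle>v, v\<rangle> + \<langle>s v, s v\<rangle>\<close> dominates \<open>\<langle>s v, s v\<rangle>\<close>. The bound is the same for all \<open>\<mu> \<ge> 0\<close>,
  so the equation can be continued from \<open>\<mu> = 1\<close> to \<open>\<mu> = 0\<close> in steps of a fixed length.\<close>

lemma shifted_bounded_below:
  assumes C: "C > 0" "\<And>v. \<lbrakk>v \<in> ran_of t; v \<in> dom_of s\<rbrakk> \<Longrightarrow> hnorm F v \<le> C * hnorm E (app_of s v)"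
    and \<mu>: "\<mu> \<ge> 0" and v: "v \<in> ran_of t" "v \<in> dom_of s" "app_of s v \<in> dom_of t"
  shows "hnorm F v \<le> C\<^sup>2 * hnorm F (csmult F (complex_of_real \<mu>) v \<oplus>\<^bsub>F\<^esub> app_of t (app_of s v))"
    (is "_ \<le> _ * hnorm F ?y")
proof (cases "hnorm F v = 0")
  case False
  have vc: "v \<in> carrier F" "app_of s v \<in> carrier E" "?y \<in> carrier F"
    using v by (auto simp: T.ran_closed S.app_closed T.app_closed T.F.csmult_closed)
  have "ip F v ?y = ip E (app_of s v) (app_of s v) + \<mu> *\<^sub>R ip F v v"
    using v vc by (simp add: T.F.ip_simps adj' T.app_closed scaleC_of_real)
  moreover have "cpositive (\<mu> *\<^sub>R ip F v v)"
  proof -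
    obtain b where "ip F v v = cstar b * b" using T.F.ip_positive[OF vc(1)] by (auto simp: cpositive_def)
    then have "\<mu> *\<^sub>R ip F v v = cstar (sqrt \<mu> *\<^sub>R b) * (sqrt \<mu> *\<^sub>R b)"
      using \<mu> by (simp add: cstar_scaleR)
    then show ?thesis unfolding cpositive_def by blast
  qed
  ultimately have "(hnorm E (app_of s v))\<^sup>2 \<le> norm (ip F v ?y)"
    using cpositive_norm_mono T.E.ip_positive[OF vc(2)] T.E.hnorm_power2 by metis
  also have "\<dots> \<le> hnorm F v * hnorm F ?y" using vc by (intro T.F.cauchy_schwarz)
  finally have "C\<^sup>2 * (hnorm E (app_of s v))\<^sup>2 \<le> C\<^sup>2 * (hnorm F v * hnorm F ?y)"
    by (intro mult_left_mono) auto
  moreover have "(hnorm F v)\<^sup>2 \<le> (C * hnorm E (app_of s v))\<^sup>2"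
    using C(2) v by (intro power_mono) auto
  ultimately have "hnorm F v * hnorm F v \<le> hnorm F v * (C\<^sup>2 * hnorm F ?y)"
    by (simp add: power_mult_distrib power2_eq_square mult_ac)
  then show ?thesis using False T.F.hnorm_nonneg[of v] by (simp add: mult_le_cancel_left)
qed simp

text \<open>The equation \<open>(\<mu> - \<delta>) v + t s v = y\<close> says that \<open>v\<close> is a fixed point of
  \<open>v \<mapsto> (\<mu> + t s)\<^sup>-\<^sup>1 (y + \<delta> v)\<close>, which is a contraction for small \<open>\<delta>\<close>.\<close>

lemma solvable_step:
  assumes C: "C > 0" "\<And>v. \<lbrakk>v \<in> ran_of t; v \<in> dom_of s\<rbrakk> \<Longrightarrow> hnorm F v \<le> C * hnorm E (app_of s v)"
    and sol: "solvable \<mu>" and \<mu>: "\<mu> \<ge> 0" and \<delta>: "0 \<le> \<delta>" "C\<^sup>2 * \<delta> \<le> 1/2"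
  shows "solvable (\<mu> - \<delta>)"
  unfolding solvable_def
proof
  fix y assume y: "y \<in> ran_of t"
  let ?L = "\<lambda>u. csmult F (complex_of_real \<mu>) u \<oplus>\<^bsub>F\<^esub> app_of t (app_of s u)"
  define ok where "ok u \<longleftrightarrow> u \<in> ran_of t \<and> u \<in> dom_of s \<and> app_of s u \<in> dom_of t" for u
  have okc: "u \<in> carrier F" "app_of t (app_of s u) \<in> carrier F" if "ok u" for u
    using that by (auto simp: ok_def S.dom_closed T.app_closed)
  have "\<forall>v\<in>ran_of t. \<exists>u. ok u \<and> ?L u = y \<oplus>\<^bsub>F\<^esub> csmult F (complex_of_real \<delta>) v"
    using sol y unfolding solvable_def ok_def by (metis T.ran_add T.ran_csmult)
  then obtain f where f: "\<And>v. v \<in> ran_of t \<Longrightarrow> ok (f v)"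
      "\<And>v. v \<in> ran_of t \<Longrightarrow> ?L (f v) = y \<oplus>\<^bsub>F\<^esub> csmult F (complex_of_real \<delta>) v"
    by metis
  have lip: "hdist F (f v) (f w) \<le> (1/2) * hdist F v w" if v: "v \<in> ran_of t" and w: "w \<in> ran_of t" for v w
  proof -
    have c: "v \<in> carrier F" "w \<in> carrier F" "y \<in> carrier F" using v w y by (auto simp: T.ran_closed)
    let ?d = "f v \<ominus>\<^bsub>F\<^esub> f w"
    have ok: "ok (f v)" "ok (f w)" using f v w by auto
    have d: "?d \<in> ran_of t" "?d \<in> dom_of s" "app_of s ?d \<in> dom_of t"
      using ok by (auto simp: ok_def T.ran_diff S.diff_dom S.app_diff T.diff_dom)
    have "?L ?d = ?L (f v) \<ominus>\<^bsub>F\<^esub> ?L (f w)"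
      using ok okc[OF ok(1)] okc[OF ok(2)] unfolding ok_def
      by (intro T.F.ip_eqI) (simp_all add: T.F.ip_simps S.app_diff T.app_diff scaleC_diff_right)
    also have "\<dots> = csmult F (complex_of_real \<delta>) (v \<ominus>\<^bsub>F\<^esub> w)"
      unfolding f(2)[OF v] f(2)[OF w] using c
      by (intro T.F.ip_eqI) (simp_all add: T.F.ip_simps scaleC_diff_right)
    finally have "hnorm F ?d \<le> C\<^sup>2 * (\<delta> * hnorm F (v \<ominus>\<^bsub>F\<^esub> w))"
      using shifted_bounded_below[OF C \<mu> d] \<delta> c by (simp add: T.F.hnorm_csmult)
    also have "\<dots> \<le> (1/2) * hnorm F (v \<ominus>\<^bsub>F\<^esub> w)"
      using mult_right_mono[OF \<delta>(2), of "hnorm F (v \<ominus>\<^bsub>F\<^esub> w)"] by (simp add: mult_ac)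
    finally show ?thesis using c okc ok by (simp add: hdist_def)
  qed
  have "ran_of t \<noteq> {}" using T.ran_zero by auto
  moreover have "f \<in> ran_of t \<rightarrow> ran_of t" using f(1) by (auto simp: ok_def)
  ultimately obtain v where v: "v \<in> ran_of t" "f v = v"
    using R.sub.Banach_fixedpoint_thm[OF ran_mcomplete, of f "1/2"] lip by auto
  have okv: "ok v" using f(1)[OF v(1)] v by simp
  have eq: "?L v = y \<oplus>\<^bsub>F\<^esub> csmult F (complex_of_real \<delta>) v" using f(2)[OF v(1)] v by simp
  have "csmult F (complex_of_real (\<mu> - \<delta>)) v \<oplus>\<^bsub>F\<^esub> app_of t (app_of s v) = y"
  proof (rule T.F.ip_eqI)
    fix z assume z: "z \<in> carrier F"
    have "ip F z (?L v) = ip F z (y \<oplus>\<^bsub>F\<^esub> csmult F (complex_of_real \<delta>) v)" by (simp add: eq)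
    then have "\<mu> *\<^sub>R ip F z v + ip F z (app_of t (app_of s v)) = ip F z y + \<delta> *\<^sub>R ip F z v"
      using z okc[OF okv] y by (simp add: T.F.ip_simps T.ran_closed scaleC_of_real)
    then show "ip F z (csmult F (complex_of_real (\<mu> - \<delta>)) v \<oplus>\<^bsub>F\<^esub> app_of t (app_of s v)) = ip F z y"
      using z okc[OF okv]
      by (simp only: T.F.ip_simps scaleC_of_real) (simp add: scaleR_diff_left algebra_simps)
  qed (use okc[OF okv] y in \<open>auto simp: T.F.csmult_closed T.ran_closed\<close>)
  then show "\<exists>v\<in>ran_of t. v \<in> dom_of s \<and> app_of s v \<in> dom_of t \<and>
      csmult F (complex_of_real (\<mu> - \<delta>)) v \<oplus>\<^bsub>F\<^esub> app_of t (app_of s v) = y"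
    using okv by (auto simp: ok_def)
qed

lemma ran_surj:
  assumes "y \<in> ran_of t"
  obtains v where "v \<in> ran_of t" "v \<in> dom_of s" "app_of s v \<in> dom_of t" "app_of t (app_of s v) = y"
proof -
  obtain C where C: "C > 0"
    "\<And>v. \<lbrakk>v \<in> ran_of t; v \<in> dom_of s\<rbrakk> \<Longrightarrow> hnorm F v \<le> C * hnorm E (app_of s v)"
    by (rule adjoint_bounded_below) blast
  \<comment> \<open>\<open>N\<close> steps of length \<open>1 / N\<close> lead from \<open>\<mu> = 1\<close> to \<open>\<mu> = 0\<close>.\<close>
  obtain N :: nat where N: "2 * C\<^sup>2 + 1 \<le> real N" using real_arch_simple by blast
  have N0: "real N > 0" using N zero_le_power2[of C] by linarith
  have step: "C\<^sup>2 * (1 / real N) \<le> 1/2"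
    using N N0 by (simp add: field_simps)
  have "solvable (1 - real n / real N)" if "n \<le> N" for n
    using that
  proof (induction n)
    case 0 show ?case using solvable_one by simp
  next
    case (Suc n)
    have "solvable (1 - real n / real N - 1 / real N)"
      using Suc N0 by (intro solvable_step[OF C _ _ _ step]) (auto simp: field_simps)
    then show ?case by (simp add: add_divide_distrib diff_diff_eq add.commute)
  qed
  from this[of N] have "solvable 0" using N0 by simp
  then obtain v where v: "v \<in> ran_of t" "v \<in> dom_of s" "app_of s v \<in> dom_of t"
      "csmult F 0 v \<oplus>\<^bsub>F\<^esub> app_of t (app_of s v) = y"
    using assms unfolding solvable_def by auto
  then show thesis
    using that by (simp add: T.F.csmult_zero_left T.ran_closed T.app_closed)
qed

text \<open>Write \<open>x = u + s t u\<close> and \<open>t u = t s v\<close>; then \<open>u - s v \<in> ker t\<close>.\<close>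

theorem domain_decomposition:
  assumes x: "x \<in> carrier E"
  obtains a b where "a \<in> ker_of F t" "b \<in> ran_of s" "x = a \<oplus>\<^bsub>E\<^esub> b"
proof -
  obtain u where u: "u \<in> dom_of t" "app_of t u \<in> dom_of s" "u \<oplus>\<^bsub>E\<^esub> app_of s (app_of t u) = x"
    using surj[OF x] by blast
  obtain v where v: "v \<in> dom_of s" "app_of s v \<in> dom_of t" "app_of t (app_of s v) = app_of t u"
    using ran_surj[of "app_of t u"] u(1) by (auto simp: ran_of_def)
  have "u \<ominus>\<^bsub>E\<^esub> app_of s v \<in> ker_of F t"
    using u v by (auto simp: ker_of_def T.diff_dom T.app_diff T.app_closed T.F.minus_eq_zero_iff)
  moreover have "app_of s v \<oplus>\<^bsub>E\<^esub> app_of s (app_of t u) \<in> ran_of s"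
    using u v by (intro S.ran_add) (auto simp: ran_of_def)
  moreover have "x = (u \<ominus>\<^bsub>E\<^esub> app_of s v) \<oplus>\<^bsub>E\<^esub> (app_of s v \<oplus>\<^bsub>E\<^esub> app_of s (app_of t u))"
    unfolding u(3)[symmetric] using u v T.dom_closed S.app_closed
    by (intro T.E.ip_eqI) (auto simp: T.E.ip_simps)
  ultimately show thesis using that by blast
qed

text \<open>Write \<open>y = v + t s v\<close> and \<open>t s v = t s w\<close> with \<open>w \<in> ran t\<close>. Then \<open>s (v - w)\<close> lies in \<open>ker t\<close> and in \<open>ran s\<close>, which
  are orthogonal, so \<open>v - w \<in> ker s\<close>.\<close>

theorem codomain_decomposition:
  assumes y: "y \<in> carrier F"
  obtains a b where "a \<in> ker_of E s" "b \<in> ran_of t" "y = a \<oplus>\<^bsub>F\<^esub> b"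
proof -
  obtain v where v: "v \<in> dom_of s" "app_of s v \<in> dom_of t" "v \<oplus>\<^bsub>F\<^esub> app_of t (app_of s v) = y"
    using surj'[OF y] by blast
  have "app_of t (app_of s v) \<in> ran_of t" using v by (auto simp: ran_of_def)
  then obtain w where w: "w \<in> ran_of t" "w \<in> dom_of s" "app_of s w \<in> dom_of t"
      "app_of t (app_of s w) = app_of t (app_of s v)"
    by (rule ran_surj)
  have "app_of s (v \<ominus>\<^bsub>F\<^esub> w) = \<zero>\<^bsub>E\<^esub>"
    using v w by (intro ran_in_kernel_zero)
      (simp_all add: S.diff_dom S.app_diff T.diff_dom T.app_diff T.app_closed T.F.minus_eq_zero_iff)
  then have "v \<ominus>\<^bsub>F\<^esub> w \<in> ker_of E s" using v w by (simp add: ker_of_def S.diff_dom)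
  moreover have "w \<oplus>\<^bsub>F\<^esub> app_of t (app_of s v) \<in> ran_of t"
    using v w by (intro T.ran_add) (auto simp: ran_of_def)
  moreover have "y = (v \<ominus>\<^bsub>F\<^esub> w) \<oplus>\<^bsub>F\<^esub> (w \<oplus>\<^bsub>F\<^esub> app_of t (app_of s v))"
    unfolding v(3)[symmetric] using v w S.dom_closed T.app_closed
    by (intro T.F.ip_eqI) (auto simp: T.F.ip_simps)
  ultimately show thesis using that by blast
qed

end

section \<open>Regular operators and their adjoints\<close>

lemma adjoint_op_unique:
  assumes "linear_operator E F t" and d: "dense_in E (dom_of t)"
    and y: "y \<in> carrier F" and z: "z \<in> carrier E"
    and eq: "\<And>x. x \<in> dom_of t \<Longrightarrow> ip F (app_of t x) y = ip E x z"
  shows "y \<in> dom_of (adjoint_op E F t)" "app_of (adjoint_op E F t) y = z"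
proof -
  interpret linear_operator E F t by fact
  show "y \<in> dom_of (adjoint_op E F t)" using y z eq by (auto simp: adjoint_op_def)
  have "(THE z. z \<in> carrier E \<and> (\<forall>x\<in>dom_of t. ip F (app_of t x) y = ip E x z)) = z"
  proof (rule the_equality)
    show "z \<in> carrier E \<and> (\<forall>x\<in>dom_of t. ip F (app_of t x) y = ip E x z)" using z eq by blast
    fix w assume "w \<in> carrier E \<and> (\<forall>x\<in>dom_of t. ip F (app_of t x) y = ip E x w)"
    then show "w = z"
      using z eq by (intro E.ip_eqI_dense[OF d]) (auto simp: dom_closed)
  qed
  then show "app_of (adjoint_op E F t) y = z" by (simp add: adjoint_op_def)
qed

lemma adjoint_pair_adjoint_op:
  assumes "linear_operator E F t" and d: "dense_in E (dom_of t)"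
  shows "adjoint_pair E F t (adjoint_op E F t)"
proof -
  interpret linear_operator E F t by fact
  let ?s = "adjoint_op E F t"
  note uniq = adjoint_op_unique[OF assms]
  have s: "y \<in> carrier F" "app_of ?s y \<in> carrier E"
    "\<And>x. x \<in> dom_of t \<Longrightarrow> ip F (app_of t x) y = ip E x (app_of ?s y)" if "y \<in> dom_of ?s" for y
  proof -
    obtain z where z: "y \<in> carrier F" "z \<in> carrier E"
        "\<And>x. x \<in> dom_of t \<Longrightarrow> ip F (app_of t x) y = ip E x z"
      using \<open>y \<in> dom_of ?s\<close> by (auto simp: adjoint_op_def)
    then have "app_of ?s y = z" by (intro uniq(2))
    then show "y \<in> carrier F" "app_of ?s y \<in> carrier E"
      "\<And>x. x \<in> dom_of t \<Longrightarrow> ip F (app_of t x) y = ip E x (app_of ?s y)"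
      using z by auto
  qed
  have "linear_op F E ?s"
    unfolding linear_op_def
  proof (intro conjI ballI allI)
    show "dom_of ?s \<subseteq> carrier F" "app_of ?s ` dom_of ?s \<subseteq> carrier E" using s by auto
    show "\<zero>\<^bsub>F\<^esub> \<in> dom_of ?s" by (rule uniq(1)[of _ "\<zero>\<^bsub>E\<^esub>"]) (auto simp: dom_closed app_closed)
    fix y assume y: "y \<in> dom_of ?s"
    { fix z assume z: "z \<in> dom_of ?s"
      have H: "ip F (app_of t x) (y \<oplus>\<^bsub>F\<^esub> z) = ip E x (app_of ?s y \<oplus>\<^bsub>E\<^esub> app_of ?s z)"
        if "x \<in> dom_of t" for x
        using s[OF y] s[OF z] that by (simp add: E.ip_simps F.ip_simps dom_closed app_closed)
      then show "y \<oplus>\<^bsub>F\<^esub> z \<in> dom_of ?s" "app_of ?s (y \<oplus>\<^bsub>F\<^esub> z) = app_of ?s y \<oplus>\<^bsub>E\<^esub> app_of ?s z"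
        using uniq[OF _ _ H] s(1,2)[OF y] s(1,2)[OF z] by simp_all }
    { fix c
      have H: "ip F (app_of t x) (csmult F c y) = ip E x (csmult E c (app_of ?s y))"
        if "x \<in> dom_of t" for x
        using s[OF y] that by (simp add: E.ip_simps F.ip_simps dom_closed app_closed)
      then show "csmult F c y \<in> dom_of ?s" "app_of ?s (csmult F c y) = csmult E c (app_of ?s y)"
        using uniq[OF _ _ H] s(1,2)[OF y] by (simp_all add: E.csmult_closed F.csmult_closed) }
    { fix a
      have H: "ip F (app_of t x) (ract F y a) = ip E x (ract E (app_of ?s y) a)"
        if "x \<in> dom_of t" for x
        using s[OF y] that by (simp add: E.ip_ract_right F.ip_ract_right dom_closed app_closed)
      then show "ract F y a \<in> dom_of ?s" "app_of ?s (ract F y a) = ract E (app_of ?s y) a"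
        using uniq[OF _ _ H] s(1,2)[OF y] by (simp_all add: E.ract_closed F.ract_closed) }
  qed
  then interpret S: linear_operator F E ?s by unfold_locales
  show ?thesis by unfold_locales (rule s(3))
qed

locale closed_adjoint_pair = adjoint_pair + HE: hilbert_module E + HF: hilbert_module F +
  assumes t_closed: "\<lbrakk>range \<sigma> \<subseteq> dom_of t; hlim E \<sigma> x; hlim F (\<lambda>n. app_of t (\<sigma> n)) y\<rbrakk> \<Longrightarrow>
      x \<in> dom_of t \<and> app_of t x = y"
    and s_closed: "\<lbrakk>range \<tau> \<subseteq> dom_of s; hlim F \<tau> y; hlim E (\<lambda>n. app_of s (\<tau> n)) x\<rbrakk> \<Longrightarrow>
      y \<in> dom_of s \<and> app_of s y = x"
begin

lemma swap_closed: "closed_adjoint_pair F E s t"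
proof -
  interpret swapped: adjoint_pair F E s t by (rule swap)
  show ?thesis
  proof unfold_locales
    show "y \<in> dom_of s \<and> app_of s y = x"
      if "range \<tau> \<subseteq> dom_of s" "hlim F \<tau> y" "hlim E (\<lambda>n. app_of s (\<tau> n)) x" for \<tau> y x
      using that by (rule s_closed)
    show "x \<in> dom_of t \<and> app_of t x = y"
      if "range \<sigma> \<subseteq> dom_of t" "hlim E \<sigma> x" "hlim F (\<lambda>n. app_of t (\<sigma> n)) y" for \<sigma> x y
      using that by (rule t_closed)
  qed
qed

text \<open>\<open>\<langle>u, (1 + s t) u\<rangle> = \<langle>u, u\<rangle> + \<langle>t u, t u\<rangle>\<close> dominates both of its terms.\<close>

lemma one_plus_bounded_below:
  assumes u: "u \<in> dom_of t" "app_of t u \<in> dom_of s"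
  shows "hnorm E u \<le> hnorm E (u \<oplus>\<^bsub>E\<^esub> app_of s (app_of t u))" (is "_ \<le> hnorm E ?x")
    and "hnorm F (app_of t u) \<le> hnorm E (u \<oplus>\<^bsub>E\<^esub> app_of s (app_of t u))"
proof -
  have c: "u \<in> carrier E" "app_of t u \<in> carrier F" "?x \<in> carrier E"
    using u by (auto simp: T.dom_closed T.app_closed S.app_closed)
  have eq: "ip E u ?x = ip E u u + ip F (app_of t u) (app_of t u)"
    using u c by (simp add: T.E.ip_simps S.app_closed adj)
  have cs: "norm (ip E u ?x) \<le> hnorm E u * hnorm E ?x" using c by (intro T.E.cauchy_schwarz)
  have pos: "cpositive (ip E u u)" "cpositive (ip F (app_of t u) (app_of t u))"
    using c by (auto intro: T.E.ip_positive T.F.ip_positive)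
  have "(hnorm E u)\<^sup>2 \<le> norm (ip E u ?x)"
    using cpositive_norm_mono[OF pos] by (simp add: eq T.E.hnorm_power2)
  then have "hnorm E u * hnorm E u \<le> hnorm E u * hnorm E ?x" using cs by (simp add: power2_eq_square)
  then show 1: "hnorm E u \<le> hnorm E ?x"
    using T.E.hnorm_nonneg[of u] T.E.hnorm_nonneg[of ?x] by (cases "hnorm E u = 0") (auto simp: mult_le_cancel_left)
  have "(hnorm F (app_of t u))\<^sup>2 \<le> norm (ip E u ?x)"
    using cpositive_norm_mono[OF pos(2,1)] by (simp add: eq T.F.hnorm_power2 add.commute)
  also have "\<dots> \<le> hnorm E ?x * hnorm E ?x"
    using cs mult_right_mono[OF 1 T.E.hnorm_nonneg[of ?x]] by linarith
  finally have "(hnorm F (app_of t u))\<^sup>2 \<le> (hnorm E ?x)\<^sup>2" by (simp add: power2_eq_square)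
  then show "hnorm F (app_of t u) \<le> hnorm E ?x" by (rule power2_le_imp_le) simp
qed

text \<open>If \<open>u\<^sub>n + s t u\<^sub>n\<close> converges, then \<open>u\<^sub>n\<close> and \<open>t u\<^sub>n\<close> are Cauchy sequences by the preceding bounds.\<close>

lemma range_one_plus_closed:
  assumes x: "hlim E \<sigma> x"
    and \<sigma>: "\<And>n. \<exists>u\<in>dom_of t. app_of t u \<in> dom_of s \<and> u \<oplus>\<^bsub>E\<^esub> app_of s (app_of t u) = \<sigma> n"
  shows "\<exists>u\<in>dom_of t. app_of t u \<in> dom_of s \<and> u \<oplus>\<^bsub>E\<^esub> app_of s (app_of t u) = x"
proof -
  obtain u where u: "\<And>n. u n \<in> dom_of t" "\<And>n. app_of t (u n) \<in> dom_of s"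
      "\<And>n. u n \<oplus>\<^bsub>E\<^esub> app_of s (app_of t (u n)) = \<sigma> n"
    using \<sigma> by metis
  have c: "u n \<in> carrier E" "app_of t (u n) \<in> carrier F" "app_of s (app_of t (u n)) \<in> carrier E" for n
    using u by (auto simp: T.dom_closed T.app_closed S.app_closed)
  have diff: "\<sigma> m \<ominus>\<^bsub>E\<^esub> \<sigma> n = (u m \<ominus>\<^bsub>E\<^esub> u n) \<oplus>\<^bsub>E\<^esub> app_of s (app_of t (u m \<ominus>\<^bsub>E\<^esub> u n))" for m n
    unfolding u(3)[symmetric] using c u(1,2)
    by (intro T.E.ip_eqI) (simp_all add: T.E.ip_simps T.app_diff S.app_diff)
  have bd: "hnorm E (u m \<ominus>\<^bsub>E\<^esub> u n) \<le> hnorm E (\<sigma> m \<ominus>\<^bsub>E\<^esub> \<sigma> n)"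
    "hnorm F (app_of t (u m) \<ominus>\<^bsub>F\<^esub> app_of t (u n)) \<le> hnorm E (\<sigma> m \<ominus>\<^bsub>E\<^esub> \<sigma> n)" for m n
    using one_plus_bounded_below[of "u m \<ominus>\<^bsub>E\<^esub> u n"] u
    by (simp_all add: diff T.diff_dom T.app_diff S.diff_dom)
  have cau: "hCauchy E \<sigma>" by (rule T.E.hlim_imp_hCauchy[OF x])
  have "hCauchy E u" by (rule hCauchy_mono[OF cau]) (use c bd in auto)
  then obtain u0 where u0: "hlim E u u0" using HE.hCauchy_converges by blast
  have "hCauchy F (\<lambda>n. app_of t (u n))" by (rule hCauchy_mono[OF cau]) (use c bd in auto)
  then obtain w where w: "hlim F (\<lambda>n. app_of t (u n)) w" using HF.hCauchy_converges by blast
  have tu0: "u0 \<in> dom_of t" "app_of t u0 = w" using t_closed[OF _ u0 w] u(1) by auto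
  have "\<sigma> n \<ominus>\<^bsub>E\<^esub> u n = app_of s (app_of t (u n))" for n
    unfolding u(3)[symmetric] using c by (intro T.E.ip_eqI) (simp_all add: T.E.ip_simps)
  then have "hlim E (\<lambda>n. app_of s (app_of t (u n))) (x \<ominus>\<^bsub>E\<^esub> u0)"
    using T.E.hlim_diff[OF x u0] by simp
  then have sw: "w \<in> dom_of s" "app_of s w = x \<ominus>\<^bsub>E\<^esub> u0"
    using s_closed[OF _ w] u(2) by auto
  have "u0 \<oplus>\<^bsub>E\<^esub> app_of s (app_of t u0) = x"
    unfolding tu0(2) sw(2) using x u0
    by (intro T.E.ip_eqI) (auto simp: T.E.ip_simps hlim_def)
  then show ?thesis using tu0 sw by auto
qed

text \<open>If \<open>u + s t u = s y\<close>, then \<open>v = y - t u\<close> satisfies \<open>s v = u\<close> and hence \<open>v + t s v = y\<close>.\<close>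

lemma regular_pairI:
  assumes surj: "\<And>x. x \<in> carrier E \<Longrightarrow>
      \<exists>u\<in>dom_of t. app_of t u \<in> dom_of s \<and> u \<oplus>\<^bsub>E\<^esub> app_of s (app_of t u) = x"
    and d: "dense_in F (dom_of s)"
  shows "regular_pair E F t s"
proof unfold_locales
  fix y assume y: "y \<in> carrier F"
  have sub: "dom_of s \<subseteq> carrier F" using S.dom_closed by blast
  obtain \<sigma> where \<sigma>: "range \<sigma> \<subseteq> dom_of s" "hlim F \<sigma> y"
    by (rule T.F.dense_in_approx[OF d sub y])
  have *: "\<exists>v\<in>dom_of s. app_of s v \<in> dom_of t \<and> v \<oplus>\<^bsub>F\<^esub> app_of t (app_of s v) = y" if y: "y \<in> dom_of s" for y
  proof -
    have yc: "y \<in> carrier F" "app_of s y \<in> carrier E" using y by (auto simp: S.dom_closed S.app_closed)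
    obtain u where u: "u \<in> dom_of t" "app_of t u \<in> dom_of s" "u \<oplus>\<^bsub>E\<^esub> app_of s (app_of t u) = app_of s y"
      using surj[OF yc(2)] by blast
    have c: "u \<in> carrier E" "app_of t u \<in> carrier F" "app_of s (app_of t u) \<in> carrier E"
      using u by (auto simp: T.dom_closed T.app_closed S.app_closed)
    let ?v = "y \<ominus>\<^bsub>F\<^esub> app_of t u"
    have "app_of s ?v = u"
      using c u(2) y yc unfolding S.app_diff[OF y u(2)] u(3)[symmetric]
      by (intro T.E.ip_eqI) (simp_all add: T.E.ip_simps)
    moreover have "?v \<oplus>\<^bsub>F\<^esub> app_of t u = y"
      using c yc by (intro T.F.ip_eqI) (simp_all add: T.F.ip_simps)
    ultimately show ?thesis using u y by (intro bexI[of _ ?v]) (auto simp: S.diff_dom)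
  qed
  show "\<exists>v\<in>dom_of s. app_of s v \<in> dom_of t \<and> v \<oplus>\<^bsub>F\<^esub> app_of t (app_of s v) = y"
    by (rule closed_adjoint_pair.range_one_plus_closed[OF swap_closed \<sigma>(2)], rule *)
      (use \<sigma>(1) in auto)
qed (rule surj)

end

text \<open>By definition \<open>1 + t\<^sup>* t\<close> merely has dense range; as this range is closed, the operator is surjective,
  and surjectivity of \<open>1 + t t\<^sup>*\<close> follows from that.\<close>

theorem regular_pair_adjoint_op:
  assumes E: "hilbert_module E" and F: "hilbert_module F" and reg: "regular_op E F t"
  shows "regular_pair E F t (adjoint_op E F t)"
proof -
  interpret E: hilbert_module E by fact
  interpret F: hilbert_module F by fact
  let ?s = "adjoint_op E F t"
  have lin: "linear_op E F t" and d: "dense_in E (dom_of t)" and ds: "dense_in F (dom_of ?s)"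
    and cl: "closedin (prod_topology (htopology E) (htopology F)) (graph_of t)"
    and d1: "dense_in E (ran_of (one_plus_op E (comp_op ?s t)))"
    using reg by (auto simp: regular_op_def semiregular_op_def densely_defined_op_def closed_op_def)
  have lo: "linear_operator E F t" by unfold_locales (rule lin)
  interpret adjoint_pair E F t ?s by (rule adjoint_pair_adjoint_op[OF lo d])
  interpret closed_adjoint_pair E F t ?s
  proof unfold_locales
    fix \<sigma> x y assume \<sigma>: "range \<sigma> \<subseteq> dom_of t" and x: "hlim E \<sigma> x" and y: "hlim F (\<lambda>n. app_of t (\<sigma> n)) y"
    have "limitin (htopology E) \<sigma> x sequentially"
      by (rule E.hlim_iff_limitin[THEN iffD1, OF _ x]) (use x in \<open>simp add: hlim_def\<close>)
    moreover have "limitin (htopology F) (\<lambda>n. app_of t (\<sigma> n)) y sequentially"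
      by (rule F.hlim_iff_limitin[THEN iffD1, OF _ y]) (use y in \<open>simp add: hlim_def\<close>)
    ultimately have "limitin (prod_topology (htopology E) (htopology F))
        (\<lambda>n. (\<sigma> n, app_of t (\<sigma> n))) (x, y) sequentially"
      by (simp add: limitin_pairwise comp_def)
    then have "(x, y) \<in> graph_of t"
      by (rule limitin_closedin[OF _ cl]) (use \<sigma> in \<open>auto simp: graph_of_def intro!: always_eventually\<close>)
    then show "x \<in> dom_of t \<and> app_of t x = y" by (auto simp: graph_of_def)
  next
    fix \<tau> y x assume \<tau>: "range \<tau> \<subseteq> dom_of ?s" and y: "hlim F \<tau> y" and x: "hlim E (\<lambda>n. app_of ?s (\<tau> n)) x"
    have "ip F (app_of t w) y = ip E w x" if w: "w \<in> dom_of t" for w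
    proof -
      have "(\<lambda>n. ip F (app_of t w) (\<tau> n)) \<longlonglongrightarrow> ip F (app_of t w) y"
        using w by (intro F.tendsto_ip_right[OF y] T.app_closed)
      moreover have "ip F (app_of t w) (\<tau> n) = ip E w (app_of ?s (\<tau> n))" for n
        using \<tau> w by (intro adj) auto
      ultimately have "(\<lambda>n. ip E w (app_of ?s (\<tau> n))) \<longlonglongrightarrow> ip F (app_of t w) y" by simp
      then show ?thesis
        using E.tendsto_ip_right[OF x T.dom_closed[OF w]] by (rule LIMSEQ_unique)
    qed
    then show "y \<in> dom_of ?s \<and> app_of ?s y = x"
      using x y by (intro conjI adjoint_op_unique[OF lo d]) (auto simp: hlim_def)
  qed
  show ?thesis
  proof (rule regular_pairI[OF _ ds])
    let ?X = "ran_of (one_plus_op E (comp_op ?s t))"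
    have X: "x \<in> ?X \<longleftrightarrow> (\<exists>u\<in>dom_of t. app_of t u \<in> dom_of ?s \<and> u \<oplus>\<^bsub>E\<^esub> app_of ?s (app_of t u) = x)" for x
      by (auto simp: ran_of_def one_plus_op_def comp_op_def)
    have sub: "?X \<subseteq> carrier E"
      unfolding X subset_iff by (auto simp: T.dom_closed S.app_closed)
    fix x assume "x \<in> carrier E"
    then obtain \<sigma> where \<sigma>: "range \<sigma> \<subseteq> ?X" "hlim E \<sigma> x"
      by (rule E.dense_in_approx[OF d1 sub])
    show "\<exists>u\<in>dom_of t. app_of t u \<in> dom_of ?s \<and> u \<oplus>\<^bsub>E\<^esub> app_of ?s (app_of t u) = x"
      by (rule range_one_plus_closed[OF \<sigma>(2)], rule X[THEN iffD1]) (use \<sigma>(1) in auto)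
  qed
qed

section \<open>Finite direct sums\<close>

lemma scaleC_sum: "c *\<^sub>C (\<Sum>i\<in>I. f i) = (\<Sum>i\<in>I. c *\<^sub>C f i)"
  by (induction I rule: infinite_finite_induct) (simp_all add: scaleC_add_right)

lemma cstar_sum: "cstar (\<Sum>i\<in>I. f i) = (\<Sum>i\<in>I. cstar (f i))"
  by (induction I rule: infinite_finite_induct) (simp_all add: cstar_add)

locale hilbert_family =
  fixes M :: "'i \<Rightarrow> ('a::cstar_algebra, 'e) hilbert_mod"
  assumes hilbert: "hilbert_module (M i)"
    and finite_support: "finite {i. carrier (M i) \<noteq> {\<zero>\<^bsub>M i\<^esub>}}"
begin

sublocale M: hilbert_module "M i" for i by (rule hilbert)

definition supp :: "'i set" where "supp = {i. carrier (M i) \<noteq> {\<zero>\<^bsub>M i\<^esub>}}"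

lemma finite_supp [simp]: "finite supp"
  using finite_support by (simp add: supp_def)

lemma zero_outside_supp: "x \<in> carrier (M i) \<Longrightarrow> i \<notin> supp \<Longrightarrow> x = \<zero>\<^bsub>M i\<^esub>"
  by (auto simp: supp_def)

abbreviation S :: "('a, 'i \<Rightarrow> 'e) hilbert_mod" where "S \<equiv> hilbert_sum M"

lemma carrier_sum: "x \<in> carrier S \<longleftrightarrow> (\<forall>i. x i \<in> carrier (M i))"
proof
  assume x: "\<forall>i. x i \<in> carrier (M i)"
  then have "{i. x i \<noteq> \<zero>\<^bsub>M i\<^esub>} \<subseteq> supp" using zero_outside_supp by blast
  then show "x \<in> carrier S" using x finite_subset[OF _ finite_supp] by (auto simp: hilbert_sum_def)
qed (simp add: hilbert_sum_def)

lemma sum_simps: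
  "\<zero>\<^bsub>S\<^esub> = (\<lambda>i. \<zero>\<^bsub>M i\<^esub>)" "x \<oplus>\<^bsub>S\<^esub> y = (\<lambda>i. x i \<oplus>\<^bsub>M i\<^esub> y i)"
  "csmult S c x = (\<lambda>i. csmult (M i) c (x i))" "ract S x a = (\<lambda>i. ract (M i) (x i) a)"
  by (simp_all add: hilbert_sum_def)

lemma ip_sum:
  assumes "x \<in> carrier S" "y \<in> carrier S"
  shows "ip S x y = (\<Sum>i\<in>supp. ip (M i) (x i) (y i))"
proof -
  have "ip S x y = (\<Sum>i | x i \<noteq> \<zero>\<^bsub>M i\<^esub>. ip (M i) (x i) (y i))" by (simp add: hilbert_sum_def)
  also have "\<dots> = (\<Sum>i\<in>supp. ip (M i) (x i) (y i))"
    using assms zero_outside_supp by (intro sum.mono_neutral_left) (auto simp: carrier_sum)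
  finally show ?thesis .
qed

lemma cpositive_ip_component: "x \<in> carrier S \<Longrightarrow> cpositive (ip (M i) (x i) (x i))"
  by (simp add: carrier_sum M.ip_positive)

lemma hnorm_component_le:
  assumes x: "x \<in> carrier S"
  shows "hnorm (M i) (x i) \<le> hnorm S x"
proof (cases "i \<in> supp")
  case True
  have "ip S x x = ip (M i) (x i) (x i) + (\<Sum>j\<in>supp - {i}. ip (M j) (x j) (x j))"
    using True x by (simp add: ip_sum sum.remove)
  then have "norm (ip (M i) (x i) (x i)) \<le> norm (ip S x x)"
    using x by (auto intro!: cpositive_norm_mono cpositive_sum cpositive_ip_component)
  then show ?thesis by (simp add: hnorm_def)
next
  case False
  then have "x i = \<zero>\<^bsub>M i\<^esub>" using x by (intro zero_outside_supp) (auto simp: carrier_sum)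
  then show ?thesis by (simp add: hnorm_def)
qed

sublocale S: pre_hilbert_module S
proof (intro pre_hilbert_module.intro pre_hilbert_module_axioms.intro abelian_groupI)
  show "\<exists>y\<in>carrier S. y \<oplus>\<^bsub>S\<^esub> x = \<zero>\<^bsub>S\<^esub>" if "x \<in> carrier S" for x
    using that by (intro bexI[of _ "\<lambda>i. \<ominus>\<^bsub>M i\<^esub> x i"]) (auto simp: sum_simps carrier_sum M.l_neg)
  show "x = \<zero>\<^bsub>S\<^esub>" if x: "x \<in> carrier S" and 0: "ip S x x = 0" for x
  proof -
    have "x i = \<zero>\<^bsub>M i\<^esub>" for i
    proof -
      have "hnorm (M i) (x i) \<le> 0" using hnorm_component_le[OF x, of i] 0 by (simp add: hnorm_def)
      then have "hnorm (M i) (x i) = 0" using M.hnorm_nonneg[of i "x i"] by linarith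
      then show ?thesis using x M.hnorm_eq_zero[of "x i" i] by (simp add: carrier_sum)
    qed
    then show ?thesis by (auto simp: sum_simps)
  qed
  show "ip S y x = cstar (ip S x y)" if "x \<in> carrier S" "y \<in> carrier S" for x y
    using that by (auto simp: ip_sum cstar_sum carrier_sum intro!: sum.cong M.ip_cstar)
  show "cpositive (ip S x x)" if "x \<in> carrier S" for x
    using that by (auto simp: ip_sum intro!: cpositive_sum cpositive_ip_component)
  show "ip S x (y \<oplus>\<^bsub>S\<^esub> z) = ip S x y + ip S x z"
    if "x \<in> carrier S" "y \<in> carrier S" "z \<in> carrier S" for x y z
  proof -
    have "y \<oplus>\<^bsub>S\<^esub> z \<in> carrier S" using that by (auto simp: carrier_sum sum_simps)
    then show ?thesis
      using that by (simp add: ip_sum) (simp add: sum_simps carrier_sum M.ip_add_right sum.distrib)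
  qed
  show "ip S x (ract S y a) = ip S x y * a" if "x \<in> carrier S" "y \<in> carrier S" for x y a
  proof -
    have "ract S y a \<in> carrier S" using that by (auto simp: carrier_sum sum_simps M.ract_closed)
    then show ?thesis
      using that by (simp add: ip_sum) (simp add: sum_simps carrier_sum M.ip_ract_right sum_distrib_right)
  qed
  show "ip S x (csmult S c y) = c *\<^sub>C ip S x y" if "x \<in> carrier S" "y \<in> carrier S" for x y c
  proof -
    have "csmult S c y \<in> carrier S" using that by (auto simp: carrier_sum sum_simps M.csmult_closed)
    then show ?thesis
      using that by (simp add: ip_sum) (simp add: sum_simps carrier_sum M.ip_csmult_right scaleC_sum)
  qed
qed (auto simp: sum_simps carrier_sum M.a_assoc M.a_comm M.a_lcomm M.ract_closed M.csmult_closed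
      M.ract_add_left M.ract_add_right M.ract_mult M.csmult_add_left M.csmult_add_right M.csmult_mult
      M.csmult_one M.csmult_ract M.ract_scaleC)

lemma minus_sum: "x \<in> carrier S \<Longrightarrow> y \<in> carrier S \<Longrightarrow> x \<ominus>\<^bsub>S\<^esub> y = (\<lambda>i. x i \<ominus>\<^bsub>M i\<^esub> y i)"
  by (simp add: a_minus_def S.csmult_minus1[symmetric])
     (simp add: sum_simps carrier_sum M.csmult_minus1)

lemma hnorm_sum_le:
  assumes x: "x \<in> carrier S"
  shows "hnorm S x \<le> (\<Sum>i\<in>supp. hnorm (M i) (x i))"
proof -
  have "(hnorm S x)\<^sup>2 \<le> (\<Sum>i\<in>supp. (hnorm (M i) (x i))\<^sup>2)"
    using x by (simp add: S.hnorm_power2 M.hnorm_power2 ip_sum norm_sum)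
  then have "hnorm S x \<le> L2_set (\<lambda>i. hnorm (M i) (x i)) supp"
    unfolding L2_set_def by (rule real_le_rsqrt)
  also have "\<dots> \<le> (\<Sum>i\<in>supp. hnorm (M i) (x i))" by (rule L2_set_le_sum) simp
  finally show ?thesis .
qed

sublocale S: hilbert_module S
proof unfold_locales
  have "\<exists>l. hlim S \<sigma> l" if \<sigma>: "hCauchy S \<sigma>" for \<sigma>
  proof -
    have "\<sigma> n \<in> carrier S" for n using \<sigma> by (auto simp: hCauchy_def)
    then have c: "\<sigma> n \<in> carrier S" "\<sigma> n i \<in> carrier (M i)" for n i
      by (auto simp: carrier_sum)
    have "hCauchy (M i) (\<lambda>n. \<sigma> n i)" for i
    proof (rule hCauchy_mono[OF \<sigma>])
      fix m n
      show "hnorm (M i) (\<sigma> m i \<ominus>\<^bsub>M i\<^esub> \<sigma> n i) \<le> hnorm S (\<sigma> m \<ominus>\<^bsub>S\<^esub> \<sigma> n)"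
        using hnorm_component_le[of "\<sigma> m \<ominus>\<^bsub>S\<^esub> \<sigma> n" i] c by (simp add: minus_sum carrier_sum)
    qed (use c in auto)
    then have "\<forall>i. \<exists>l. hlim (M i) (\<lambda>n. \<sigma> n i) l" using M.hCauchy_converges by blast
    then obtain l where l: "\<And>i. hlim (M i) (\<lambda>n. \<sigma> n i) (l i)" by metis
    have lS: "l \<in> carrier S" using l by (simp add: hlim_def carrier_sum)
    have lim: "(\<lambda>n. \<Sum>i\<in>supp. hnorm (M i) (\<sigma> n i \<ominus>\<^bsub>M i\<^esub> l i)) \<longlonglongrightarrow> 0"
      using l by (intro tendsto_null_sum) (simp add: hlim_def)
    have "(\<lambda>n. hnorm S (\<sigma> n \<ominus>\<^bsub>S\<^esub> l)) \<longlonglongrightarrow> 0"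
    proof (rule tendsto_zero_mono[OF lim])
      fix n
      show "hnorm S (\<sigma> n \<ominus>\<^bsub>S\<^esub> l) \<le> (\<Sum>i\<in>supp. hnorm (M i) (\<sigma> n i \<ominus>\<^bsub>M i\<^esub> l i))"
        using hnorm_sum_le[of "\<sigma> n \<ominus>\<^bsub>S\<^esub> l"] c lS by (simp add: minus_sum carrier_sum)
    qed simp
    then show ?thesis using c lS by (auto simp: hlim_def)
  qed
  then show "S.metric.mcomplete" unfolding S.mcomplete_iff by blast
qed

end

section \<open>Hodge decomposition at one module\<close>

lemma in_set_add_iff: "x \<in> X <+>\<^bsub>E\<^esub> Y \<longleftrightarrow> (\<exists>a\<in>X. \<exists>b\<in>Y. x = a \<oplus>\<^bsub>E\<^esub> b)"
  by (auto simp: set_add_defs)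

lemma bex_set_add: "(\<exists>x\<in>X <+>\<^bsub>E\<^esub> Y. P x) \<longleftrightarrow> (\<exists>a\<in>X. \<exists>b\<in>Y. P (a \<oplus>\<^bsub>E\<^esub> b))"
  by (auto simp: set_add_defs)

text \<open>A module \<open>E\<close> of a complex with its incoming map \<open>r\<close>, its outgoing map \<open>t\<close>, and their adjoints \<open>r'\<close>, \<open>t'\<close>.
  Exchanging \<open>r\<close> with \<open>t'\<close> and \<open>r'\<close> with \<open>t\<close> gives the same situation for the dual complex.\<close>

locale two_step = R: regular_pair D E r r' + T: regular_pair E F t t'
  for D :: "('a::cstar_algebra, 'd) hilbert_mod" and E :: "('a, 'e) hilbert_mod"
    and F :: "('a, 'f) hilbert_mod" and r r' t t' +
  assumes ran_r: "ran_of r \<subseteq> ker_of F t" and ran_t': "ran_of t' \<subseteq> ker_of D r'"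
begin

definition harmonic :: "'e set" where
  "harmonic = ker_of F t \<inter> ker_of D r'"

definition decomposes :: bool where
  "decomposes \<longleftrightarrow> (\<forall>x\<in>carrier E. \<exists>h\<in>harmonic. \<exists>a\<in>ran_of t'. \<exists>b\<in>ran_of r.
     x = h \<oplus>\<^bsub>E\<^esub> a \<oplus>\<^bsub>E\<^esub> b)"

lemma harmonic_closed: "h \<in> harmonic \<Longrightarrow> h \<in> carrier E"
  by (auto simp: harmonic_def T.T.ker_closed)

lemma harmonic_orthogonal_ran_t': "h \<in> harmonic \<Longrightarrow> a \<in> ran_of t' \<Longrightarrow> ip E h a = 0"
  by (auto simp: harmonic_def intro: T.ker_orthogonal_ran)

lemma harmonic_orthogonal_ran_r: "h \<in> harmonic \<Longrightarrow> b \<in> ran_of r \<Longrightarrow> ip E h b = 0"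
  using adjoint_pair.ker_orthogonal_ran[OF R.swap] by (auto simp: harmonic_def)

lemma ran_t'_orthogonal_ran_r: "a \<in> ran_of t' \<Longrightarrow> b \<in> ran_of r \<Longrightarrow> ip E a b = 0"
  using adjoint_pair.ker_orthogonal_ran[OF R.swap] ran_t' by blast

lemma orthogonal_sum3_iff_decomposes:
  "orthogonal_sum3 E (ker_of F t \<inter> ker_of D r') (ran_of t') (ran_of r) \<longleftrightarrow> decomposes"
proof -
  let ?S = "harmonic <+>\<^bsub>E\<^esub> ran_of t' <+>\<^bsub>E\<^esub> ran_of r"
  have iff: "x \<in> ?S \<longleftrightarrow> (\<exists>h\<in>harmonic. \<exists>a\<in>ran_of t'. \<exists>b\<in>ran_of r.
      x = h \<oplus>\<^bsub>E\<^esub> a \<oplus>\<^bsub>E\<^esub> b)" for x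
    by (simp add: in_set_add_iff bex_set_add)
  have "?S \<subseteq> carrier E"
    unfolding subset_iff iff by (auto simp: harmonic_closed T.S.ran_closed R.T.ran_closed)
  then have "carrier E = ?S \<longleftrightarrow> (\<forall>x\<in>carrier E. x \<in> ?S)" by blast
  then have "carrier E = ?S \<longleftrightarrow> decomposes" unfolding decomposes_def iff .
  then show ?thesis
    unfolding orthogonal_sum3_def harmonic_def[symmetric] orthogonal_sets_def
    using harmonic_orthogonal_ran_t' harmonic_orthogonal_ran_r ran_t'_orthogonal_ran_r by blast
qed

lemma swap_two_step: "two_step F E D t' t r' r"
  by (intro two_step.intro T.swap_regular_pair R.swap_regular_pair two_step_axioms.intro ran_r ran_t')

lemma swap_decomposes: "two_step.decomposes F E D t' t r' r \<longleftrightarrow> decomposes"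
proof -
  interpret sw: two_step F E D t' t r' r by (rule swap_two_step)
  have h: "sw.harmonic = harmonic" by (auto simp: harmonic_def sw.harmonic_def)
  have comm: "h \<oplus>\<^bsub>E\<^esub> a \<oplus>\<^bsub>E\<^esub> b = h \<oplus>\<^bsub>E\<^esub> b \<oplus>\<^bsub>E\<^esub> a"
    if "h \<in> harmonic" "a \<in> ran_of t'" "b \<in> ran_of r" for h a b
    using harmonic_closed[OF that(1)] T.S.ran_closed[OF that(2)] R.T.ran_closed[OF that(3)]
    by (simp add: R.T.F.a_ac)
  have "(\<exists>a\<in>ran_of r. \<exists>b\<in>ran_of t'. x = h \<oplus>\<^bsub>E\<^esub> a \<oplus>\<^bsub>E\<^esub> b) \<longleftrightarrow>
      (\<exists>a\<in>ran_of t'. \<exists>b\<in>ran_of r. x = h \<oplus>\<^bsub>E\<^esub> a \<oplus>\<^bsub>E\<^esub> b)"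
    if "h \<in> harmonic" for x h
    using comm[OF that] by metis
  then show ?thesis unfolding decomposes_def sw.decomposes_def h by simp
qed

text \<open>Split \<open>x\<close> along \<open>ker t\<close> and \<open>ran t'\<close>, then the first component along \<open>ker r'\<close> and \<open>ran r\<close>. As
  \<open>ran r \<subseteq> ker t\<close>, the second splitting stays inside \<open>ker t\<close>.\<close>

lemma decomposes_if_closed_ranges:
  assumes "hilbert_module E" "hilbert_module F" "closed_range E r" "closed_range F t"
  shows decomposes
  unfolding decomposes_def
proof
  interpret HE: hilbert_module E by fact
  interpret HF: hilbert_module F by fact
  interpret Rc: closed_range_pair D E r r' by unfold_locales fact
  interpret Tc: closed_range_pair E F t t' by unfold_locales fact
  fix x assume x: "x \<in> carrier E"
  obtain a b where a: "a \<in> ker_of F t" and b: "b \<in> ran_of t'" and xab: "x = a \<oplus>\<^bsub>E\<^esub> b"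
    by (rule Tc.domain_decomposition[OF x])
  have ac: "a \<in> carrier E" using a by (rule T.T.ker_closed)
  obtain h c where h: "h \<in> ker_of D r'" and c: "c \<in> ran_of r" and ahc: "a = h \<oplus>\<^bsub>E\<^esub> c"
    by (rule Rc.codomain_decomposition[OF ac])
  have cl: "b \<in> carrier E" "h \<in> carrier E" "c \<in> carrier E"
    using b h c by (auto simp: T.S.ran_closed R.T.ran_closed R.S.ker_closed)
  have ct: "c \<in> ker_of F t" using c ran_r by blast
  have "h = a \<ominus>\<^bsub>E\<^esub> c" unfolding ahc using cl by (intro R.T.F.ip_eqI) (simp_all add: R.T.F.ip_simps)
  then have "h \<in> ker_of F t"
    using a ct by (simp add: ker_of_def T.T.diff_dom T.T.app_diff T.T.F.minus_eq_zero_iff T.T.F.zero_closed)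
  moreover have "x = h \<oplus>\<^bsub>E\<^esub> b \<oplus>\<^bsub>E\<^esub> c"
    unfolding xab ahc using cl by (simp add: R.T.F.a_ac)
  ultimately show "\<exists>h\<in>harmonic. \<exists>a\<in>ran_of t'. \<exists>b\<in>ran_of r. x = h \<oplus>\<^bsub>E\<^esub> a \<oplus>\<^bsub>E\<^esub> b"
    using h b c unfolding harmonic_def by blast
qed

text \<open>A summand of an orthogonal decomposition is the orthogonal complement of the others.\<close>

lemma closed_range_if_decomposes:
  assumes dec: decomposes
  shows "closed_range E r"
proof -
  have "ran_of r = {y \<in> carrier E. \<forall>h\<in>harmonic \<union> ran_of t'. ip E h y = 0}" (is "_ = ?C")
  proof
    show "ran_of r \<subseteq> ?C"
      using harmonic_orthogonal_ran_r ran_t'_orthogonal_ran_r R.T.ran_closed by auto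
    show "?C \<subseteq> ran_of r"
    proof
      fix y assume y: "y \<in> ?C"
      then obtain h a b where hab: "h \<in> harmonic" "a \<in> ran_of t'" "b \<in> ran_of r"
          "y = h \<oplus>\<^bsub>E\<^esub> a \<oplus>\<^bsub>E\<^esub> b"
        using dec unfolding decomposes_def by blast
      have c: "h \<in> carrier E" "a \<in> carrier E" "b \<in> carrier E"
        using hab by (auto simp: harmonic_closed T.S.ran_closed R.T.ran_closed)
      have o: "ip E h a = 0" "ip E h b = 0" "ip E a b = 0"
        using hab harmonic_orthogonal_ran_t' harmonic_orthogonal_ran_r ran_t'_orthogonal_ran_r by auto
      have "ip E h h = ip E h y" "ip E a a = ip E a y"
        using c o R.T.F.ip_cstar[of h a] by (simp_all add: hab(4) R.T.F.ip_simps)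
      moreover have "ip E h y = 0" "ip E a y = 0" using y hab by auto
      ultimately have "h = \<zero>\<^bsub>E\<^esub>" "a = \<zero>\<^bsub>E\<^esub>" using R.T.F.ip_definite[OF c(1)] R.T.F.ip_definite[OF c(2)] by simp_all
      then show "y \<in> ran_of r" using hab c by simp
    qed
  qed
  moreover have "closedin (htopology E) ?C"
    by (rule R.T.F.closedin_orthogonal_complement) (auto simp: harmonic_closed T.S.ran_closed)
  ultimately show ?thesis by (simp add: closed_range_def)
qed

text \<open>If \<open>v\<^sub>1 + r r' v\<^sub>1 = x\<close> and \<open>v + t' t v = v\<^sub>1\<close>, then \<open>r' v = r' v\<^sub>1\<close> because \<open>r' t' = 0\<close>.\<close>

lemma one_plus_laplacian_surj:
  assumes x: "x \<in> carrier E"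
  obtains v where "v \<in> dom_of t" "v \<in> dom_of r'" "app_of t v \<in> dom_of t'" "app_of r' v \<in> dom_of r"
    "v \<oplus>\<^bsub>E\<^esub> (app_of t' (app_of t v) \<oplus>\<^bsub>E\<^esub> app_of r (app_of r' v)) = x"
proof -
  obtain w where w: "w \<in> dom_of r'" "app_of r' w \<in> dom_of r" "w \<oplus>\<^bsub>E\<^esub> app_of r (app_of r' w) = x"
    using R.surj'[OF x] by blast
  have wc: "w \<in> carrier E" using w by (simp add: R.S.dom_closed)
  obtain v where v: "v \<in> dom_of t" "app_of t v \<in> dom_of t'" "v \<oplus>\<^bsub>E\<^esub> app_of t' (app_of t v) = w"
    using T.surj[OF wc] by blast
  let ?z = "app_of t' (app_of t v)"
  have vc: "v \<in> carrier E" "?z \<in> carrier E" using v by (auto simp: T.T.dom_closed T.S.app_closed)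
  have z: "?z \<in> dom_of r'" "app_of r' ?z = \<zero>\<^bsub>D\<^esub>"
    using ran_t' v by (auto simp: ran_of_def ker_of_def)
  have veq: "v = w \<ominus>\<^bsub>E\<^esub> ?z"
    unfolding v(3)[symmetric] using vc by (intro R.T.F.ip_eqI) (simp_all add: R.T.F.ip_simps)
  have "w \<ominus>\<^bsub>E\<^esub> ?z \<in> dom_of r'" using w z by (intro R.S.diff_dom)
  then have vr: "v \<in> dom_of r'" by (simp only: veq[symmetric])
  have "app_of r' w = app_of r' v"
    unfolding v(3)[symmetric] using vr z by (simp add: R.S.app_add R.S.app_closed)
  then show thesis
    using that[of v] v vr w vc by (auto simp: R.T.F.a_assoc R.T.app_closed)
qed

text \<open>An element of \<open>dom t\<close> may be replaced by its component in \<open>ran t'\<close>, without changing its image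
  under \<open>t\<close>.\<close>

lemma coexact_representative:
  assumes dec: decomposes and x: "x \<in> dom_of t"
  obtains x' where "x' \<in> dom_of t" "app_of t x' = app_of t x" "x' \<in> ker_of D r'"
proof -
  have xc: "x \<in> carrier E" using x by (rule T.T.dom_closed)
  obtain h a b where hab: "h \<in> harmonic" "a \<in> ran_of t'" "b \<in> ran_of r" "x = h \<oplus>\<^bsub>E\<^esub> a \<oplus>\<^bsub>E\<^esub> b"
    using dec xc unfolding decomposes_def by blast
  have c: "h \<in> carrier E" "a \<in> carrier E" "b \<in> carrier E"
    using hab by (auto simp: harmonic_closed T.S.ran_closed R.T.ran_closed)
  have k: "h \<oplus>\<^bsub>E\<^esub> b \<in> dom_of t" "app_of t (h \<oplus>\<^bsub>E\<^esub> b) = \<zero>\<^bsub>F\<^esub>"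
    using hab ran_r by (auto simp: harmonic_def ker_of_def T.T.add_dom T.T.app_add)
  have aeq: "a = x \<ominus>\<^bsub>E\<^esub> (h \<oplus>\<^bsub>E\<^esub> b)"
    unfolding hab(4) using c by (intro R.T.F.ip_eqI) (simp_all add: R.T.F.ip_simps)
  have "a \<in> dom_of t" "app_of t a = app_of t x"
    unfolding aeq using x k
    by (simp_all add: T.T.diff_dom T.T.app_diff) (simp add: a_minus_def T.T.app_closed)
  then show thesis using that[of a] hab(2) ran_t' by blast
qed

end

section \<open>Dirac operators\<close>

text \<open>The maps \<open>b\<close> and \<open>c\<close> are meant to be inverse to each other: the component \<open>j\<close> of the target receives
  contributions from the components \<open>j\<close> (through \<open>p j\<close>) and \<open>b j\<close> (through \<open>q j\<close>) of the source. For the even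
  Dirac operator \<open>b j = j + 1\<close>. With \<open>b\<close> arbitrary, the formal adjoint of such an operator is again
  of this form.\<close>

definition dirac ::
    "('i \<Rightarrow> ('a::cstar_algebra, 'e) hilbert_mod) \<Rightarrow> ('i \<Rightarrow> ('a, 'e) hilbert_mod) \<Rightarrow>
     ('i \<Rightarrow> ('e, 'e) unbounded_op) \<Rightarrow> ('i \<Rightarrow> ('e, 'e) unbounded_op) \<Rightarrow> ('i \<Rightarrow> 'i) \<Rightarrow> ('i \<Rightarrow> 'i) \<Rightarrow>
     ('i \<Rightarrow> 'e, 'i \<Rightarrow> 'e) unbounded_op" where
  "dirac V W p q b c =
    \<lparr>dom_of = {x \<in> carrier (hilbert_sum V). \<forall>k. x k \<in> dom_of (p k) \<inter> dom_of (q (c k))},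
     app_of = (\<lambda>x j. app_of (p j) (x j) \<oplus>\<^bsub>W j\<^esub> app_of (q j) (x (b j)))\<rparr>"

text \<open>The situation is symmetric: it persists when \<open>V\<close> and \<open>W\<close>, \<open>p\<close> and \<open>p'\<close>, \<open>q\<close> and \<open>q'\<close>, \<open>b\<close> and \<open>c\<close> are exchanged
  (with \<open>q\<close>, \<open>q'\<close> reindexed by \<open>c\<close>). So every result on \<open>D\<close> below is also one on its formal adjoint
  \<open>D'\<close>.\<close>

locale dirac_family = V: hilbert_family V + W: hilbert_family W
  for V W :: "'i \<Rightarrow> ('a::cstar_algebra, 'e) hilbert_mod" +
  fixes p p' q q' :: "'i \<Rightarrow> ('e, 'e) unbounded_op" and b c :: "'i \<Rightarrow> 'i"
  assumes cb [simp]: "c (b k) = k" and bc [simp]: "b (c k) = k"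
    and p: "regular_pair (V k) (W k) (p k) (p' k)"
    and q: "regular_pair (V (b k)) (W k) (q k) (q' k)"
    and p_ran: "ran_of (p k) \<subseteq> ker_of (V (b k)) (q' k)"
    and q_ran: "ran_of (q k) \<subseteq> ker_of (V k) (p' k)"
    and p'_ran: "ran_of (p' k) \<subseteq> ker_of (W (c k)) (q (c k))"
    and q'_ran: "ran_of (q' k) \<subseteq> ker_of (W (b k)) (p (b k))"
begin

sublocale P: regular_pair "V k" "W k" "p k" "p' k" for k by (rule p)
sublocale Q: regular_pair "V (b k)" "W k" "q k" "q' k" for k by (rule q)

lemma swap_dirac_family: "dirac_family W V p' p (\<lambda>k. q' (c k)) (\<lambda>k. q (c k)) c b"
proof (intro dirac_family.intro dirac_family_axioms.intro)
  fix k
  show "regular_pair (W (c k)) (V k) (q' (c k)) (q (c k))"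
    using Q.swap_regular_pair[of "c k"] by simp
  show "ran_of (q' (c k)) \<subseteq> ker_of (W k) (p k)" using q'_ran[of "c k"] by simp
  show "ran_of (p k) \<subseteq> ker_of (V (b k)) (q' (c (b k)))" using p_ran[of k] by simp
  show "ran_of (q (c k)) \<subseteq> ker_of (V (c k)) (p' (c k))" by (rule q_ran)
  show "ran_of (p' k) \<subseteq> ker_of (W (c k)) (q (c k))" by (rule p'_ran)
  show "regular_pair (W k) (V k) (p' k) (p k)" by (rule P.swap_regular_pair)
qed (simp_all add: W.hilbert_family_axioms V.hilbert_family_axioms)

lemma two_step_site: "two_step (W (c k)) (V k) (W k) (q' (c k)) (q (c k)) (p k) (p' k)"
proof -
  interpret Q': regular_pair "W (c k)" "V k" "q' (c k)" "q (c k)"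
    using Q.swap_regular_pair[of "c k"] by simp
  show ?thesis
    by unfold_locales (use q'_ran[of "c k"] p'_ran[of k] in auto)
qed

sublocale site: two_step "W (c k)" "V k" "W k" "q' (c k)" "q (c k)" "p k" "p' k" for k
  by (rule two_step_site)

abbreviation "D \<equiv> dirac V W p q b c"
abbreviation "D' \<equiv> dirac W V p' (\<lambda>k. q' (c k)) c b"

lemma dom_D: "x \<in> dom_of D \<longleftrightarrow> (\<forall>k. x k \<in> dom_of (p k) \<and> x k \<in> dom_of (q (c k)))"
  by (auto simp: dirac_def V.carrier_sum P.T.dom_closed)

lemma dom_D_b: "x \<in> dom_of D \<Longrightarrow> x (b k) \<in> dom_of (q k)"
  using dom_D[of x] cb by metis

lemma app_D: "app_of D x = (\<lambda>j. app_of (p j) (x j) \<oplus>\<^bsub>W j\<^esub> app_of (q j) (x (b j)))"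
  by (simp add: dirac_def)

lemma app_closed_D:
  assumes "x \<in> dom_of D"
  shows "app_of (p j) (x j) \<in> carrier (W j)" "app_of (q j) (x (b j)) \<in> carrier (W j)"
  using assms dom_D dom_D_b by (auto intro: P.T.app_closed Q.T.app_closed)

lemma linear_D: "linear_op V.S W.S D"
  unfolding linear_op_def
proof (intro conjI ballI allI)
  show "dom_of D \<subseteq> carrier V.S" by (auto simp: dom_D V.carrier_sum P.T.dom_closed)
  show "app_of D ` dom_of D \<subseteq> carrier W.S"
    using app_closed_D by (auto simp: app_D W.carrier_sum)
  show "\<zero>\<^bsub>V.S\<^esub> \<in> dom_of D"
    using P.T.zero_dom Q.T.zero_dom[of "c _"] by (auto simp: dom_D V.sum_simps)
  fix x assume x: "x \<in> dom_of D"
  have xd: "x k \<in> dom_of (p k)" "x k \<in> dom_of (q (c k))" "x (b k) \<in> dom_of (q k)" for k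
    using x dom_D dom_D_b by auto
  { fix y assume y: "y \<in> dom_of D"
    have yd: "y k \<in> dom_of (p k)" "y k \<in> dom_of (q (c k))" "y (b k) \<in> dom_of (q k)" for k
      using y dom_D dom_D_b by auto
    show "x \<oplus>\<^bsub>V.S\<^esub> y \<in> dom_of D"
      using xd yd P.T.add_dom Q.T.add_dom[of _ "c _"] by (simp add: dom_D V.sum_simps)
    show "app_of D (x \<oplus>\<^bsub>V.S\<^esub> y) = app_of D x \<oplus>\<^bsub>W.S\<^esub> app_of D y"
      using xd yd by (auto simp: app_D V.sum_simps W.sum_simps P.T.app_add Q.T.app_add
          P.T.app_closed Q.T.app_closed W.M.a_ac) }
  { fix d
    show "csmult V.S d x \<in> dom_of D"
      using xd P.T.csmult_dom Q.T.csmult_dom[of _ "c _"] by (simp add: dom_D V.sum_simps)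
    show "app_of D (csmult V.S d x) = csmult W.S d (app_of D x)"
      using xd by (auto simp: app_D V.sum_simps W.sum_simps P.T.app_csmult Q.T.app_csmult
          P.T.app_closed Q.T.app_closed W.M.csmult_add_right) }
  { fix a
    show "ract V.S x a \<in> dom_of D"
      using xd P.T.ract_dom Q.T.ract_dom[of _ "c _"] by (simp add: dom_D V.sum_simps)
    show "app_of D (ract V.S x a) = ract W.S (app_of D x) a"
      using xd by (auto simp: app_D V.sum_simps W.sum_simps P.T.app_ract Q.T.app_ract
          P.T.app_closed Q.T.app_closed W.M.ract_add_left) }
qed

text \<open>The terms with \<open>q\<close> are indexed by the target in \<open>\<langle>D x, y\<rangle>\<close> and by the source in \<open>\<langle>x, D' y\<rangle>\<close>; the bijection
  \<open>c\<close> matches them. The two sums run over different supports; a term outside of either support vanishes.\<close>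

lemma adj_D:
  assumes x: "x \<in> dom_of D" and y: "y \<in> dom_of D'"
  shows "ip W.S (app_of D x) y = ip V.S x (app_of D' y)"
proof -
  interpret dual: dirac_family W V p' p "\<lambda>k. q' (c k)" "\<lambda>k. q (c k)" c b
    by (rule swap_dirac_family)
  have xd: "x k \<in> dom_of (p k)" "x (b k) \<in> dom_of (q k)" "x k \<in> carrier (V k)" for k
    using x dom_D dom_D_b by (auto simp: P.T.dom_closed)
  have yd: "y k \<in> dom_of (p' k)" "y k \<in> dom_of (q' k)" "y k \<in> carrier (W k)" for k
    using y dual.dom_D by (auto simp: P.S.dom_closed)
  define f where "f k = ip (V k) (x k) (app_of (p' k) (y k))" for k
  define g where "g k = ip (V (b k)) (x (b k)) (app_of (q' k) (y k))" for k
  have f0: "f k = 0" if "k \<notin> V.supp \<or> k \<notin> W.supp" for k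
    using that V.zero_outside_supp[OF xd(3)] W.zero_outside_supp[OF yd(3)] yd(1)[of k]
    by (auto simp: f_def P.S.app_closed P.S.app_zero xd)
  have g0: "g k = 0" if "b k \<notin> V.supp \<or> k \<notin> W.supp" for k
    using that V.zero_outside_supp[OF xd(3)] W.zero_outside_supp[OF yd(3)] yd(2)[of k]
    by (auto simp: g_def Q.S.app_closed Q.S.app_zero xd)
  have "ip W.S (app_of D x) y = (\<Sum>k\<in>W.supp. f k + g k)"
  proof -
    have "app_of D x \<in> carrier W.S" "y \<in> carrier W.S"
      using xd yd by (auto simp: app_D W.carrier_sum P.T.app_closed Q.T.app_closed)
    then show ?thesis
      using xd yd by (auto simp: W.ip_sum app_D f_def g_def W.M.ip_add_left P.T.app_closed Q.T.app_closed
          P.adj Q.adj intro!: sum.cong)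
  qed
  also have "\<dots> = (\<Sum>k\<in>W.supp. f k) + (\<Sum>k\<in>W.supp. g k)" by (rule sum.distrib)
  also have "(\<Sum>k\<in>W.supp. f k) = (\<Sum>k\<in>V.supp. f k)"
    using f0 by (intro sum.mono_neutral_cong) auto
  also have "(\<Sum>k\<in>W.supp. g k) = (\<Sum>k\<in>c ` V.supp. g k)"
  proof (intro sum.mono_neutral_cong)
    show "g k = 0" if "k \<in> W.supp - c ` V.supp" for k
    proof -
      have "b k \<notin> V.supp" using that cb[of k] by (metis DiffD2 imageI)
      then show ?thesis using g0 by blast
    qed
  qed (use g0 in auto)
  also have "\<dots> = (\<Sum>k\<in>V.supp. g (c k))"
    by (rule sum.reindex_cong[of c]) (auto simp: inj_on_def dest: arg_cong[of _ _ b])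
  also have "(\<Sum>k\<in>V.supp. f k) + (\<Sum>k\<in>V.supp. g (c k)) = (\<Sum>k\<in>V.supp. f k + g (c k))"
    by (rule sum.distrib[symmetric])
  also have "\<dots> = ip V.S x (app_of D' y)"
  proof -
    have c: "app_of (p' k) (y k) \<in> carrier (V k)" "app_of (q' (c k)) (y (c k)) \<in> carrier (V k)" for k
      using yd(1) P.S.app_closed Q.S.app_closed[OF yd(2), of "c k"] by auto
    have "app_of D' y \<in> carrier V.S" "x \<in> carrier V.S"
      using xd c by (auto simp: dual.app_D V.carrier_sum)
    then show ?thesis
      using xd c by (simp add: V.ip_sum dual.app_D f_def g_def V.M.ip_add_right)
  qed
  finally show ?thesis .
qed

text \<open>The mixed terms of \<open>D' D\<close> vanish, so \<open>1 + D' D\<close> acts in each component as \<open>1\<close> plus the Laplacian of that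
  module.\<close>

lemma surj_D:
  assumes x: "x \<in> carrier V.S"
  shows "\<exists>u\<in>dom_of D. app_of D u \<in> dom_of D' \<and> u \<oplus>\<^bsub>V.S\<^esub> app_of D' (app_of D u) = x"
proof -
  interpret dual: dirac_family W V p' p "\<lambda>k. q' (c k)" "\<lambda>k. q (c k)" c b
    by (rule swap_dirac_family)
  have "\<exists>v. v \<in> dom_of (p k) \<and> v \<in> dom_of (q (c k)) \<and> app_of (p k) v \<in> dom_of (p' k) \<and>
      app_of (q (c k)) v \<in> dom_of (q' (c k)) \<and>
      v \<oplus>\<^bsub>V k\<^esub> (app_of (p' k) (app_of (p k) v) \<oplus>\<^bsub>V k\<^esub> app_of (q' (c k)) (app_of (q (c k)) v)) = x k" for k
    using site.one_plus_laplacian_surj[of "x k" k] x by (metis V.carrier_sum)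
  then obtain u where u: "\<And>k. u k \<in> dom_of (p k)" "\<And>k. u k \<in> dom_of (q (c k))"
      "\<And>k. app_of (p k) (u k) \<in> dom_of (p' k)" "\<And>k. app_of (q (c k)) (u k) \<in> dom_of (q' (c k))"
      "\<And>k. u k \<oplus>\<^bsub>V k\<^esub> (app_of (p' k) (app_of (p k) (u k)) \<oplus>\<^bsub>V k\<^esub>
        app_of (q' (c k)) (app_of (q (c k)) (u k))) = x k"
    by metis
  have uq: "u (b k) \<in> dom_of (q k)" "app_of (q k) (u (b k)) \<in> dom_of (q' k)" for k
    using u(2)[of "b k"] u(4)[of "b k"] by simp_all
  have uD: "u \<in> dom_of D" using u by (simp add: dom_D)
  have pk: "app_of (p k) (u k) \<in> dom_of (q' k)" "app_of (q' k) (app_of (p k) (u k)) = \<zero>\<^bsub>V (b k)\<^esub>" for k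
    using p_ran[of k] u(1)[of k] by (auto simp: ran_of_def ker_of_def)
  have qk: "app_of (q k) (u (b k)) \<in> dom_of (p' k)" "app_of (p' k) (app_of (q k) (u (b k))) = \<zero>\<^bsub>V k\<^esub>" for k
    using q_ran[of k] uq(1)[of k] by (auto simp: ran_of_def ker_of_def)
  have DuD: "app_of D u \<in> dom_of D'"
    using u(3) uq(2) pk(1) qk(1) by (simp add: dual.dom_D app_D P.S.add_dom Q.S.add_dom)
  have p'D: "app_of (p' k) (app_of D u k) = app_of (p' k) (app_of (p k) (u k))" for k
    using u(3)[of k] qk[of k] by (simp add: app_D P.S.app_add P.S.app_closed)
  have q'D: "app_of (q' k) (app_of D u k) = app_of (q' k) (app_of (q k) (u (b k)))" for k
    using uq(2)[of k] pk[of k] by (simp add: app_D Q.S.app_add Q.S.app_closed)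
  have "u \<oplus>\<^bsub>V.S\<^esub> app_of D' (app_of D u) = x"
    unfolding V.sum_simps dual.app_D p'D q'D using u(5) by simp
  then show ?thesis using uD DuD by blast
qed

theorem regular_pair_D: "regular_pair V.S W.S D D'"
proof -
  interpret dual: dirac_family W V p' p "\<lambda>k. q' (c k)" "\<lambda>k. q (c k)" c b
    by (rule swap_dirac_family)
  interpret DT: linear_operator V.S W.S D by unfold_locales (rule linear_D)
  interpret DS: linear_operator W.S V.S D' by unfold_locales (rule dual.linear_D)
  show ?thesis
  proof unfold_locales
    show "\<exists>v\<in>dom_of D'. app_of D' v \<in> dom_of D \<and> v \<oplus>\<^bsub>W.S\<^esub> app_of D (app_of D' v) = y"
      if "y \<in> carrier W.S" for y
      using dual.surj_D[OF that] by simp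
  qed (use adj_D surj_D in auto)
qed

text \<open>The two contributions to a component of \<open>D x\<close> are orthogonal; if their sum vanishes, so do both.\<close>

lemma ker_D_harmonic:
  assumes x: "x \<in> ker_of W.S D"
  shows "x k \<in> site.harmonic k"
proof -
  have xD: "x \<in> dom_of D" using x by (simp add: ker_of_def)
  have zero: "app_of (p j) (x j) = \<zero>\<^bsub>W j\<^esub> \<and> app_of (q j) (x (b j)) = \<zero>\<^bsub>W j\<^esub>" for j
  proof -
    let ?a = "app_of (p j) (x j)" and ?b = "app_of (q j) (x (b j))"
    have c: "?a \<in> carrier (W j)" "?b \<in> carrier (W j)" using app_closed_D[OF xD] by auto
    have sum: "?a \<oplus>\<^bsub>W j\<^esub> ?b = \<zero>\<^bsub>W j\<^esub>"
      using x by (auto simp: ker_of_def app_D W.sum_simps dest: fun_cong[of _ _ j])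
    have "?a \<in> ker_of (V (b j)) (q' j)" using p_ran[of j] xD dom_D by (auto simp: ran_of_def)
    moreover have "?b \<in> ran_of (q j)" using dom_D_b[OF xD] by (auto simp: ran_of_def)
    ultimately have o: "ip (W j) ?a ?b = 0"
      using adjoint_pair.ker_orthogonal_ran[OF Q.swap] by blast
    have "ip (W j) ?a (?a \<oplus>\<^bsub>W j\<^esub> ?b) = 0" using c by (simp add: sum)
    then have "ip (W j) ?a ?a = 0" using o c by (simp add: W.M.ip_add_right)
    then have "?a = \<zero>\<^bsub>W j\<^esub>" using c W.M.ip_definite by blast
    then show ?thesis using sum c by simp
  qed
  show ?thesis
    using xD dom_D zero[of k] zero[of "c k"] by (simp add: site.harmonic_def ker_of_def)
qed

lemma site_decomposes:
  assumes dec: "\<And>x. x \<in> carrier V.S \<Longrightarrow> \<exists>a\<in>ker_of W.S D. \<exists>z\<in>ran_of D'. x = a \<oplus>\<^bsub>V.S\<^esub> z"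
  shows "site.decomposes k"
  unfolding site.decomposes_def
proof
  interpret dual: dirac_family W V p' p "\<lambda>k. q' (c k)" "\<lambda>k. q (c k)" c b
    by (rule swap_dirac_family)
  fix x assume x: "x \<in> carrier (V k)"
  define X where "X = (\<lambda>i. if i = k then x else \<zero>\<^bsub>V i\<^esub>)"
  have "X \<in> carrier V.S" using x by (simp add: X_def V.carrier_sum)
  then obtain a y where a: "a \<in> ker_of W.S D" and y: "y \<in> dom_of D'" and X: "X = a \<oplus>\<^bsub>V.S\<^esub> app_of D' y"
    using dec by (auto simp: ran_of_def) blast
  have ha: "a k \<in> site.harmonic k" by (rule ker_D_harmonic[OF a])
  have r: "app_of (p' k) (y k) \<in> ran_of (p' k)" "app_of (q' (c k)) (y (c k)) \<in> ran_of (q' (c k))"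
    using y dual.dom_D dual.dom_D_b[of y] by (auto simp: ran_of_def)
  have "x = X k" by (simp add: X_def)
  also have "\<dots> = a k \<oplus>\<^bsub>V k\<^esub> (app_of (p' k) (y k) \<oplus>\<^bsub>V k\<^esub> app_of (q' (c k)) (y (c k)))"
    by (simp add: X V.sum_simps dual.app_D)
  also have "\<dots> = a k \<oplus>\<^bsub>V k\<^esub> app_of (p' k) (y k) \<oplus>\<^bsub>V k\<^esub> app_of (q' (c k)) (y (c k))"
    using site.harmonic_closed[OF ha] dual.app_closed_D[OF y] by (simp add: V.M.a_assoc)
  finally show "\<exists>h\<in>site.harmonic k. \<exists>a\<in>ran_of (p' k). \<exists>b\<in>ran_of (q' (c k)).
      x = h \<oplus>\<^bsub>V k\<^esub> a \<oplus>\<^bsub>V k\<^esub> b"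
    using ha r by blast
qed

theorem decomposes_if_closed_range_D:
  assumes "closed_range W.S D"
  shows "site.decomposes k" "two_step.decomposes (V (b k)) (W k) (V k) (q k) (q' k) (p' k) (p k)"
proof -
  interpret dual: dirac_family W V p' p "\<lambda>k. q' (c k)" "\<lambda>k. q (c k)" c b
    by (rule swap_dirac_family)
  interpret regular_pair V.S W.S D D' by (rule regular_pair_D)
  interpret closed_range_pair V.S W.S D D' by unfold_locales fact
  show "site.decomposes k" by (rule site_decomposes) (metis domain_decomposition)
  have "dual.site.decomposes k"
    by (rule dual.site_decomposes) (simp, metis codomain_decomposition)
  then show "two_step.decomposes (V (b k)) (W k) (V k) (q k) (q' k) (p' k) (p k)" by simp
qed

text \<open>The range of \<open>D\<close> is the orthogonal complement of the harmonic vectors. Indeed a vector orthogonal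
  to them has components \<open>p u + q w\<close>, and \<open>u\<close>, \<open>w\<close> can be chosen with \<open>q u = 0\<close> and \<open>p w = 0\<close>, so that they can be
  added up to a preimage without disturbing each other.\<close>

theorem closed_range_D_if_decomposes:
  assumes decV: "\<And>k. site.decomposes k"
    and decW: "\<And>k. two_step.decomposes (V (b k)) (W k) (V k) (q k) (q' k) (p' k) (p k)"
  shows "closed_range W.S D"
proof -
  interpret wsite: two_step "V (b k)" "W k" "V k" "q k" "q' k" "p' k" "p k" for k
    using dirac_family.two_step_site[OF swap_dirac_family, of k] by simp
  \<comment> \<open>the harmonic vectors of the target\<close>
  define H where "H = {h \<in> carrier W.S. \<forall>j. h j \<in> wsite.harmonic j}"
  have "ran_of D = {y \<in> carrier W.S. \<forall>h\<in>H. ip W.S h y = 0}" (is "_ = ?C")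
  proof
    show "ran_of D \<subseteq> ?C"
    proof
      fix y assume "y \<in> ran_of D"
      then obtain x where x: "x \<in> dom_of D" "y = app_of D x" by (auto simp: ran_of_def)
      have yc: "y \<in> carrier W.S" using app_closed_D[OF x(1)] by (simp add: x(2) app_D W.carrier_sum)
      have "ip W.S h y = 0" if h: "h \<in> H" for h
      proof -
        have "ip (W j) (h j) (y j) = 0" for j
        proof -
          have hj: "h j \<in> wsite.harmonic j" using h by (simp add: H_def)
          have "app_of (p j) (x j) \<in> ran_of (p j)" "app_of (q j) (x (b j)) \<in> ran_of (q j)"
            using x dom_D dom_D_b by (auto simp: ran_of_def)
          then show ?thesis
            using hj app_closed_D[OF x(1)]
            by (simp add: x(2) app_D W.M.ip_add_right wsite.harmonic_closed
                wsite.harmonic_orthogonal_ran_t' wsite.harmonic_orthogonal_ran_r)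
        qed
        then show ?thesis using h yc by (simp add: H_def W.ip_sum)
      qed
      then show "y \<in> ?C" using yc by blast
    qed
    show "?C \<subseteq> ran_of D"
    proof
      fix y assume y: "y \<in> ?C"
      have "\<exists>h u w. h \<in> wsite.harmonic j \<and> u \<in> dom_of (p j) \<and> w \<in> dom_of (q j) \<and>
          y j = h \<oplus>\<^bsub>W j\<^esub> app_of (p j) u \<oplus>\<^bsub>W j\<^esub> app_of (q j) w" for j
      proof -
        have "y j \<in> carrier (W j)" using y by (simp add: W.carrier_sum)
        then show ?thesis using decW[of j] unfolding wsite.decomposes_def ran_of_def by blast
      qed
      then obtain h u w where h: "\<And>j. h j \<in> wsite.harmonic j" and u: "\<And>j. u j \<in> dom_of (p j)"
          and w: "\<And>j. w j \<in> dom_of (q j)"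
          and yj: "\<And>j. y j = h j \<oplus>\<^bsub>W j\<^esub> app_of (p j) (u j) \<oplus>\<^bsub>W j\<^esub> app_of (q j) (w j)"
        by metis
      have cl: "h j \<in> carrier (W j)" "app_of (p j) (u j) \<in> carrier (W j)"
          "app_of (q j) (w j) \<in> carrier (W j)" for j
        using h u w by (auto simp: wsite.harmonic_closed P.T.app_closed Q.T.app_closed)
      have hH: "h \<in> H" using h cl by (simp add: H_def W.carrier_sum)
      have "ip (W j) (h j) (y j) = ip (W j) (h j) (h j)" for j
      proof -
        have "app_of (p j) (u j) \<in> ran_of (p j)" "app_of (q j) (w j) \<in> ran_of (q j)"
          using u w by (auto simp: ran_of_def)
        then show ?thesis
          using h cl by (simp add: yj W.M.ip_add_right
              wsite.harmonic_orthogonal_ran_t' wsite.harmonic_orthogonal_ran_r)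
      qed
      then have "ip W.S h h = ip W.S h y" using hH y by (simp add: H_def W.ip_sum)
      also have "\<dots> = 0" using y hH by blast
      finally have "h = \<zero>\<^bsub>W.S\<^esub>" using hH by (intro W.S.ip_definite) (simp_all add: H_def)
      then have "h j = \<zero>\<^bsub>W j\<^esub>" for j by (simp add: W.sum_simps)
      then have yj: "y j = app_of (p j) (u j) \<oplus>\<^bsub>W j\<^esub> app_of (q j) (w j)" for j
        using yj[of j] cl by simp
      have "\<exists>u'. u' \<in> dom_of (p j) \<and> app_of (p j) u' = app_of (p j) (u j) \<and>
          u' \<in> ker_of (W (c j)) (q (c j))" for j
        using site.coexact_representative[OF decV u] by metis
      then obtain u' where u': "\<And>j. u' j \<in> dom_of (p j)" "\<And>j. app_of (p j) (u' j) = app_of (p j) (u j)"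
          "\<And>j. u' j \<in> ker_of (W (c j)) (q (c j))" by metis
      have "\<exists>w'. w' \<in> dom_of (q j) \<and> app_of (q j) w' = app_of (q j) (w j) \<and>
          w' \<in> ker_of (W (b j)) (p (b j))" for j
      proof -
        have "two_step (W (b j)) (V (b j)) (W j) (p' (b j)) (p (b j)) (q j) (q' j)"
          using site.swap_two_step[of "b j"] by simp
        moreover have "two_step.decomposes (W (b j)) (V (b j)) (W j) (p' (b j)) (p (b j)) (q j) (q' j)"
          using site.swap_decomposes[of "b j"] decV[of "b j"] by simp
        ultimately show ?thesis
          using two_step.coexact_representative[of "W (b j)" "V (b j)" "W j" "p' (b j)" "p (b j)" "q j" "q' j" "w j"] w
          by metis
      qed
      then obtain w' where w': "\<And>j. w' j \<in> dom_of (q j)" "\<And>j. app_of (q j) (w' j) = app_of (q j) (w j)"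
          "\<And>j. w' j \<in> ker_of (W (b j)) (p (b j))" by metis
      have w'c: "w' (c k) \<in> dom_of (p k)" "app_of (p k) (w' (c k)) = \<zero>\<^bsub>W k\<^esub>" for k
        using w'(3)[of "c k"] by (simp_all add: ker_of_def)
      have u'b: "u' (b k) \<in> dom_of (q k)" "app_of (q k) (u' (b k)) = \<zero>\<^bsub>W k\<^esub>" for k
        using u'(3)[of "b k"] by (simp_all add: ker_of_def)
      define x where "x k = u' k \<oplus>\<^bsub>V k\<^esub> w' (c k)" for k
      have "x k \<in> dom_of (p k)" "x (b k) \<in> dom_of (q k)" for k
        using P.T.add_dom[OF u'(1) w'c(1)] Q.T.add_dom[OF u'b(1) w'(1)] by (simp_all add: x_def)
      then have xD: "x \<in> dom_of D" unfolding dom_D by (metis bc)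
      have "app_of (p j) (x j) = app_of (p j) (u j)" for j
        using P.T.app_add[OF u'(1) w'c(1)] cl by (simp add: x_def w'c u'(2))
      moreover have "app_of (q j) (x (b j)) = app_of (q j) (w j)" for j
        using Q.T.app_add[OF u'b(1) w'(1)] cl by (simp add: x_def u'b w'(2))
      ultimately have "app_of D x = y" by (auto simp: app_D yj)
      then show "y \<in> ran_of D" using xD by (auto simp: ran_of_def)
    qed
  qed
  moreover have "closedin (htopology W.S) ?C"
    by (rule W.S.closedin_orthogonal_complement) (auto simp: H_def)
  ultimately show ?thesis by (simp add: closed_range_def)
qed

end

section \<open>Hilbert complexes\<close>

text \<open>\<open>\<langle>t x, v y\<rangle> = \<langle>u t x, y\<rangle> = 0\<close>.\<close>

lemma ran_adjoint_op_subset_ker: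
  assumes t: "linear_operator E F t" "dense_in E (dom_of t)" and uv: "adjoint_pair F G u v"
    and tu: "ran_of t \<subseteq> ker_of G u"
  shows "ran_of v \<subseteq> ker_of E (adjoint_op E F t)"
proof
  interpret T: linear_operator E F t by fact
  interpret U: adjoint_pair F G u v by fact
  fix z assume "z \<in> ran_of v"
  then obtain y where y: "y \<in> dom_of v" "z = app_of v y" by (auto simp: ran_of_def)
  have z: "z \<in> carrier F" using y U.S.app_closed by simp
  have "ip F (app_of t x) z = ip E x \<zero>\<^bsub>E\<^esub>" if x: "x \<in> dom_of t" for x
  proof -
    have "app_of t x \<in> ker_of G u" using x tu by (auto simp: ran_of_def)
    then show ?thesis
      using y x U.ker_orthogonal_ran[of "app_of t x" z] by (simp add: ran_of_def T.dom_closed)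
  qed
  then show "z \<in> ker_of E (adjoint_op E F t)"
    using adjoint_op_unique[OF t z T.E.zero_closed] by (simp add: ker_of_def)
qed

context
  fixes E :: "int \<Rightarrow> ('a::cstar_algebra, 'e) hilbert_mod" and t :: "int \<Rightarrow> ('e, 'e) unbounded_op"
  assumes cplx: "hilbert_complex E t"
begin

abbreviation "s \<equiv> complex_adj E t"

lemma hilbert_module_E: "hilbert_module (E k)"
  using cplx by (simp add: hilbert_complex_def)

lemma regular_pair_t: "regular_pair (E k) (E (k + 1)) (t k) (s k)"
  using cplx unfolding complex_adj_def hilbert_complex_def by (intro regular_pair_adjoint_op) auto

lemma ran_t: "ran_of (t k) \<subseteq> ker_of (E (k + 2)) (t (k + 1))"
  using cplx by (simp add: hilbert_complex_def)

lemma ran_s: "ran_of (s (k + 1)) \<subseteq> ker_of (E k) (s k)"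
proof -
  interpret T: regular_pair "E k" "E (k + 1)" "t k" "s k" by (rule regular_pair_t)
  interpret U: regular_pair "E (k + 1)" "E (k + 1 + 1)" "t (k + 1)" "s (k + 1)" by (rule regular_pair_t)
  have "dense_in (E k) (dom_of (t k))"
    using cplx by (simp add: hilbert_complex_def regular_op_def semiregular_op_def densely_defined_op_def)
  then show ?thesis
    unfolding complex_adj_def[of E t k] using ran_t[of k]
    by (intro ran_adjoint_op_subset_ker[OF T.T.linear_operator_axioms _ U.adjoint_pair_axioms])
      (simp_all add: add.assoc)
qed

lemma two_step_complex:
  "two_step (E (k - 1)) (E k) (E (k + 1)) (t (k - 1)) (s (k - 1)) (t k) (s k)"
proof (intro two_step.intro two_step_axioms.intro)
  show "regular_pair (E (k - 1)) (E k) (t (k - 1)) (s (k - 1))" using regular_pair_t[of "k - 1"] by simp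
  show "ran_of (t (k - 1)) \<subseteq> ker_of (E (k + 1)) (t k)" using ran_t[of "k - 1"] by (simp add: add.commute)
  show "ran_of (s k) \<subseteq> ker_of (E (k - 1)) (s (k - 1))" using ran_s[of "k - 1"] by simp
qed (rule regular_pair_t)

interpretation degree: two_step "E (k - 1)" "E k" "E (k + 1)" "t (k - 1)" "s (k - 1)" "t k" "s k" for k
  by (rule two_step_complex)

lemma strong_hodge_iff_decomposes: "strong_hodge_decomposition E t \<longleftrightarrow> (\<forall>k. degree.decomposes k)"
  by (simp add: strong_hodge_decomposition_def degree.orthogonal_sum3_iff_decomposes)

theorem strong_hodge_iff_closed_ranges:
  "strong_hodge_decomposition E t \<longleftrightarrow> (\<forall>k. closed_range (E (k + 1)) (t k))"
proof
  assume "strong_hodge_decomposition E t"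
  then have "closed_range (E (k + 1)) (t (k + 1 - 1))" for k
    unfolding strong_hodge_iff_decomposes by (intro degree.closed_range_if_decomposes) blast
  then show "\<forall>k. closed_range (E (k + 1)) (t k)" by simp
next
  assume cl: "\<forall>k. closed_range (E (k + 1)) (t k)"
  have "degree.decomposes k" for k
  proof (rule degree.decomposes_if_closed_ranges)
    show "closed_range (E k) (t (k - 1))" using cl[rule_format, of "k - 1"] by simp
  qed (use cl hilbert_module_E in auto)
  then show "strong_hodge_decomposition E t" unfolding strong_hodge_iff_decomposes by blast
qed

lemma hilbert_family_parity:
  assumes fin: "finite_length E" and f: "\<And>k. \<bar>k\<bar> \<le> \<bar>f k\<bar> + 1"
  shows "hilbert_family (\<lambda>k::int. E (f k))"
proof (rule hilbert_family.intro)
  show "hilbert_module (E (f k))" for k by (rule hilbert_module_E)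
  obtain K where K: "\<And>k. \<bar>k\<bar> > K \<Longrightarrow> carrier (E k) = {\<zero>\<^bsub>E k\<^esub>}"
    using fin by (auto simp: finite_length_def)
  have "i \<in> {- (K + 1)..K + 1}" if "carrier (E (f i)) \<noteq> {\<zero>\<^bsub>E (f i)\<^esub>}" for i
  proof -
    have "\<bar>f i\<bar> \<le> K" using K[of "f i"] that by linarith
    then show ?thesis using f[of i] by auto
  qed
  then have "{i. carrier (E (f i)) \<noteq> {\<zero>\<^bsub>E (f i)\<^esub>}} \<subseteq> {- (K + 1)..K + 1}" by blast
  then show "finite {i. carrier (E (f i)) \<noteq> {\<zero>\<^bsub>E (f i)\<^esub>}}" by (rule finite_subset) simp
qed

lemma dirac_family_complex:
  assumes fin: "finite_length E"
  shows "dirac_family (\<lambda>k. E (2 * k)) (\<lambda>k. E (2 * k + 1)) (\<lambda>k. t (2 * k)) (\<lambda>k. s (2 * k))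
    (\<lambda>k. s (2 * k + 1)) (\<lambda>k. t (2 * k + 1)) (\<lambda>k. k + 1) (\<lambda>k. k - 1)"
proof (intro dirac_family.intro dirac_family_axioms.intro)
  show "hilbert_family (\<lambda>k. E (2 * k))" "hilbert_family (\<lambda>k. E (2 * k + 1))"
    by (rule hilbert_family_parity[OF fin], linarith)+
  fix k :: int
  have two: "2 * (k + 1) = 2 * k + 1 + 1" "2 * (k - 1) + 1 = 2 * k - 1" "2 * k + 2 = 2 * k + 1 + 1"
    by simp_all
  show "regular_pair (E (2 * k)) (E (2 * k + 1)) (t (2 * k)) (s (2 * k))" by (rule regular_pair_t)
  show "regular_pair (E (2 * (k + 1))) (E (2 * k + 1)) (s (2 * k + 1)) (t (2 * k + 1))"
    unfolding two by (rule regular_pair.swap_regular_pair[OF regular_pair_t])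
  show "ran_of (t (2 * k)) \<subseteq> ker_of (E (2 * (k + 1))) (t (2 * k + 1))"
    using ran_t[of "2 * k"] unfolding two .
  show "ran_of (s (2 * k + 1)) \<subseteq> ker_of (E (2 * k)) (s (2 * k))" by (rule ran_s)
  show "ran_of (s (2 * k)) \<subseteq> ker_of (E (2 * (k - 1) + 1)) (s (2 * (k - 1) + 1))"
    unfolding two using ran_s[of "2 * k - 1"] by simp
  show "ran_of (t (2 * k + 1)) \<subseteq> ker_of (E (2 * (k + 1) + 1)) (t (2 * (k + 1)))"
    using ran_t[of "2 * k + 1"] by (simp add: algebra_simps)
qed simp_all

lemma even_dirac_eq_dirac:
  "even_dirac E t = dirac (\<lambda>k. E (2 * k)) (\<lambda>k. E (2 * k + 1)) (\<lambda>k. t (2 * k))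
    (\<lambda>k. s (2 * k + 1)) (\<lambda>k. k + 1) (\<lambda>k. k - 1)"
proof -
  have "2 * (k - 1) + 1 = 2 * k - 1" for k :: int by simp
  then show ?thesis by (simp only: even_dirac_def dirac_def even_part_def)
qed

theorem strong_hodge_iff_closed_range_dirac:
  assumes fin: "finite_length E"
  shows "strong_hodge_decomposition E t \<longleftrightarrow> closed_range (odd_part E) (even_dirac E t)"
proof -
  interpret dirac_family "\<lambda>k. E (2 * k)" "\<lambda>k. E (2 * k + 1)" "\<lambda>k. t (2 * k)" "\<lambda>k. s (2 * k)"
      "\<lambda>k. s (2 * k + 1)" "\<lambda>k. t (2 * k + 1)" "\<lambda>k. k + 1" "\<lambda>k. k - 1"
    by (rule dirac_family_complex[OF fin])
  have even: "site.decomposes k \<longleftrightarrow> degree.decomposes (2 * k)" for k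
  proof -
    have "2 * (k - 1) + 1 = 2 * k - 1" by simp
    then show ?thesis by (simp only:)
  qed
  have odd: "two_step.decomposes (E (2 * (k + 1))) (E (2 * k + 1)) (E (2 * k)) (s (2 * k + 1))
      (t (2 * k + 1)) (s (2 * k)) (t (2 * k)) \<longleftrightarrow> degree.decomposes (2 * k + 1)" for k
  proof -
    have "2 * (k + 1) = 2 * k + 1 + 1" "2 * k = 2 * k + 1 - 1" by simp_all
    then show ?thesis using degree.swap_decomposes[of "2 * k + 1"] by (simp add: add.commute)
  qed
  have parity: "(\<forall>k. P k) \<longleftrightarrow> (\<forall>k. P (2 * k)) \<and> (\<forall>k. P (2 * k + 1))" for P :: "int \<Rightarrow> bool"
    by (metis evenE oddE)
  have "strong_hodge_decomposition E t \<longleftrightarrow>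
      (\<forall>k. site.decomposes k) \<and> (\<forall>k. two_step.decomposes (E (2 * (k + 1))) (E (2 * k + 1)) (E (2 * k))
        (s (2 * k + 1)) (t (2 * k + 1)) (s (2 * k)) (t (2 * k)))"
    unfolding strong_hodge_iff_decomposes even odd by (rule parity)
  also have "\<dots> \<longleftrightarrow> closed_range W.S D"
    using decomposes_if_closed_range_D closed_range_D_if_decomposes by blast
  finally show ?thesis unfolding even_dirac_eq_dirac odd_part_def .
qed

end

theorem theorem1p6:
  fixes E :: "int \<Rightarrow> ('a::cstar_algebra, 'e) hilbert_mod"
    and t :: "int \<Rightarrow> ('e, 'e) unbounded_op"
  assumes "hilbert_complex E t"
  shows "(strong_hodge_decomposition E t \<longleftrightarrow> (\<forall>k. closed_range (E (k + 1)) (t k))) \<and>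
    (finite_length E \<longrightarrow>
      (strong_hodge_decomposition E t \<longleftrightarrow> closed_range (odd_part E) (even_dirac E t)))"
  using strong_hodge_iff_closed_ranges[OF assms] strong_hodge_iff_closed_range_dirac[OF assms] by blast

end
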